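(* Assume the setting described in the context. Then $\Gamma$ is smooth out of the diagonal of $\mathbb{R}^{1+n}\times\mathbb{R}^{1+n}$.
   Context: Let $X_1,\dots,X_m$ be smooth vector fields on $\mathbb{R}^n$, linearly independent in the vector space of smooth vector fields, satisfying: (H.1) there are reals $1=\sigma_1\le\dots\le\sigma_n$ such that, with $\delta_\lambda(x)=(\lambda^{\sigma_1}x_1,\dots,\lambda^{\sigma_n}x_n)$, $X_j(f\circ\delta_\lambda)=\lambda(X_jf)\circ\delta_\lambda$ for all $\lambda>0$, $f\in C^\infty(\mathbb{R}^n)$; (H.2) $\dim\{Y(0):Y\in\mathrm{Lie}\{X_1,\dots,X_m\}\}=n$. Let $N=\dim\mathrm{Lie}\{X_1,\dots,X_m\}$, assume $N>n$, $p=N-n$. Fix a homogeneous Carnot group $\mathbb{G}=(\mathbb{R}^N,\star)$ on $\mathbb{R}^N=\mathbb{R}^n_x\times\mathbb{R}^p_\xi$ with dilations $D_\lambda(x,\xi)=(\delta_\lambda(x),\delta^*_\lambda(\xi))$, $\delta^*_\lambda(\xi)=(\lambda^{\sigma^*_1}\xi_1,\dots,\lambda^{\sigma^*_p}\xi_p)$, and left-invariant $D_\lambda$-homogeneous of degree 1 vector fields $Z_1,\dots,Z_m$ Lie-generating its Lie algebra with $Z_i(f\circ\pi)(x,\xi)=(X_if)(x)$ for $f\in C^\infty(\mathbb{R}^n)$, $\pi(x,\xi)=x$ (such objects exist). Let $\gamma_{\mathbb{G}}$ be the unique fundamental solution of $\sum_jZ_j^2-\partial_t$ on $\mathbb{R}^{1+N}$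 with pole at the origin vanishing at infinity, and $\Gamma(t,x;s,y)=\int_{\mathbb{R}^p}\gamma_{\mathbb{G}}(s-t,(x,0)^{-1}\star(y,\eta))\,d\eta$ for $(t,x),(s,y)\in\mathbb{R}^{1+n}$. *)

theory Defs
  imports "HOL-Analysis.Analysis"
begin

fun Ck_on :: "nat \<Rightarrow> 'a::euclidean_space set \<Rightarrow> ('a \<Rightarrow> real) \<Rightarrow> bool" where
  "Ck_on 0 S f = continuous_on S f"
| "Ck_on (Suc k) S f =
     (f differentiable_on S \<and> (\<forall>v\<in>Basis. Ck_on k S (\<lambda>x. frechet_derivative f (at x) v)))"

definition smooth_on :: "'a::euclidean_space set \<Rightarrow> ('a \<Rightarrow> real) \<Rightarrow> bool" where
  "smooth_on S f \<longleftrightarrow> (\<forall>k. Ck_on k S f)"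

definition smooth_map_on :: "'a::euclidean_space set \<Rightarrow> ('a \<Rightarrow> 'b::euclidean_space) \<Rightarrow> bool" where
  "smooth_map_on S F \<longleftrightarrow> (\<forall>i\<in>Basis. smooth_on S (\<lambda>x. F x \<bullet> i))"

definition vf_apply :: "('a::euclidean_space \<Rightarrow> 'a) \<Rightarrow> ('a \<Rightarrow> real) \<Rightarrow> 'a \<Rightarrow> real" where
  "vf_apply X f x = frechet_derivative f (at x) (X x)"

text \<open>Lie bracket [X,Y], so that [X,Y] f = X(Y f) - Y(X f).\<close>
definition lie_bracket :: "('a::euclidean_space \<Rightarrow> 'a) \<Rightarrow> ('a \<Rightarrow> 'a) \<Rightarrow> 'a \<Rightarrow> 'a" where
  "lie_bracket X Y x = frechet_derivative Y (at x) (X x) - frechet_derivative X (at x) (Y x)"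

inductive_set lie_gen :: "('a::euclidean_space \<Rightarrow> 'a) set \<Rightarrow> ('a \<Rightarrow> 'a) set" for G where
  base: "X \<in> G \<Longrightarrow> X \<in> lie_gen G"
| add: "X \<in> lie_gen G \<Longrightarrow> Y \<in> lie_gen G \<Longrightarrow> (\<lambda>x. X x + Y x) \<in> lie_gen G"
| scale: "X \<in> lie_gen G \<Longrightarrow> (\<lambda>x. c *\<^sub>R X x) \<in> lie_gen G"
| bracket: "X \<in> lie_gen G \<Longrightarrow> Y \<in> lie_gen G \<Longrightarrow> lie_bracket X Y \<in> lie_gen G"

definition fun_lin_indep :: "(nat \<Rightarrow> 'a \<Rightarrow> 'b::real_vector) \<Rightarrow> nat set \<Rightarrow> bool" where
  "fun_lin_indep F I \<longleftrightarrow>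
     (\<forall>c. (\<forall>x. (\<Sum>j\<in>I. c j *\<^sub>R F j x) = 0) \<longrightarrow> (\<forall>j\<in>I. c j = 0))"

definition fun_space_dim :: "('a \<Rightarrow> 'b::real_vector) set \<Rightarrow> nat \<Rightarrow> bool" where
  "fun_space_dim L N \<longleftrightarrow>
     (\<exists>F. (\<forall>j<N. F j \<in> L) \<and> fun_lin_indep F {..<N} \<and>
          (\<forall>Y\<in>L. \<exists>c. Y = (\<lambda>x. \<Sum>j<N. c j *\<^sub>R F j x)))"

definition dil :: "('i::finite \<Rightarrow> real) \<Rightarrow> real \<Rightarrow> real^'i \<Rightarrow> real^'i" where
  "dil \<sigma> r x = (\<chi> i. (r powr \<sigma> i) * x $ i)"

definition prod_dil :: "('i::finite \<Rightarrow> real) \<Rightarrow> ('j::finite \<Rightarrow> real) \<Rightarrow> real \<Rightarrow>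
    (real^'i) \<times> (real^'j) \<Rightarrow> (real^'i) \<times> (real^'j)" where
  "prod_dil \<sigma> \<sigma>s r w = (dil \<sigma> r (fst w), dil \<sigma>s r (snd w))"

definition grp_inv :: "('a \<Rightarrow> 'a \<Rightarrow> 'a) \<Rightarrow> 'a \<Rightarrow> 'a::zero" where
  "grp_inv star x = (THE y. star x y = 0 \<and> star y x = 0)"

text \<open>(R^N, star) is a Lie group with identity 0 and the dilations D are group automorphisms.
  (The stratification / Carnot condition is expressed in the main statement through the
  existence of the degree-one left-invariant Lie generators Z_1,...,Z_m.)\<close>
definition hom_lie_group :: "('a::euclidean_space \<Rightarrow> 'a \<Rightarrow> 'a) \<Rightarrow> (real \<Rightarrow> 'a \<Rightarrow> 'a) \<Rightarrow> bool" where
  "hom_lie_group star D \<longleftrightarrow>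
     (\<forall>x y z. star (star x y) z = star x (star y z)) \<and>
     (\<forall>x. star 0 x = x \<and> star x 0 = x) \<and>
     (\<forall>x. \<exists>y. star x y = 0 \<and> star y x = 0) \<and>
     smooth_map_on UNIV (\<lambda>(x, y). star x y) \<and>
     smooth_map_on UNIV (grp_inv star) \<and>
     (\<forall>r>0. \<forall>x y. D r (star x y) = star (D r x) (D r y))"

definition left_invariant :: "('a::euclidean_space \<Rightarrow> 'a \<Rightarrow> 'a) \<Rightarrow> ('a \<Rightarrow> 'a) \<Rightarrow> bool" where
  "left_invariant star Z \<longleftrightarrow>
     (\<forall>a f. smooth_on UNIV f \<longrightarrow>
        vf_apply Z (\<lambda>y. f (star a y)) = (\<lambda>y. vf_apply Z f (star a y)))"

definition group_lie_algebra :: "('a::euclidean_space \<Rightarrow> 'a \<Rightarrow> 'a) \<Rightarrow> ('a \<Rightarrow> 'a) set" where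
  "group_lie_algebra star = {Z. smooth_map_on UNIV Z \<and> left_invariant star Z}"

definition homogeneous_deg1 :: "(real \<Rightarrow> 'a \<Rightarrow> 'a) \<Rightarrow> ('a::euclidean_space \<Rightarrow> 'a) \<Rightarrow> bool" where
  "homogeneous_deg1 D Z \<longleftrightarrow>
     (\<forall>r>0. \<forall>f. smooth_on UNIV f \<longrightarrow>
        vf_apply Z (f \<circ> D r) = (\<lambda>x. r * vf_apply Z f (D r x)))"

definition vf_space :: "('a::euclidean_space \<Rightarrow> 'a) \<Rightarrow> (real \<times> 'a \<Rightarrow> real) \<Rightarrow> real \<times> 'a \<Rightarrow> real" where
  "vf_space Z \<phi> w = vf_apply Z (\<lambda>z. \<phi> (fst w, z)) (snd w)"

definition dt :: "(real \<times> 'a \<Rightarrow> real) \<Rightarrow> real \<times> 'a \<Rightarrow> real" where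
  "dt \<phi> w = deriv (\<lambda>s. \<phi> (s, snd w)) (fst w)"

definition test_function :: "('a::euclidean_space \<Rightarrow> real) \<Rightarrow> bool" where
  "test_function \<phi> \<longleftrightarrow> smooth_on UNIV \<phi> \<and> compact (closure {w. \<phi> w \<noteq> 0})"

text \<open>gamma is a fundamental solution of H = sum_j Z_j^2 - d/dt with pole at the origin, vanishing
  at infinity: smooth off the origin, locally integrable, tends to 0 at infinity and
  H gamma = - Dirac_0 in the sense of distributions. Since left-invariant vector fields on a
  homogeneous group are divergence free, the formal transpose of H is sum_j Z_j^2 + d/dt.\<close>
definition heat_fundamental_solution ::
  "(nat \<Rightarrow> 'a::euclidean_space \<Rightarrow> 'a) \<Rightarrow> nat \<Rightarrow> (real \<times> 'a \<Rightarrow> real) \<Rightarrow> bool" where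
  "heat_fundamental_solution Z m \<gamma> \<longleftrightarrow>
     smooth_on (UNIV - {0}) \<gamma> \<and>
     (\<forall>K. compact K \<longrightarrow> set_integrable lborel K \<gamma>) \<and>
     (\<gamma> \<longlongrightarrow> 0) at_infinity \<and>
     (\<forall>\<phi>. test_function \<phi> \<longrightarrow>
        (\<integral>w. \<gamma> w * ((\<Sum>j=1..m. vf_space (Z j) (vf_space (Z j) \<phi>) w) + dt \<phi> w) \<partial>lborel)
          = - \<phi> 0)"

definition Gamma_kernel ::
  "((real^'n) \<times> (real^'p) \<Rightarrow> (real^'n) \<times> (real^'p) \<Rightarrow> (real^'n) \<times> (real^'p)) \<Rightarrow>
   (real \<times> ((real^'n) \<times> (real^'p)) \<Rightarrow> real) \<Rightarrow>
   real \<times> (real^'n) \<Rightarrow> real \<times> (real^'n) \<Rightarrow> real" where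
  "Gamma_kernel star \<gamma> tx sy =
     (\<integral>\<eta>. \<gamma> (fst sy - fst tx, star (grp_inv star (snd tx, 0)) (snd sy, \<eta>)) \<partial>lborel)"

end

theory Submission
  imports Defs
begin

text \<open>
  The decay of \<open>\<gamma>\<close> that makes the fibre integral smooth comes from homogeneity:
  \<open>\<gamma> (r\<^sup>2 t, D\<^sub>r z) = r powr (- Q) * \<gamma> (t, z)\<close> with \<open>Q\<close> the homogeneous dimension of the group.
  Both \<open>\<gamma>\<close> and its rescalings are fundamental solutions, so homogeneity is a uniqueness statement:
  a locally integrable distributional solution \<open>u\<close> of the heat equation that is continuous off the
  origin and tends to \<open>0\<close> at infinity vanishes off the origin. Hypoellipticity is not needed for this. For
  a test function \<open>\<phi>\<close> put \<open>v z = \<integral>y. u y * \<phi> (z y\<^sup>-\<^sup>1)\<close>. For a left-invariant field \<open>V\<close>, the kernel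
  \<open>\<Psi> (z, y) = \<phi> (z y\<^sup>-\<^sup>1)\<close> is constant along \<open>w \<mapsto> (z w, y w)\<close>, so \<open>V\<close> acting on \<open>z\<close> equals \<open>- V\<close> acting on \<open>y\<close>.
  The heat operator in \<open>z\<close> therefore becomes its adjoint in \<open>y\<close>, and \<open>v\<close> is a classical
  solution. It tends to \<open>0\<close> at infinity because right translates of a compact set have
  bounded volume, hence it vanishes by the maximum principle; letting \<open>\<phi>\<close> run through bump functions gives \<open>u = 0\<close>.

  The integrand \<open>\<gamma> (s - t, (x, 0)\<^sup>-\<^sup>1 (y, \<eta>))\<close> is then smooth and homogeneous of degree \<open>- Q\<close> in \<open>(t, x, s, y, \<eta>)\<close> off the set
  \<open>(t, x) = (s, y), \<eta> = 0\<close>. Its derivatives in \<open>(t, x, s, y)\<close> are homogeneous of even lower degree, so locally uniformly off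
  the diagonal they are dominated by an integrable function of \<open>\<eta>\<close>.
\<close>

section \<open>Calculus of smooth functions\<close>

text \<open>The degree \<open>- Q\<close> is forced by scaling: the heat operator lowers degrees by
  two, and the Dirac mass on space-time has degree \<open>- (Q + 2)\<close>. For this count time is
  treated as one more group coordinate of weight 2, so that space-time is itself a homogeneous
  group. The fibre integral converges because the weights of \<open>\<eta>\<close> sum to less than
  \<open>Q\<close>, the weights of \<open>x\<close> being left over.

  Two obstacles shape the rest. The group law is given only as smooth and compatible with dilations,
  so invariance of Lebesgue measure under translations is not at hand; a volume bound that is
  uniform in the translating point replaces it, and dilations reduce this bound to a Lipschitz
  estimate on one compact set. Moreover, smoothness means that all iterated derivatives along basis
  vectors exist, so differentiation under the integral is organised by families of integrands that
  are closed under these derivatives and locally dominated. Two such families occur: kernels with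
  proper support, and functions homogeneous of sufficiently negative degree.\<close>

lemma Ck_on_cong:
  assumes "open S" "\<And>x. x \<in> S \<Longrightarrow> f x = g x"
  shows "Ck_on k S f \<longleftrightarrow> Ck_on k S g"
  using assms(2)
proof (induction k arbitrary: f g)
  case 0
  then show ?case by (auto intro: continuous_on_cong[THEN iffD1])
next
  case (Suc k)
  have eq: "frechet_derivative f (at x) = frechet_derivative g (at x)" if "x \<in> S" for x
  proof -
    have "(f has_derivative F) (at x) \<longleftrightarrow> (g has_derivative F) (at x)" for F
      using has_derivative_transform_within_open[OF _ assms(1) that, of f F UNIV g]
        has_derivative_transform_within_open[OF _ assms(1) that, of g F UNIV f] Suc.prems
      by auto
    then show ?thesis by (simp add: frechet_derivative_def)
  qed
  have d: "f differentiable_on S \<longleftrightarrow> g differentiable_on S"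
    using differentiable_on_eq_differentiable_at[OF assms(1)]
    by (metis (no_types, lifting) Suc.prems differentiable_on_def differentiable_transform_within
        linordered_field_no_ub zero_less_one)
  have "Ck_on k S (\<lambda>x. frechet_derivative f (at x) v) \<longleftrightarrow> Ck_on k S (\<lambda>x. frechet_derivative g (at x) v)" for v
    by (rule Suc.IH) (simp add: eq)
  with d show ?case by simp
qed

text \<open>\<open>frechet_derivative\<close> is defined by choice; this rule lets later inductions
  on the order work with an explicit derivative \<open>f'\<close> instead.\<close>

lemma Ck_on_SucI:
  assumes "open S" "\<And>x. x \<in> S \<Longrightarrow> (f has_derivative f' x) (at x)"
    "\<And>v. v \<in> Basis \<Longrightarrow> Ck_on k S (\<lambda>x. f' x v)"
  shows "Ck_on (Suc k) S f"
proof -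
  have "frechet_derivative f (at x) = f' x" if "x \<in> S" for x
    using frechet_derivative_at[OF assms(2)[OF that]] by simp
  then have "Ck_on k S (\<lambda>x. frechet_derivative f (at x) v)" if "v \<in> Basis" for v
    using assms(3)[OF that] Ck_on_cong[OF assms(1), of "\<lambda>x. frechet_derivative f (at x) v" "\<lambda>x. f' x v"]
    by auto
  moreover have "f differentiable_on S"
    using assms(1,2) by (meson differentiable_at_imp_differentiable_on differentiable_def)
  ultimately show ?thesis by simp
qed

lemma Ck_on_SucD: "Ck_on (Suc k) S f \<Longrightarrow> Ck_on k S f"
  by (induction k arbitrary: f) (auto intro: differentiable_imp_continuous_on)

lemma Ck_on_Suc_has_derivative:
  assumes "Ck_on (Suc k) S f" "open S" "x \<in> S"
  shows "(f has_derivative frechet_derivative f (at x)) (at x)"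
  using assms differentiable_on_eq_differentiable_at[OF assms(2), of f]
  by (simp add: frechet_derivative_works[symmetric])

lemma frechet_derivative_Basis_sum:
  fixes f :: "'a::euclidean_space \<Rightarrow> 'b::real_normed_vector"
  assumes "f differentiable at x"
  shows "frechet_derivative f (at x) v = (\<Sum>b\<in>Basis. (v \<bullet> b) *\<^sub>R frechet_derivative f (at x) b)"
proof -
  have "frechet_derivative f (at x) (\<Sum>b\<in>Basis. (v \<bullet> b) *\<^sub>R b)
      = (\<Sum>b\<in>Basis. (v \<bullet> b) *\<^sub>R frechet_derivative f (at x) b)"
    using linear_frechet_derivative[OF assms] by (simp add: linear_sum linear_scale)
  then show ?thesis by (simp add: euclidean_representation)
qed

lemma Ck_on_const [simp]: "Ck_on k S (\<lambda>x. c)"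
  by (induction k arbitrary: c) auto

lemma Ck_on_add:
  assumes "open S"
  shows "Ck_on k S f \<Longrightarrow> Ck_on k S g \<Longrightarrow> Ck_on k S (\<lambda>x. f x + g x)"
proof (induction k arbitrary: f g)
  case 0
  then show ?case by (simp add: continuous_on_add)
next
  case (Suc k)
  show ?case
  proof (rule Ck_on_SucI[OF assms])
    fix x assume "x \<in> S"
    then show "((\<lambda>x. f x + g x) has_derivative
        (\<lambda>v. frechet_derivative f (at x) v + frechet_derivative g (at x) v)) (at x)"
      using Suc.prems assms by (intro has_derivative_add Ck_on_Suc_has_derivative)
  qed (use Suc in auto)
qed

lemma Ck_on_mult:
  assumes "open S"
  shows "Ck_on k S f \<Longrightarrow> Ck_on k S g \<Longrightarrow> Ck_on k S (\<lambda>x. f x * g x)"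
proof (induction k arbitrary: f g)
  case 0
  then show ?case by (simp add: continuous_on_mult)
next
  case (Suc k)
  show ?case
  proof (rule Ck_on_SucI[OF assms])
    fix x assume "x \<in> S"
    then show "((\<lambda>x. f x * g x) has_derivative
        (\<lambda>v. f x * frechet_derivative g (at x) v + frechet_derivative f (at x) v * g x)) (at x)"
      using Suc.prems assms by (intro has_derivative_mult Ck_on_Suc_has_derivative)
  next
    fix v :: 'a assume "v \<in> Basis"
    then show "Ck_on k S (\<lambda>x. f x * frechet_derivative g (at x) v + frechet_derivative f (at x) v * g x)"
      using Suc.prems Suc.IH Ck_on_SucD[OF Suc.prems(1)] Ck_on_SucD[OF Suc.prems(2)]
      by (intro Ck_on_add assms Suc.IH) auto
  qed
qed

lemma Ck_on_sum:
  assumes "open S" "\<And>i. i \<in> I \<Longrightarrow> Ck_on k S (f i)"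
  shows "Ck_on k S (\<lambda>x. \<Sum>i\<in>I. f i x)"
  using assms(2) by (induction I rule: infinite_finite_induct) (auto intro: Ck_on_add[OF assms(1)])

lemma Ck_on_bounded_linear:
  assumes "bounded_linear f"
  shows "Ck_on k S f"
proof (cases k)
  case 0
  then show ?thesis
    using assms by (simp add: linear_continuous_on)
next
  case (Suc l)
  have "frechet_derivative f (at x) = f" for x
    using bounded_linear_imp_has_derivative[OF assms, of "at x"] frechet_derivative_at by metis
  then show ?thesis
    using Suc assms by (simp add: bounded_linear_imp_differentiable_on)
qed

lemma has_derivative_componentwise_at:
  fixes g :: "'a::euclidean_space \<Rightarrow> 'b::euclidean_space"
  assumes "\<And>b. b \<in> Basis \<Longrightarrow> (\<lambda>x. g x \<bullet> b) differentiable at x"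
  shows "(g has_derivative (\<lambda>v. \<Sum>b\<in>Basis. frechet_derivative (\<lambda>x. g x \<bullet> b) (at x) v *\<^sub>R b)) (at x)"
proof (subst has_derivative_componentwise_within, intro ballI)
  fix b :: 'b assume b: "b \<in> Basis"
  have "(\<lambda>v. (\<Sum>c\<in>Basis. frechet_derivative (\<lambda>x. g x \<bullet> c) (at x) v *\<^sub>R c) \<bullet> b) = frechet_derivative (\<lambda>x. g x \<bullet> b) (at x)"
    using b by (auto simp: inner_sum_left inner_Basis if_distrib cong: if_cong)
  then show "((\<lambda>x. g x \<bullet> b) has_derivative (\<lambda>v. (\<Sum>c\<in>Basis. frechet_derivative (\<lambda>x. g x \<bullet> c) (at x) v *\<^sub>R c) \<bullet> b)) (at x)"
    using assms[OF b] frechet_derivative_works by auto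
qed

text \<open>The chain rule writes each basis derivative of the composition as a sum of products of a
  derivative of a component of \<open>g\<close> with a basis derivative of \<open>f\<close> composed
  with \<open>g\<close>. The induction therefore keeps \<open>g\<close> fixed and varies
  \<open>f\<close>; the hypothesis on \<open>g\<close> is lowered by one order to apply it.\<close>

lemma Ck_on_compose:
  fixes f :: "'b::euclidean_space \<Rightarrow> real" and g :: "'a::euclidean_space \<Rightarrow> 'b"
  assumes "open S" "open T" "g ` T \<subseteq> S"
  shows "Ck_on k S f \<Longrightarrow> (\<And>b. b \<in> Basis \<Longrightarrow> Ck_on k T (\<lambda>x. g x \<bullet> b)) \<Longrightarrow> Ck_on k T (\<lambda>x. f (g x))"
proof (induction k arbitrary: f)
  case 0
  have "continuous_on T g"
    using 0 by (simp add: continuous_on_componentwise[of T g])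
  then show ?case
    using 0 assms by (simp add: continuous_on_compose2)
next
  case (Suc k)
  let ?g' = "\<lambda>b x v. frechet_derivative (\<lambda>x. g x \<bullet> b) (at x) v"
  let ?f' = "\<lambda>b y. frechet_derivative f (at y) b"
  show ?case
  proof (rule Ck_on_SucI[OF assms(2)])
    fix x assume x: "x \<in> T"
    have fd: "(f has_derivative frechet_derivative f (at (g x))) (at (g x))"
      using Suc.prems(1) assms x by (intro Ck_on_Suc_has_derivative) auto
    have "(g has_derivative (\<lambda>v. \<Sum>b\<in>Basis. ?g' b x v *\<^sub>R b)) (at x)"
      using Ck_on_Suc_has_derivative[OF Suc.prems(2) assms(2) x]
      by (intro has_derivative_componentwise_at) (auto simp: differentiable_def)
    from has_derivative_compose[OF this fd]
    have "((\<lambda>x. f (g x)) has_derivative (\<lambda>v. frechet_derivative f (at (g x)) (\<Sum>b\<in>Basis. ?g' b x v *\<^sub>R b))) (at x)" .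
    moreover have "frechet_derivative f (at (g x)) (\<Sum>b\<in>Basis. ?g' b x v *\<^sub>R b) = (\<Sum>b\<in>Basis. ?g' b x v * ?f' b (g x))" for v
      using has_derivative_linear[OF fd] by (simp add: linear_sum linear_scale)
    ultimately show "((\<lambda>x. f (g x)) has_derivative (\<lambda>v. \<Sum>b\<in>Basis. ?g' b x v * ?f' b (g x))) (at x)"
      by simp
  next
    fix v :: 'a assume v: "v \<in> Basis"
    show "Ck_on k T (\<lambda>x. \<Sum>b\<in>Basis. ?g' b x v * ?f' b (g x))"
    proof (intro Ck_on_sum Ck_on_mult assms)
      fix b :: 'b assume b: "b \<in> Basis"
      show "Ck_on k T (\<lambda>x. ?g' b x v)"
        using Suc.prems(2)[OF b] v by simp
      show "Ck_on k T (\<lambda>x. ?f' b (g x))"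
      proof (rule Suc.IH)
        show "Ck_on k S (?f' b)"
          using Suc.prems(1) b by simp
      qed (rule Ck_on_SucD[OF Suc.prems(2)])
    qed
  qed
qed

lemma smooth_on_cong:
  "open S \<Longrightarrow> (\<And>x. x \<in> S \<Longrightarrow> f x = g x) \<Longrightarrow> smooth_on S f \<longleftrightarrow> smooth_on S g"
  by (simp add: smooth_on_def Ck_on_cong[of S f g])

lemma smooth_on_const [simp]: "smooth_on S (\<lambda>x. c)"
  by (simp add: smooth_on_def)

lemma smooth_on_add: "open S \<Longrightarrow> smooth_on S f \<Longrightarrow> smooth_on S g \<Longrightarrow> smooth_on S (\<lambda>x. f x + g x)"
  by (simp add: smooth_on_def Ck_on_add)

lemma smooth_on_mult: "open S \<Longrightarrow> smooth_on S f \<Longrightarrow> smooth_on S g \<Longrightarrow> smooth_on S (\<lambda>x. f x * g x)"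
  by (simp add: smooth_on_def Ck_on_mult)

lemma smooth_on_minus: "open S \<Longrightarrow> smooth_on S f \<Longrightarrow> smooth_on S (\<lambda>x. - f x)"
  using smooth_on_mult[of S "\<lambda>_. -1" f] by simp

lemma smooth_on_sum:
  "open S \<Longrightarrow> (\<And>i. i \<in> I \<Longrightarrow> smooth_on S (f i)) \<Longrightarrow> smooth_on S (\<lambda>x. \<Sum>i\<in>I. f i x)"
  by (simp add: smooth_on_def Ck_on_sum)

lemma smooth_on_bounded_linear: "bounded_linear f \<Longrightarrow> smooth_on S f"
  by (simp add: smooth_on_def Ck_on_bounded_linear)

lemma smooth_on_compose:
  assumes "smooth_on S f" "smooth_map_on T g" "open S" "open T" "g ` T \<subseteq> S"
  shows "smooth_on T (\<lambda>x. f (g x))"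
  using assms Ck_on_compose[OF assms(3-5)] by (auto simp: smooth_on_def smooth_map_on_def)

lemma smooth_map_on_compose:
  assumes "smooth_map_on S f" "smooth_map_on T g" "open S" "open T" "g ` T \<subseteq> S"
  shows "smooth_map_on T (\<lambda>x. f (g x))"
  unfolding smooth_map_on_def
proof
  fix i :: 'b assume "i \<in> Basis"
  with assms show "smooth_on T (\<lambda>x. f (g x) \<bullet> i)"
    by (intro smooth_on_compose[OF _ assms(2-5)]) (auto simp: smooth_map_on_def)
qed

lemma smooth_map_on_bounded_linear: "bounded_linear f \<Longrightarrow> smooth_map_on S f"
  unfolding smooth_map_on_def
  by (auto intro!: smooth_on_bounded_linear bounded_linear_compose[OF bounded_linear_inner_left])

lemma smooth_map_on_const [simp]: "smooth_map_on S (\<lambda>x. c)"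
  by (simp add: smooth_map_on_def)

lemma smooth_map_on_Pair:
  assumes "smooth_map_on S f" "smooth_map_on S g"
  shows "smooth_map_on S (\<lambda>x. (f x, g x))"
  using assms unfolding smooth_map_on_def Basis_prod_def by (auto simp: inner_Pair)

lemma smooth_map_on_real_iff: "smooth_map_on S (f :: _ \<Rightarrow> real) \<longleftrightarrow> smooth_on S f"
  by (simp add: smooth_map_on_def)

lemma smooth_map_on_fst: "smooth_map_on S f \<Longrightarrow> smooth_map_on S (\<lambda>x. fst (f x))"
  unfolding smooth_map_on_def
proof
  fix b :: 'b assume a: "\<forall>i\<in>Basis. smooth_on S (\<lambda>x. f x \<bullet> i)" "b \<in> Basis"
  then have "smooth_on S (\<lambda>x. f x \<bullet> (b, 0))" by (auto simp: Basis_prod_def)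
  then show "smooth_on S (\<lambda>x. fst (f x) \<bullet> b)" by (simp add: inner_prod_def)
qed

lemma smooth_map_on_snd: "smooth_map_on S f \<Longrightarrow> smooth_map_on S (\<lambda>x. snd (f x))"
  unfolding smooth_map_on_def
proof
  fix b :: 'c assume a: "\<forall>i\<in>Basis. smooth_on S (\<lambda>x. f x \<bullet> i)" "b \<in> Basis"
  then have "smooth_on S (\<lambda>x. f x \<bullet> (0, b))" by (auto simp: Basis_prod_def)
  then show "smooth_on S (\<lambda>x. snd (f x) \<bullet> b)" by (simp add: inner_prod_def)
qed

lemma smooth_on_has_derivative:
  "smooth_on S f \<Longrightarrow> open S \<Longrightarrow> x \<in> S \<Longrightarrow> (f has_derivative frechet_derivative f (at x)) (at x)"
  unfolding smooth_on_def by (meson Ck_on_Suc_has_derivative)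

lemma smooth_on_differentiable:
  "smooth_on S f \<Longrightarrow> open S \<Longrightarrow> x \<in> S \<Longrightarrow> f differentiable at x"
  using smooth_on_has_derivative differentiable_def by blast

lemma smooth_on_imp_continuous_on: "smooth_on S f \<Longrightarrow> continuous_on S f"
  unfolding smooth_on_def by (metis Ck_on.simps(1))

lemma smooth_map_on_imp_continuous_on: "smooth_map_on S f \<Longrightarrow> continuous_on S f"
  by (subst continuous_on_componentwise)
    (auto simp: smooth_map_on_def intro: smooth_on_imp_continuous_on)

lemma smooth_map_on_differentiable:
  fixes f :: "'a::euclidean_space \<Rightarrow> 'b::euclidean_space"
  shows "smooth_map_on S f \<Longrightarrow> open S \<Longrightarrow> x \<in> S \<Longrightarrow> f differentiable at x"
  using has_derivative_componentwise_at[of f x] smooth_on_differentiable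
  unfolding smooth_map_on_def differentiable_def by blast

lemma smooth_on_frechet_derivative_Basis:
  "smooth_on S f \<Longrightarrow> v \<in> Basis \<Longrightarrow> smooth_on S (\<lambda>x. frechet_derivative f (at x) v)"
  unfolding smooth_on_def by (metis Ck_on.simps(2))

text \<open>\<open>smooth_on\<close> controls derivatives along constant basis vectors only, so the
  varying direction \<open>V x\<close> is expanded in the basis with smooth coefficients.\<close>

lemma smooth_on_vf_apply:
  assumes "smooth_on S f" "smooth_map_on S V" "open S"
  shows "smooth_on S (\<lambda>x. frechet_derivative f (at x) (V x))"
proof -
  have "smooth_on S (\<lambda>x. \<Sum>b\<in>Basis. (V x \<bullet> b) * frechet_derivative f (at x) b)"
    using assms by (intro smooth_on_sum smooth_on_mult smooth_on_frechet_derivative_Basis)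
      (auto simp: smooth_map_on_def)
  then show ?thesis
    using frechet_derivative_Basis_sum[OF smooth_on_differentiable[OF assms(1,3)]] assms(3)
      smooth_on_cong[OF assms(3)]
    by (smt (verit, best) real_scaleR_def sum.cong)
qed

section \<open>Symmetry of second derivatives\<close>

lemma smooth_on_line_derivative:
  fixes g :: "'a::euclidean_space \<Rightarrow> real"
  assumes g: "smooth_on UNIV g"
  shows "((\<lambda>t. g (p + t *\<^sub>R q)) has_real_derivative frechet_derivative g (at (p + t *\<^sub>R q)) q) (at t)"
proof -
  have gd: "(g has_derivative frechet_derivative g (at (p + t *\<^sub>R q))) (at (p + t *\<^sub>R q))"
    using smooth_on_has_derivative[OF g] by simp
  have "((\<lambda>t. p + t *\<^sub>R q) has_derivative (\<lambda>h. h *\<^sub>R q)) (at t)"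
    by (auto intro!: derivative_eq_intros)
  from has_derivative_compose[OF this gd]
  have "((\<lambda>t. g (p + t *\<^sub>R q)) has_derivative (\<lambda>h. frechet_derivative g (at (p + t *\<^sub>R q)) (h *\<^sub>R q))) (at t)" .
  moreover have "(\<lambda>h. frechet_derivative g (at (p + t *\<^sub>R q)) (h *\<^sub>R q)) = (*) (frechet_derivative g (at (p + t *\<^sub>R q)) q)"
    using has_derivative_linear[OF gd] by (auto simp: linear_scale)
  ultimately show ?thesis by (simp add: has_field_derivative_def)
qed

text \<open>Both mixed derivatives are the limit of the same second difference quotient.\<close>

lemma second_difference_mvt:
  fixes f :: "'a::euclidean_space \<Rightarrow> real"
  assumes f: "smooth_on UNIV f" and s: "s > 0"
  shows "\<exists>a b. 0 < a \<and> a < s \<and> 0 < b \<and> b < s \<and>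
     f (x + s *\<^sub>R v + s *\<^sub>R w) - f (x + s *\<^sub>R v) - (f (x + s *\<^sub>R w) - f x)
     = s * s * frechet_derivative (\<lambda>y. frechet_derivative f (at y) v) (at (x + a *\<^sub>R v + b *\<^sub>R w)) w"
proof -
  let ?\<phi> = "\<lambda>t. f (x + s *\<^sub>R w + t *\<^sub>R v) - f (x + t *\<^sub>R v)"
  let ?h = "\<lambda>y. frechet_derivative f (at y) v"
  have h: "smooth_on UNIV ?h"
    by (rule smooth_on_vf_apply[OF f]) auto
  \<comment> \<open>The mean value theorem is applied in direction \<open>v\<close> to the increment
    of \<open>f\<close> in direction \<open>w\<close>, and afterwards in direction \<open>w\<close>
    to the resulting increment of the derivative \<open>?h\<close>.\<close>
  obtain a where a: "0 < a" "a < s" and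
    ae: "?\<phi> s - ?\<phi> 0 = (s - 0) * (?h (x + s *\<^sub>R w + a *\<^sub>R v) - ?h (x + a *\<^sub>R v))"
    using MVT2[OF s, of ?\<phi> "\<lambda>t. ?h (x + s *\<^sub>R w + t *\<^sub>R v) - ?h (x + t *\<^sub>R v)"]
      DERIV_diff[OF smooth_on_line_derivative[OF f] smooth_on_line_derivative[OF f]] by blast
  obtain b where b: "0 < b" "b < s" and
    be: "?h (x + a *\<^sub>R v + s *\<^sub>R w) - ?h (x + a *\<^sub>R v + 0 *\<^sub>R w)
      = (s - 0) * frechet_derivative ?h (at (x + a *\<^sub>R v + b *\<^sub>R w)) w"
    using MVT2[OF s, of "\<lambda>t. ?h (x + a *\<^sub>R v + t *\<^sub>R w)" "\<lambda>t. frechet_derivative ?h (at (x + a *\<^sub>R v + t *\<^sub>R w)) w"] smooth_on_line_derivative[OF h]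
    by blast
  show ?thesis
    using a b ae be by (intro exI[of _ a] exI[of _ b]) (auto simp: algebra_simps)
qed

lemma frechet_derivative_commute:
  fixes f :: "'a::euclidean_space \<Rightarrow> real"
  assumes f: "smooth_on UNIV f"
  shows "frechet_derivative (\<lambda>y. frechet_derivative f (at y) v) (at x) w
       = frechet_derivative (\<lambda>y. frechet_derivative f (at y) w) (at x) v"
proof -
  define e where "e n = inverse (real (Suc n))" for n
  have e: "e n > 0" for n by (simp add: e_def)
  have e_lim: "e \<longlonglongrightarrow> 0"
    using LIMSEQ_inverse_real_of_nat by (simp add: e_def[abs_def])
  have key: "((\<lambda>n. (f (x + e n *\<^sub>R v + e n *\<^sub>R w) - f (x + e n *\<^sub>R v)
      - (f (x + e n *\<^sub>R w) - f x)) / (e n * e n))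
      \<longlonglongrightarrow> frechet_derivative (\<lambda>y. frechet_derivative f (at y) v) (at x) w)" for v w
  proof -
    let ?h = "\<lambda>z. frechet_derivative (\<lambda>y. frechet_derivative f (at y) v) (at z) w"
    have "smooth_on UNIV ?h"
      by (intro smooth_on_vf_apply f) auto
    then have cont: "isCont ?h x"
      using smooth_on_imp_continuous_on continuous_on_eq_continuous_at by blast
    have "\<forall>n. \<exists>a b. 0 < a \<and> a < e n \<and> 0 < b \<and> b < e n \<and>
      f (x + e n *\<^sub>R v + e n *\<^sub>R w) - f (x + e n *\<^sub>R v)
      - (f (x + e n *\<^sub>R w) - f x)
      = e n * e n * ?h (x + a *\<^sub>R v + b *\<^sub>R w)"
      using second_difference_mvt[OF f e] by blast
    then obtain a b where ab: "\<And>n. 0 < a n \<and> a n < e n \<and> 0 < b n \<and> b n < e n \<and>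
      f (x + e n *\<^sub>R v + e n *\<^sub>R w) - f (x + e n *\<^sub>R v)
      - (f (x + e n *\<^sub>R w) - f x)
      = e n * e n * ?h (x + a n *\<^sub>R v + b n *\<^sub>R w)"
      by metis
    have "a \<longlonglongrightarrow> 0" "b \<longlonglongrightarrow> 0"
      using ab by (auto intro!: tendsto_sandwich[OF _ _ tendsto_const e_lim] simp: less_imp_le)
    then have "(\<lambda>n. x + a n *\<^sub>R v + b n *\<^sub>R w) \<longlonglongrightarrow> x + 0 *\<^sub>R v + 0 *\<^sub>R w"
      by (intro tendsto_intros)
    then have "(\<lambda>n. ?h (x + a n *\<^sub>R v + b n *\<^sub>R w)) \<longlonglongrightarrow> ?h x"
      using cont by (auto intro: isCont_tendsto_compose)
    moreover have "e n \<noteq> 0" for n using e[of n] by simp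
    ultimately show ?thesis by (simp add: ab)
  qed
  \<comment> \<open>The second difference does not change when \<open>v\<close> and \<open>w\<close>
    are exchanged, so the two limits in \<open>key\<close> are limits of one sequence.\<close>
  have eq: "f (x + s *\<^sub>R v + s *\<^sub>R w) - f (x + s *\<^sub>R v) - (f (x + s *\<^sub>R w) - f x)
      = f (x + s *\<^sub>R w + s *\<^sub>R v) - f (x + s *\<^sub>R w) - (f (x + s *\<^sub>R v) - f x)" for s
    by (simp add: algebra_simps)
  show ?thesis
    using LIMSEQ_unique[OF key[of v w] key[of w v, folded eq]] .
qed

section \<open>Differentiation under the integral sign\<close>

text \<open>The remainder of the first-order expansion, divided by the norm of the increment, tends
  to 0 pointwise in \<open>\<eta>\<close> and is dominated by twice the bound on the derivative, by
  the mean value inequality on the ball. Dominated convergence then gives the limit of the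
  integrals.\<close>

lemma has_derivative_integral_dominated:
  fixes F :: "'a::euclidean_space \<Rightarrow> 'b \<Rightarrow> real"
  assumes e: "e > 0"
    and int: "\<And>x. x \<in> ball x0 e \<Longrightarrow> integrable M (F x)"
    and der: "\<And>x \<eta>. x \<in> ball x0 e \<Longrightarrow> \<eta> \<in> space M \<Longrightarrow> ((\<lambda>x. F x \<eta>) has_derivative F' x \<eta>) (at x)"
    and meas: "\<And>v. v \<in> Basis \<Longrightarrow> (\<lambda>\<eta>. F' x0 \<eta> v) \<in> borel_measurable M"
    and g: "integrable M g"
    and bd: "\<And>x \<eta> v. x \<in> ball x0 e \<Longrightarrow> \<eta> \<in> space M \<Longrightarrow> v \<in> Basis \<Longrightarrow> \<bar>F' x \<eta> v\<bar> \<le> g \<eta>"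
  shows "((\<lambda>x. \<integral>\<eta>. F x \<eta> \<partial>M) has_derivative (\<lambda>v. \<integral>\<eta>. F' x0 \<eta> v \<partial>M)) (at x0)"
proof -
  \<comment> \<open>\<open>g\<close> bounds the derivative along each basis vector; summing over the
    basis bounds the operator norm at the cost of a factor \<open>DIM('a)\<close>.\<close>
  define G where "G \<eta> = real DIM('a) * g \<eta>" for \<eta>
  have G: "integrable M G" using g by (simp add: G_def[abs_def])
  have x0: "x0 \<in> ball x0 e" using e by simp
  have lin: "linear (F' x \<eta>)" if "x \<in> ball x0 e" "\<eta> \<in> space M" for x \<eta>
    using der[OF that] has_derivative_linear by blast
  have expand: "F' x \<eta> v = (\<Sum>b\<in>Basis. (v \<bullet> b) * F' x \<eta> b)" if "x \<in> ball x0 e" "\<eta> \<in> space M" for x \<eta> v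
    using arg_cong[OF euclidean_representation[of v], of "F' x \<eta>"] lin[OF that]
    by (simp add: linear_sum linear_scale)
  have bound: "\<bar>F' x \<eta> v\<bar> \<le> G \<eta> * norm v" if "x \<in> ball x0 e" "\<eta> \<in> space M" for x \<eta> v
  proof -
    have "\<bar>F' x \<eta> v\<bar> \<le> (\<Sum>b\<in>Basis. \<bar>(v \<bullet> b) * F' x \<eta> b\<bar>)"
      unfolding expand[OF that, of v] by (rule sum_abs)
    also have "\<dots> \<le> (\<Sum>b\<in>(Basis::'a set). norm v * g \<eta>)"
      using bd[OF that] by (intro sum_mono) (auto simp: abs_mult intro!: mult_mono Basis_le_norm)
    also have "\<dots> = G \<eta> * norm v" by (simp add: G_def)
    finally show ?thesis .
  qed
  have int': "integrable M (\<lambda>\<eta>. F' x0 \<eta> v)" for v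
  proof -
    have "integrable M (\<lambda>\<eta>. F' x0 \<eta> b)" if "b \<in> Basis" for b
      by (rule Bochner_Integration.integrable_bound[OF g meas[OF that]])
        (use bd[OF x0 _ that] in \<open>auto intro!: AE_I2 order_trans[OF _ abs_ge_self]\<close>)
    then have "integrable M (\<lambda>\<eta>. \<Sum>b\<in>Basis. (v \<bullet> b) * F' x0 \<eta> b)"
      by auto
    moreover have "integrable M (\<lambda>\<eta>. \<Sum>b\<in>Basis. (v \<bullet> b) * F' x0 \<eta> b) \<longleftrightarrow> integrable M (\<lambda>\<eta>. F' x0 \<eta> v)"
      by (rule Bochner_Integration.integrable_cong) (simp_all add: expand[OF x0, of _ v])
    ultimately show ?thesis by simp
  qed
  have "linear (\<lambda>v. \<integral>\<eta>. F' x0 \<eta> v \<partial>M)"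
  proof (rule linearI)
    fix v w :: 'a
    have "(\<integral>\<eta>. F' x0 \<eta> (v + w) \<partial>M) = (\<integral>\<eta>. F' x0 \<eta> v + F' x0 \<eta> w \<partial>M)"
      by (rule Bochner_Integration.integral_cong) (auto simp: linear_add[OF lin[OF x0]])
    then show "(\<integral>\<eta>. F' x0 \<eta> (v + w) \<partial>M) = (\<integral>\<eta>. F' x0 \<eta> v \<partial>M) + (\<integral>\<eta>. F' x0 \<eta> w \<partial>M)"
      using int' by simp
  next
    fix c :: real and v :: 'a
    have "(\<integral>\<eta>. F' x0 \<eta> (c *\<^sub>R v) \<partial>M) = (\<integral>\<eta>. c * F' x0 \<eta> v \<partial>M)"
      by (rule Bochner_Integration.integral_cong) (auto simp: linear_scale[OF lin[OF x0]])
    then show "(\<integral>\<eta>. F' x0 \<eta> (c *\<^sub>R v) \<partial>M) = c *\<^sub>R (\<integral>\<eta>. F' x0 \<eta> v \<partial>M)"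
      by simp
  qed
  then have bl: "bounded_linear (\<lambda>v. \<integral>\<eta>. F' x0 \<eta> v \<partial>M)"
    by (simp add: linear_conv_bounded_linear)
  \<comment> \<open>Setting the quotient to 0 outside the ball makes measurability and domination
    valid for every \<open>x\<close>, so that an arbitrary sequence converging to \<open>x0\<close>
    can be used below.\<close>
  define R where "R x \<eta> = (if x \<in> ball x0 e then (F x \<eta> - F x0 \<eta> - F' x0 \<eta> (x - x0)) / norm (x - x0) else 0)" for x \<eta>
  have R_bound: "\<bar>R x \<eta>\<bar> \<le> 2 * G \<eta>" if \<eta>: "\<eta> \<in> space M" for x \<eta>
  proof (cases "x \<in> ball x0 e \<and> x \<noteq> x0")
    case True
    have "norm (F x \<eta> - F x0 \<eta>) \<le> G \<eta> * norm (x - x0)"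
      by (rule differentiable_bound[OF convex_ball[of x0 e], of "\<lambda>x. F x \<eta>" "\<lambda>x. F' x \<eta>"])
        (use True x0 der[OF _ \<eta>] bound[OF _ \<eta>] in \<open>auto intro!: onorm_le intro: has_derivative_at_withinI\<close>)
    moreover have "\<bar>F' x0 \<eta> (x - x0)\<bar> \<le> G \<eta> * norm (x - x0)"
      by (rule bound[OF x0 \<eta>])
    ultimately have "\<bar>F x \<eta> - F x0 \<eta> - F' x0 \<eta> (x - x0)\<bar> \<le> 2 * G \<eta> * norm (x - x0)"
      by simp
    then show ?thesis using True by (simp add: R_def divide_simps)
  next
    case False
    have "0 \<le> G \<eta>"
    proof -
      obtain b :: 'a where "b \<in> Basis" using nonempty_Basis by blast
      then have "0 \<le> g \<eta>" using bd[OF x0 \<eta>, of b] by linarith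
      then show ?thesis by (simp add: G_def)
    qed
    then show ?thesis using False by (auto simp: R_def)
  qed
  have R_meas: "R x \<in> borel_measurable M" for x
    using int[of x] int[OF x0] int'[of "x - x0"] unfolding R_def[abs_def]
    by (cases "x \<in> ball x0 e") (auto intro!: borel_measurable_divide borel_measurable_diff borel_measurable_integrable)
  have R_lim: "((\<lambda>x. R x \<eta>) \<longlongrightarrow> 0) (at x0)" if \<eta>: "\<eta> \<in> space M" for \<eta>
  proof -
    have "((\<lambda>x. norm (F x \<eta> - F x0 \<eta> - F' x0 \<eta> (x - x0)) / norm (x - x0)) \<longlongrightarrow> 0) (at x0)"
      using der[OF x0 \<eta>] unfolding has_derivative_iff_norm by simp
    then have "((\<lambda>x. norm ((F x \<eta> - F x0 \<eta> - F' x0 \<eta> (x - x0)) / norm (x - x0))) \<longlongrightarrow> 0) (at x0)"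
      by simp
    then have "((\<lambda>x. (F x \<eta> - F x0 \<eta> - F' x0 \<eta> (x - x0)) / norm (x - x0)) \<longlongrightarrow> 0) (at x0)"
      by (rule tendsto_norm_zero_cancel)
    moreover have "\<forall>\<^sub>F x in at x0. (F x \<eta> - F x0 \<eta> - F' x0 \<eta> (x - x0)) / norm (x - x0) = R x \<eta>"
      using eventually_at_ball[OF e, of x0 UNIV] by eventually_elim (simp add: R_def)
    ultimately show ?thesis by (rule Lim_transform_eventually)
  qed
  have "((\<lambda>x. \<integral>\<eta>. R x \<eta> \<partial>M) \<longlongrightarrow> 0) (at x0)"
    unfolding tendsto_at_iff_sequentially comp_def
  proof (intro allI impI)
    fix X :: "nat \<Rightarrow> 'a" assume X: "\<forall>i. X i \<in> UNIV - {x0}" "X \<longlonglongrightarrow> x0"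
    have "(\<lambda>i. \<integral>\<eta>. R (X i) \<eta> \<partial>M) \<longlonglongrightarrow> (\<integral>\<eta>. 0 \<partial>M)"
    proof (rule integral_dominated_convergence[where w = "\<lambda>\<eta>. 2 * G \<eta>"])
      show "AE \<eta> in M. (\<lambda>i. R (X i) \<eta>) \<longlonglongrightarrow> 0"
        using R_lim X unfolding tendsto_at_iff_sequentially comp_def by (intro AE_I2) blast
    qed (use G R_meas R_bound in auto)
    then show "(\<lambda>i. \<integral>\<eta>. R (X i) \<eta> \<partial>M) \<longlonglongrightarrow> 0" by simp
  qed
  then have "((\<lambda>x. \<bar>\<integral>\<eta>. R x \<eta> \<partial>M\<bar>) \<longlongrightarrow> 0) (at x0)"
    using tendsto_rabs_zero by blast
  moreover have "\<forall>\<^sub>F x in at x0. \<bar>\<integral>\<eta>. R x \<eta> \<partial>M\<bar> =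
      norm ((\<integral>\<eta>. F x \<eta> \<partial>M) - (\<integral>\<eta>. F x0 \<eta> \<partial>M) - (\<integral>\<eta>. F' x0 \<eta> (x - x0) \<partial>M)) / norm (x - x0)"
    using eventually_at_ball[OF e, of x0 UNIV]
  proof eventually_elim
    case (elim x)
    then have "R x = (\<lambda>\<eta>. (F x \<eta> - F x0 \<eta> - F' x0 \<eta> (x - x0)) / norm (x - x0))"
      by (auto simp: R_def)
    then show ?case
      using int[of x] int[OF x0] int'[of "x - x0"] elim by simp
  qed
  ultimately have "((\<lambda>x. norm ((\<integral>\<eta>. F x \<eta> \<partial>M) - (\<integral>\<eta>. F x0 \<eta> \<partial>M) - (\<integral>\<eta>. F' x0 \<eta> (x - x0) \<partial>M)) / norm (x - x0)) \<longlongrightarrow> 0) (at x0)"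
    by (rule Lim_transform_eventually)
  then show ?thesis
    using bl by (simp add: has_derivative_iff_norm)
qed

text \<open>The set \<open>FF\<close> replaces a bookkeeping of orders: since derivatives of members
  are again members, the local domination assumed of all members also dominates their derivatives,
  which is what differentiation under the integral asks for.\<close>

lemma has_derivative_integral_family:
  fixes FF :: "('a::euclidean_space \<Rightarrow> 'b \<Rightarrow> real) set"
  assumes S: "open S"
    and meas: "\<And>F x. F \<in> FF \<Longrightarrow> x \<in> S \<Longrightarrow> F x \<in> borel_measurable M"
    and diff: "\<And>F x \<eta>. F \<in> FF \<Longrightarrow> x \<in> S \<Longrightarrow> \<eta> \<in> space M \<Longrightarrow> (\<lambda>x. F x \<eta>) differentiable at x"
    and dom: "\<And>F x. F \<in> FF \<Longrightarrow> x \<in> S \<Longrightarrow>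
      \<exists>e>0. \<exists>g. integrable M g \<and> (\<forall>y\<in>ball x e. \<forall>\<eta>\<in>space M. \<bar>F y \<eta>\<bar> \<le> g \<eta>)"
    and step: "\<And>F v. F \<in> FF \<Longrightarrow> v \<in> Basis \<Longrightarrow>
      \<exists>F'\<in>FF. \<forall>x\<in>S. \<forall>\<eta>\<in>space M. frechet_derivative (\<lambda>x. F x \<eta>) (at x) v = F' x \<eta>"
    and F: "F \<in> FF" and x: "x \<in> S"
  shows "((\<lambda>x. \<integral>\<eta>. F x \<eta> \<partial>M) has_derivative
      (\<lambda>v. \<integral>\<eta>. frechet_derivative (\<lambda>x. F x \<eta>) (at x) v \<partial>M)) (at x)"
proof -
  have "\<forall>v\<in>Basis. \<exists>F'\<in>FF. \<forall>x\<in>S. \<forall>\<eta>\<in>space M. frechet_derivative (\<lambda>x. F x \<eta>) (at x) v = F' x \<eta>"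
    using step[OF F] by blast
  then obtain D where D: "\<And>v. v \<in> Basis \<Longrightarrow> D v \<in> FF"
    "\<And>v x \<eta>. v \<in> Basis \<Longrightarrow> x \<in> S \<Longrightarrow> \<eta> \<in> space M \<Longrightarrow> frechet_derivative (\<lambda>x. F x \<eta>) (at x) v = D v x \<eta>"
    by metis
  have "\<forall>v\<in>Basis. \<exists>e>0. \<exists>g. integrable M g \<and> (\<forall>y\<in>ball x e. \<forall>\<eta>\<in>space M. \<bar>D v y \<eta>\<bar> \<le> g \<eta>)"
    using dom[OF D(1) x] by blast
  then obtain e g where eg: "\<And>v. v \<in> Basis \<Longrightarrow> e v > 0" "\<And>v. v \<in> Basis \<Longrightarrow> integrable M (g v)"
    "\<And>v y \<eta>. v \<in> Basis \<Longrightarrow> y \<in> ball x (e v) \<Longrightarrow> \<eta> \<in> space M \<Longrightarrow> \<bar>D v y \<eta>\<bar> \<le> g v \<eta>"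
    by metis
  obtain e1 where e1: "e1 > 0" "ball x e1 \<subseteq> S"
    using S x open_contains_ball by blast
  obtain e2 g2 where e2: "e2 > 0" "integrable M g2" "\<And>y \<eta>. y \<in> ball x e2 \<Longrightarrow> \<eta> \<in> space M \<Longrightarrow> \<bar>F y \<eta>\<bar> \<le> g2 \<eta>"
    using dom[OF F x] by blast
  \<comment> \<open>One radius on which all of the finitely many basis derivatives are dominated at
    once.\<close>
  define r where "r = min (min e1 e2) (Min (e ` Basis))"
  have r: "r > 0" "r \<le> e1" "r \<le> e2" "\<And>v. v \<in> Basis \<Longrightarrow> r \<le> e v"
    using e1 e2 eg(1) by (auto simp: r_def min.coboundedI2)
  show ?thesis
  proof (rule has_derivative_integral_dominated[where e = r and g = "\<lambda>\<eta>. \<Sum>v\<in>Basis. g v \<eta>"])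
    fix y assume y: "y \<in> ball x r"
    then have yS: "y \<in> S" and ye: "y \<in> ball x e2" and yv: "\<And>v. v \<in> Basis \<Longrightarrow> y \<in> ball x (e v)"
      using r e1(2) by (auto simp: subset_iff) (meson order_less_le_trans)
    show "integrable M (F y)"
      by (rule Bochner_Integration.integrable_bound[OF e2(2) meas[OF F yS]])
        (use e2(3)[OF ye] in \<open>auto intro!: AE_I2 order_trans[OF _ abs_ge_self]\<close>)
    fix \<eta> assume \<eta>: "\<eta> \<in> space M"
    show "((\<lambda>x. F x \<eta>) has_derivative frechet_derivative (\<lambda>x. F x \<eta>) (at y)) (at y)"
      using diff[OF F yS \<eta>] frechet_derivative_works by blast
    fix v :: 'a assume v: "v \<in> Basis"
    have "\<bar>D v y \<eta>\<bar> \<le> g v \<eta>" by (rule eg(3)[OF v yv[OF v] \<eta>])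
    also have "\<dots> \<le> (\<Sum>v\<in>Basis. g v \<eta>)"
    proof (rule member_le_sum[OF v])
      fix w :: 'a assume "w \<in> Basis - {v}"
      then have "\<bar>D w y \<eta>\<bar> \<le> g w \<eta>" using eg(3)[OF _ yv \<eta>] by blast
      then show "0 \<le> g w \<eta>" by linarith
    qed simp
    finally show "\<bar>frechet_derivative (\<lambda>x. F x \<eta>) (at y) v\<bar> \<le> (\<Sum>v\<in>Basis. g v \<eta>)"
      using D(2)[OF v yS \<eta>] by simp
  next
    fix v :: 'a assume v: "v \<in> Basis"
    show "(\<lambda>\<eta>. frechet_derivative (\<lambda>x. F x \<eta>) (at x) v) \<in> borel_measurable M"
      using meas[OF D(1)[OF v] x] D(2)[OF v x] by (simp cong: measurable_cong)
  qed (use r eg(2) in auto)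
qed

lemma smooth_on_integral_family:
  fixes FF :: "('a::euclidean_space \<Rightarrow> 'b \<Rightarrow> real) set"
  assumes S: "open S"
    and meas: "\<And>F x. F \<in> FF \<Longrightarrow> x \<in> S \<Longrightarrow> F x \<in> borel_measurable M"
    and diff: "\<And>F x \<eta>. F \<in> FF \<Longrightarrow> x \<in> S \<Longrightarrow> \<eta> \<in> space M \<Longrightarrow> (\<lambda>x. F x \<eta>) differentiable at x"
    and dom: "\<And>F x. F \<in> FF \<Longrightarrow> x \<in> S \<Longrightarrow>
      \<exists>e>0. \<exists>g. integrable M g \<and> (\<forall>y\<in>ball x e. \<forall>\<eta>\<in>space M. \<bar>F y \<eta>\<bar> \<le> g \<eta>)"
    and step: "\<And>F v. F \<in> FF \<Longrightarrow> v \<in> Basis \<Longrightarrow>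
      \<exists>F'\<in>FF. \<forall>x\<in>S. \<forall>\<eta>\<in>space M. frechet_derivative (\<lambda>x. F x \<eta>) (at x) v = F' x \<eta>"
    and F: "F \<in> FF"
  shows "smooth_on S (\<lambda>x. \<integral>\<eta>. F x \<eta> \<partial>M)"
  unfolding smooth_on_def
proof
  fix k
  have der: "((\<lambda>x. \<integral>\<eta>. F x \<eta> \<partial>M) has_derivative
      (\<lambda>v. \<integral>\<eta>. frechet_derivative (\<lambda>x. F x \<eta>) (at x) v \<partial>M)) (at x)" if "F \<in> FF" "x \<in> S" for F x
    by (rule has_derivative_integral_family[where FF = FF and S = S];
        use S meas diff dom step that in blast)
  show "Ck_on k S (\<lambda>x. \<integral>\<eta>. F x \<eta> \<partial>M)"
    using F
  proof (induction k arbitrary: F)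
    case 0
    have "isCont (\<lambda>x. \<integral>\<eta>. F x \<eta> \<partial>M) x" if "x \<in> S" for x
      using has_derivative_continuous[OF der[OF 0 that]] .
    then show ?case
      by (simp add: continuous_at_imp_continuous_on)
  next
    case (Suc k)
    show ?case
    proof (rule Ck_on_SucI[OF S der[OF Suc.prems]])
      fix v :: 'a assume "v \<in> Basis"
      from step[OF Suc.prems this] obtain F' where F': "F' \<in> FF"
        "\<And>x \<eta>. x \<in> S \<Longrightarrow> \<eta> \<in> space M \<Longrightarrow> frechet_derivative (\<lambda>x. F x \<eta>) (at x) v = F' x \<eta>"
        by blast
      have "(\<integral>\<eta>. frechet_derivative (\<lambda>x. F x \<eta>) (at x) v \<partial>M) = (\<integral>\<eta>. F' x \<eta> \<partial>M)" if "x \<in> S" for x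
        by (rule Bochner_Integration.integral_cong) (use F'(2)[OF that] in auto)
      then show "Ck_on k S (\<lambda>x. \<integral>\<eta>. frechet_derivative (\<lambda>x. F x \<eta>) (at x) v \<partial>M)"
        using Suc.IH[OF F'(1)] Ck_on_cong[OF S] by (smt (verit, best))
    qed
  qed
qed

section \<open>Bump functions\<close>

text \<open>The polynomial in \<open>1 / x\<close> is carried along because the resulting class of
  functions is closed under differentiation; smoothness at 0 then follows by an induction over all
  \<open>p\<close> together.\<close>

definition poly_exp_bump :: "real poly \<Rightarrow> real \<Rightarrow> real" where
  "poly_exp_bump p x = (if x > 0 then poly p (1 / x) * exp (- (1 / x)) else 0)"

lemma poly_exp_tendsto_0: "((\<lambda>y::real. poly p y * exp (- y)) \<longlongrightarrow> 0) at_top"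
proof -
  have "((\<lambda>y. \<Sum>i\<le>degree p. coeff p i * (y ^ i / exp y)) \<longlongrightarrow> (\<Sum>i\<le>degree p. coeff p i * 0)) at_top"
    by (intro tendsto_intros tendsto_power_div_exp_0)
  then show ?thesis
    by (simp add: poly_altdef sum_distrib_right exp_minus field_simps sum_divide_distrib)
qed

text \<open>With \<open>y = 1 / x\<close> the factor \<open>[:0, 0, 1:]\<close> is
  \<open>y ^ 2\<close>, the inner derivative up to sign, and \<open>p - pderiv p\<close> collects
  the derivatives of the exponential and of the polynomial. Only \<open>x = 0\<close> calls for a
  limit argument.\<close>

lemma poly_exp_bump_has_derivative:
  "(poly_exp_bump p has_real_derivative poly_exp_bump ([:0, 0, 1:] * (p - pderiv p)) x) (at x)"
proof (cases x "0::real" rule: linorder_cases)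
  case less
  have "((\<lambda>x. 0::real) has_real_derivative 0) (at x)" by simp
  then show ?thesis
    using less by (subst DERIV_cong_ev[OF refl _ refl, where g = "\<lambda>x. 0"])
      (auto simp: poly_exp_bump_def intro!: eventually_mono[OF eventually_nhds_in_open[of "{..<0}" x]])
next
  case greater
  have "((\<lambda>x. poly p (1 / x) * exp (- (1 / x))) has_real_derivative poly_exp_bump ([:0, 0, 1:] * (p - pderiv p)) x) (at x)"
    using greater
    by (auto intro!: derivative_eq_intros simp: poly_exp_bump_def field_simps power2_eq_square)
  then show ?thesis
    using greater by (subst DERIV_cong_ev[OF refl _ refl, where g = "\<lambda>x. poly p (1 / x) * exp (- (1 / x))"])
      (auto simp: poly_exp_bump_def intro!: eventually_mono[OF eventually_nhds_in_open[of "{0<..}" x]])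
next
  case equal
  have "((\<lambda>h. poly_exp_bump p h / h) \<longlongrightarrow> 0) (at_right 0)"
  proof -
    \<comment> \<open>The factor \<open>[:0, 1:]\<close> is the \<open>1 / h\<close> of the
      difference quotient.\<close>
    have "((\<lambda>h. poly ([:0, 1:] * p) (inverse h) * exp (- inverse h)) \<longlongrightarrow> 0) (at_right 0)"
      by (rule filterlim_compose[OF poly_exp_tendsto_0 filterlim_inverse_at_top_right])
    moreover have "\<forall>\<^sub>F h in at_right (0::real). poly ([:0, 1:] * p) (inverse h) * exp (- inverse h) = poly_exp_bump p h / h"
      using eventually_at_right_less[of "0::real"]
      by eventually_elim (simp add: poly_exp_bump_def field_simps)
    ultimately show ?thesis by (rule Lim_transform_eventually)
  qed
  moreover have "((\<lambda>h. poly_exp_bump p h / h) \<longlongrightarrow> 0) (at_left 0)"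
  proof -
    have "\<forall>\<^sub>F h in at_left (0::real). 0 = poly_exp_bump p h / h"
      by (auto simp: eventually_at_filter poly_exp_bump_def)
    then show ?thesis by (rule Lim_transform_eventually[OF tendsto_const])
  qed
  ultimately have "((\<lambda>h. poly_exp_bump p h / h) \<longlongrightarrow> 0) (at 0)"
    using filterlim_split_at by blast
  then show ?thesis
    using equal by (simp add: DERIV_def poly_exp_bump_def)
qed

lemma smooth_on_poly_exp_bump: "smooth_on UNIV (poly_exp_bump p)"
  unfolding smooth_on_def
proof
  show "Ck_on k UNIV (poly_exp_bump p)" for k
  proof (induction k arbitrary: p)
    case 0
    have "isCont (poly_exp_bump p) x" for x
      using poly_exp_bump_has_derivative DERIV_isCont by blast
    then show ?case by (simp add: continuous_at_imp_continuous_on)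
  next
    case (Suc k)
    show ?case
    proof (rule Ck_on_SucI)
      show "(poly_exp_bump p has_derivative (*) (poly_exp_bump ([:0, 0, 1:] * (p - pderiv p)) x)) (at x)" for x
        using poly_exp_bump_has_derivative[of p x] by (simp add: has_field_derivative_def)
    qed (use Suc.IH[of "[:0, 0, 1:] * (p - pderiv p)"] in simp_all)
  qed
qed

lemma smooth_bump_exists:
  fixes \<rho> :: real
  assumes "\<rho> > 0"
  obtains \<phi> :: "'a::euclidean_space \<Rightarrow> real" where
    "smooth_on UNIV \<phi>" "\<And>x. 0 \<le> \<phi> x" "\<phi> 0 > 0" "\<And>x. \<rho> \<le> norm x \<Longrightarrow> \<phi> x = 0"
proof
  \<comment> \<open>The square of the norm is a polynomial in the coordinates, which avoids the
    singularity of the norm at 0.\<close>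
  let ?\<phi> = "\<lambda>x::'a. poly_exp_bump 1 (\<rho>\<^sup>2 - (norm x)\<^sup>2)"
  have "(\<lambda>x::'a. \<rho>\<^sup>2 - (norm x)\<^sup>2) = (\<lambda>x. \<rho>\<^sup>2 + - (\<Sum>b\<in>Basis. (x \<bullet> b) * (x \<bullet> b)))"
    by (simp add: power2_norm_eq_inner euclidean_inner[symmetric])
  then have "smooth_on UNIV (\<lambda>x::'a. \<rho>\<^sup>2 - (norm x)\<^sup>2)"
    by (simp only:) (intro smooth_on_add smooth_on_minus smooth_on_sum smooth_on_mult
        smooth_on_const smooth_on_bounded_linear bounded_linear_inner_left open_UNIV)
  then show "smooth_on UNIV ?\<phi>"
    by (intro smooth_on_compose[OF smooth_on_poly_exp_bump]) (auto simp: smooth_map_on_real_iff)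
  show "0 \<le> ?\<phi> x" for x
    by (simp add: poly_exp_bump_def)
  show "?\<phi> 0 > 0"
    using assms by (simp add: poly_exp_bump_def)
  show "?\<phi> x = 0" if "\<rho> \<le> norm x" for x
    using power_mono[OF that, of 2] assms by (simp add: poly_exp_bump_def not_less)
qed

section \<open>Anisotropic dilations and volume\<close>

text \<open>Weights are attached to basis vectors rather than to indices, so that one notion covers
  the group, its product with time, and the parameter space of the fibre integral.\<close>

definition wdil :: "('a::euclidean_space \<Rightarrow> real) \<Rightarrow> real \<Rightarrow> 'a \<Rightarrow> 'a" where
  "wdil c r x = (\<Sum>b\<in>Basis. (r powr c b * (x \<bullet> b)) *\<^sub>R b)"

lemma wdil_inner [simp]: "b \<in> Basis \<Longrightarrow> wdil c r x \<bullet> b = r powr c b * (x \<bullet> b)"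
  by (simp add: wdil_def)

lemma bounded_linear_wdil: "bounded_linear (wdil c r)"
  unfolding wdil_def
  by (auto intro!: bounded_linear_sum bounded_linear_scaleR_left bounded_linear_compose[OF bounded_linear_scaleR_left]
      bounded_linear_const_mult bounded_linear_inner_left)

lemma wdil_0 [simp]: "wdil c r 0 = 0"
  by (simp add: wdil_def)

lemma wdil_1 [simp]: "wdil c 1 x = x"
  by (rule euclidean_eqI) simp

lemma wdil_wdil: "r > 0 \<Longrightarrow> s > 0 \<Longrightarrow> wdil c r (wdil c s x) = wdil c (r * s) x"
  by (rule euclidean_eqI) (simp add: powr_mult)

lemma wdil_inverse [simp]:
  assumes "r > 0"
  shows "wdil c r (wdil c (1 / r) x) = x" "wdil c (1 / r) (wdil c r x) = x"
  using assms by (simp_all add: wdil_wdil)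

lemma wdil_eq_0_iff [simp]: "r > 0 \<Longrightarrow> wdil c r x = 0 \<longleftrightarrow> x = 0"
  by (metis wdil_0 wdil_inverse(2))

lemma inj_wdil: "r > 0 \<Longrightarrow> inj (wdil c r)"
  by (rule inj_on_inverseI[where g = "wdil c (1 / r)"]) simp

lemma smooth_map_on_wdil: "smooth_map_on S (wdil c r)"
  by (intro smooth_map_on_bounded_linear bounded_linear_wdil)

lemma continuous_on_wdil [continuous_intros]: "continuous_on S f \<Longrightarrow> continuous_on S (\<lambda>x. wdil c r (f x))"
  by (rule bounded_linear.continuous_on[OF bounded_linear_wdil])

lemma borel_measurable_wdil [measurable]: "wdil c r \<in> borel \<rightarrow>\<^sub>M borel"
  by (intro borel_measurable_continuous_onI continuous_on_wdil continuous_on_id)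

lemma lborel_wdil:
  assumes r: "r > 0"
  shows "lborel = density (distr lborel borel (wdil c r)) (\<lambda>_. ennreal (r powr (\<Sum>b\<in>Basis. c b)))"
proof -
  have "wdil c r = (\<lambda>x::'a. 0 + (\<Sum>j\<in>Basis. (r powr c j * (x \<bullet> j)) *\<^sub>R j))"
    by (auto simp: wdil_def)
  moreover have "(\<Prod>j\<in>Basis. \<bar>r powr c j\<bar>) = r powr (\<Sum>b\<in>Basis. c b)"
    using r by (simp add: powr_sum)
  ultimately show ?thesis
    using lborel_affine_euclidean[of "\<lambda>b. r powr c b" "0::'a"] r by simp
qed

lemma nn_integral_wdil:
  assumes "r > 0" and [measurable]: "f \<in> borel_measurable borel"
  shows "(\<integral>\<^sup>+x. f x \<partial>lborel) = ennreal (r powr (\<Sum>b\<in>Basis. c b)) * (\<integral>\<^sup>+x. f (wdil c r x) \<partial>lborel)"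
  by (subst lborel_wdil[OF assms(1), of c])
    (simp add: nn_integral_density nn_integral_distr nn_integral_cmult)

lemma emeasure_wdil_vimage:
  assumes "r > 0" and [measurable]: "A \<in> sets borel"
  shows "emeasure lborel A = ennreal (r powr (\<Sum>b\<in>Basis. c b)) * emeasure lborel (wdil c r -` A)"
proof -
  have [measurable]: "wdil c r -` A \<in> sets borel"
    using measurable_sets[OF borel_measurable_wdil assms(2), of c r] by simp
  have "(\<integral>\<^sup>+x. indicator A x \<partial>lborel) = ennreal (r powr (\<Sum>b\<in>Basis. c b)) * (\<integral>\<^sup>+x. indicator A (wdil c r x) \<partial>lborel)"
    by (rule nn_integral_wdil[OF assms(1)]) measurable
  moreover have "(\<lambda>x. indicator A (wdil c r x)) = (indicator (wdil c r -` A) :: _ \<Rightarrow> ennreal)"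
    by (auto simp: indicator_def)
  ultimately show ?thesis by simp
qed

lemma integral_wdil:
  fixes f :: "'a::euclidean_space \<Rightarrow> real"
  assumes "r > 0" and f [measurable]: "f \<in> borel_measurable borel"
  shows "(\<integral>x. f x \<partial>lborel) = r powr (\<Sum>b\<in>Basis. c b) * (\<integral>x. f (wdil c r x) \<partial>lborel)"
  by (subst lborel_wdil[OF assms(1), of c]) (simp add: integral_density integral_distr)

lemma integrable_wdil:
  fixes f :: "'a::euclidean_space \<Rightarrow> real"
  assumes "r > 0" and f: "integrable lborel f"
  shows "integrable lborel (\<lambda>x. f (wdil c r x))"
proof -
  have [measurable]: "f \<in> borel_measurable borel" using f by simp
  have "ennreal (r powr (\<Sum>b\<in>Basis. c b)) * (\<integral>\<^sup>+x. norm (f (wdil c r x)) \<partial>lborel) < \<infinity>"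
    using f nn_integral_wdil[OF assms(1), of "\<lambda>x. ennreal (norm (f x))" c] by (simp add: integrable_iff_bounded)
  then show ?thesis
    using assms(1) by (auto simp: integrable_iff_bounded ennreal_mult_less_top)
qed

text \<open>A quasi-norm enters only through the normalising factor: \<open>1 / r\<close> is the maximum of \<open>1\<close> and
  the homogeneous quasi-norm \<open>max\<^sub>b \<bar>x \<bullet> b\<bar> powr (1 / c b)\<close> of \<open>x\<close>.\<close>

lemma wdil_normalize:
  fixes x :: "'a::euclidean_space"
  assumes c: "\<And>b. b \<in> Basis \<Longrightarrow> c b > 0"
  obtains r where "0 < r" "r \<le> 1" "\<And>b. b \<in> Basis \<Longrightarrow> \<bar>wdil c r x \<bullet> b\<bar> \<le> 1"
    "r = 1 \<or> (\<exists>b\<in>Basis. \<bar>wdil c r x \<bullet> b\<bar> = 1)"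
proof -
  define M where "M = Max (insert 1 ((\<lambda>b. \<bar>x \<bullet> b\<bar> powr (1 / c b)) ` Basis))"
  have M1: "1 \<le> M" by (simp add: M_def)
  have Mb: "\<bar>x \<bullet> b\<bar> powr (1 / c b) \<le> M" if "b \<in> Basis" for b
    unfolding M_def by (rule Max_ge) (use that in auto)
  have eq: "\<bar>x \<bullet> b\<bar> = (\<bar>x \<bullet> b\<bar> powr (1 / c b)) powr c b" if "b \<in> Basis" for b
    using c[OF that] by (simp add: powr_powr)
  have "M \<in> insert 1 ((\<lambda>b. \<bar>x \<bullet> b\<bar> powr (1 / c b)) ` Basis)"
    unfolding M_def by (intro Max_in) auto
  then consider "M = 1" | b where "b \<in> Basis" "M = \<bar>x \<bullet> b\<bar> powr (1 / c b)" by auto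
  then have "1 / M = 1 \<or> (\<exists>b\<in>Basis. \<bar>wdil c (1 / M) x \<bullet> b\<bar> = 1)"
  proof cases
    case 2
    have "\<bar>wdil c (1 / M) x \<bullet> b\<bar> = (1 / M) powr c b * M powr c b"
      using 2 eq[OF 2(1)] by (simp add: abs_mult)
    also have "\<dots> = 1"
      using M1 by (simp add: powr_mult[symmetric])
    finally show ?thesis using 2 by blast
  qed simp
  moreover have "\<bar>wdil c (1 / M) x \<bullet> b\<bar> \<le> 1" if b: "b \<in> Basis" for b
  proof -
    have "\<bar>x \<bullet> b\<bar> \<le> M powr c b"
      using c[OF b] by (subst eq[OF b]) (intro powr_mono2 Mb b, auto)
    then have "(1 / M) powr c b * \<bar>x \<bullet> b\<bar> \<le> (1 / M) powr c b * M powr c b"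
      by (intro mult_left_mono) auto
    also have "\<dots> = 1"
      using M1 by (simp add: powr_mult[symmetric])
    finally show ?thesis using b by (simp add: abs_mult)
  qed
  ultimately show ?thesis
    using that[of "1 / M"] M1 by auto
qed

text \<open>The set \<open>S\<close> is covered by non-overlapping dyadic cubes whose total volume
  exceeds that of \<open>S\<close> by at most \<open>e\<close>. The image of a cube of side
  \<open>s\<close> lies in a cube of side \<open>2 * L * DIM('a) * s\<close>, so volumes grow at
  most by a fixed factor. The crude constant suffices because only boundedness is wanted
  later.\<close>

lemma lipschitz_image_emeasure:
  fixes f :: "'a::euclidean_space \<Rightarrow> 'a"
  assumes \<rho>: "\<rho> > 0" and L: "L \<ge> 0" and e: "e > 0"
    and lip: "\<And>x y. x \<in> cbox (- \<rho> *\<^sub>R One) (\<rho> *\<^sub>R One) \<Longrightarrow> y \<in> cbox (- \<rho> *\<^sub>R One) (\<rho> *\<^sub>R One) \<Longrightarrow>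
      norm (f x - f y) \<le> L * norm (x - y)"
    and S: "S \<in> lmeasurable" "S \<subseteq> cbox (- \<rho> *\<^sub>R One) (\<rho> *\<^sub>R One)"
    and T: "T \<subseteq> f ` S"
  shows "emeasure lborel T \<le> ennreal ((2 * L * DIM('a)) ^ DIM('a)) * (emeasure lebesgue S + ennreal e)"
proof -
  let ?Q = "cbox (- \<rho> *\<^sub>R One) (\<rho> *\<^sub>R One) :: 'a set"
  let ?C = "(2 * L * DIM('a)) ^ DIM('a)"
  obtain D where D: "countable D"
    and sub: "\<And>K. K \<in> D \<Longrightarrow> K \<subseteq> ?Q \<and> K \<noteq> {} \<and> (\<exists>c d. K = cbox c d)"
    and disj: "pairwise (\<lambda>A B. interior A \<inter> interior B = {}) D"
    and cube: "\<And>u v. cbox u v \<in> D \<Longrightarrow> \<exists>n. \<forall>i \<in> Basis. v \<bullet> i - u \<bullet> i = ((\<rho> *\<^sub>R One) \<bullet> i - (- \<rho> *\<^sub>R One) \<bullet> i) / 2 ^ n"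
    and cov: "S \<subseteq> \<Union>D" and UD: "\<Union>D \<in> lmeasurable" and le: "measure lebesgue (\<Union>D) \<le> measure lebesgue S + e"
    using measurable_outer_intervals_bounded[OF S e] by metis
  have box: "\<exists>u s. s > 0 \<and> K = cbox u (u + s *\<^sub>R One)" if "K \<in> D" for K
  proof -
    obtain u v where uv: "K = cbox u v" using sub[OF \<open>K \<in> D\<close>] by blast
    have "\<exists>n. \<forall>i\<in>Basis. v \<bullet> i - u \<bullet> i = 2 * \<rho> / 2 ^ n"
      using cube[of u v] that uv by (simp add: inner_simps)
    then obtain n where n: "\<And>i. i \<in> Basis \<Longrightarrow> v \<bullet> i - u \<bullet> i = 2 * \<rho> / 2 ^ n"
      by blast
    have "v = u + (2 * \<rho> / 2 ^ n) *\<^sub>R One"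
      by (rule euclidean_eqI) (use n in \<open>auto simp: inner_simps algebra_simps\<close>)
    moreover have "2 * \<rho> / 2 ^ n > 0" using \<rho> by simp
    ultimately show ?thesis using uv by blast
  qed
  \<comment> \<open>The bound is stated with the interior of \<open>K\<close>, since only the
    interiors of the cubes are disjoint and hence add up.\<close>
  have ex: "\<exists>B. f ` K \<subseteq> B \<and> B \<in> sets borel \<and> emeasure lborel B \<le> ennreal ?C * emeasure lborel (interior K)"
    if K: "K \<in> D" for K
  proof -
    obtain u s where us: "s > 0" "K = cbox u (u + s *\<^sub>R One)" using box[OF K] by blast
    have u: "u \<in> K" using us by (auto simp: mem_box inner_simps)
    let ?R = "L * (real DIM('a) * s)"
    let ?B = "cbox (f u - ?R *\<^sub>R One) (f u + ?R *\<^sub>R One)"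
    have "f x \<in> ?B" if x: "x \<in> K" for x
    proof -
      have "norm (x - u) \<le> (\<Sum>b\<in>Basis. \<bar>(x - u) \<bullet> b\<bar>)" by (rule norm_le_l1)
      also have "\<dots> \<le> (\<Sum>b\<in>(Basis::'a set). s)"
        using x us by (intro sum_mono) (auto simp: mem_box inner_simps abs_le_iff algebra_simps)
      finally have "norm (x - u) \<le> real DIM('a) * s" by simp
      then have "L * norm (x - u) \<le> ?R" using L by (rule mult_left_mono)
      moreover have "norm (f x - f u) \<le> L * norm (x - u)"
        using x u sub[OF K] by (intro lip) auto
      ultimately have "norm (f x - f u) \<le> ?R" by linarith
      then have "\<bar>(f x - f u) \<bullet> b\<bar> \<le> ?R" if "b \<in> Basis" for b
        using Basis_le_norm[OF that, of "f x - f u"] by linarith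
      then show ?thesis by (auto simp: mem_box inner_simps abs_le_iff algebra_simps)
    qed
    moreover have "emeasure lborel ?B \<le> ennreal ?C * emeasure lborel (interior K)"
    proof -
      have R: "?R \<ge> 0" using L us by simp
      have "emeasure lborel ?B = ennreal ((2 * ?R) ^ DIM('a))"
        using R by (subst emeasure_lborel_cbox) (auto simp: inner_simps mult.commute mult.left_commute)
      also have "(2 * ?R) ^ DIM('a) = ?C * s ^ DIM('a)"
        by (simp add: power_mult_distrib algebra_simps)
      also have "ennreal \<dots> = ennreal ?C * ennreal (s ^ DIM('a))"
        using L us by (simp add: ennreal_mult')
      also have "ennreal (s ^ DIM('a)) = emeasure lborel (interior K)"
        using us by (auto simp: interior_cbox emeasure_lborel_box_eq inner_simps)
      finally show ?thesis by simp
    qed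
    ultimately show ?thesis by (intro exI[of _ ?B]) auto
  qed
  then obtain B where B: "\<And>K. K \<in> D \<Longrightarrow> f ` K \<subseteq> B K" "\<And>K. K \<in> D \<Longrightarrow> B K \<in> sets borel"
    "\<And>K. K \<in> D \<Longrightarrow> emeasure lborel (B K) \<le> ennreal ?C * emeasure lborel (interior K)"
    by metis
  \<comment> \<open>The countable family \<open>D\<close> may be finite; \<open>X\<close> and
    \<open>Y\<close> list it over all naturals, with the empty set at the remaining indices.\<close>
  let ?I = "to_nat_on D ` D"
  define X where "X n = (if n \<in> ?I then interior (from_nat_into D n) else {})" for n
  define Y where "Y n = (if n \<in> ?I then B (from_nat_into D n) else {})" for n
  have fn: "from_nat_into D n \<in> D" if "n \<in> ?I" for n
    using that D by auto
  have fn_inj: "m = n" if "m \<in> ?I" "n \<in> ?I" "from_nat_into D m = from_nat_into D n" for m n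
    using that D by auto
  have "disjoint_family X"
    unfolding disjoint_family_on_def
  proof (intro ballI impI)
    fix m n :: nat assume mn: "m \<noteq> n"
    show "X m \<inter> X n = {}"
    proof (cases "m \<in> ?I \<and> n \<in> ?I")
      case True
      then have "from_nat_into D m \<noteq> from_nat_into D n" using fn_inj mn by metis
      then show ?thesis
        using True pairwiseD[OF disj fn fn] by (simp add: X_def)
    qed (auto simp: X_def)
  qed
  have Xsets: "range X \<subseteq> sets lborel"
    by (auto simp: X_def)
  have Ysets: "range Y \<subseteq> sets lborel"
    using B(2) fn by (auto simp: Y_def)
  have "T \<subseteq> (\<Union>n. Y n)"
  proof
    fix y assume "y \<in> T"
    then obtain x K where x: "y = f x" "x \<in> K" "K \<in> D" using T cov by blast
    then have "y \<in> Y (to_nat_on D K)" using B(1)[of K] D by (auto simp: Y_def)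
    then show "y \<in> (\<Union>n. Y n)" by blast
  qed
  then have "emeasure lborel T \<le> emeasure lborel (\<Union>n. Y n)"
    using Ysets by (intro emeasure_mono sets.countable_UN) auto
  also have "\<dots> \<le> (\<Sum>n. emeasure lborel (Y n))"
    by (rule emeasure_subadditive_countably[OF Ysets])
  also have "\<dots> \<le> (\<Sum>n. ennreal ?C * emeasure lborel (X n))"
    using B(3) fn by (intro suminf_le) (auto simp: X_def Y_def)
  also have "\<dots> = ennreal ?C * emeasure lborel (\<Union>n. X n)"
    using suminf_emeasure[OF Xsets \<open>disjoint_family X\<close>] by simp
  also have "\<dots> \<le> ennreal ?C * (emeasure lebesgue S + ennreal e)"
  proof (rule mult_left_mono)
    have "emeasure lborel (\<Union>n. X n) = emeasure lebesgue (\<Union>n. X n)"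
      using Xsets by (subst emeasure_completion) (auto intro!: sets.countable_UN)
    also have "\<dots> \<le> emeasure lebesgue (\<Union>D)"
    proof (rule emeasure_mono)
      show "(\<Union>n. X n) \<subseteq> \<Union>D"
        using fn interior_subset by (fastforce simp: X_def split: if_splits)
    qed (use UD in auto)
    also have "\<dots> = ennreal (measure lebesgue (\<Union>D))"
      using UD by (simp add: emeasure_eq_measure2)
    also have "\<dots> \<le> ennreal (measure lebesgue S + e)"
      using le by (rule ennreal_leI)
    also have "\<dots> = emeasure lebesgue S + ennreal e"
      using S(1) e by (simp add: emeasure_eq_measure2)
    finally show "emeasure lborel (\<Union>n. X n) \<le> emeasure lebesgue S + ennreal e" .
  qed simp
  finally show ?thesis .
qed

lemma smooth_on_lipschitz_compact:
  fixes f :: "'a::euclidean_space \<Rightarrow> real"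
  assumes f: "smooth_on UNIV f" and K: "compact K" "convex K"
  obtains L where "L \<ge> 0" "\<And>x y. x \<in> K \<Longrightarrow> y \<in> K \<Longrightarrow> \<bar>f x - f y\<bar> \<le> L * norm (x - y)"
proof -
  have "\<exists>B. \<forall>x\<in>K. \<bar>frechet_derivative f (at x) b\<bar> \<le> B" if "b \<in> Basis" for b
  proof -
    have "continuous_on K (\<lambda>x. frechet_derivative f (at x) b)"
      using smooth_on_imp_continuous_on[OF smooth_on_frechet_derivative_Basis[OF f that]]
      by (rule continuous_on_subset) simp
    then have "compact ((\<lambda>x. frechet_derivative f (at x) b) ` K)"
      using K(1) by (rule compact_continuous_image)
    then show ?thesis
      by (auto dest!: compact_imp_bounded simp: bounded_iff)
  qed
  then obtain B where B: "\<And>b x. b \<in> Basis \<Longrightarrow> x \<in> K \<Longrightarrow> \<bar>frechet_derivative f (at x) b\<bar> \<le> B b"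
    by metis
  define L where "L = (\<Sum>b\<in>Basis. \<bar>B b\<bar>)"
  have "\<bar>f x - f y\<bar> \<le> L * norm (x - y)" if "x \<in> K" "y \<in> K" for x y
  proof -
    have "norm (f x - f y) \<le> L * norm (x - y)"
    proof (rule differentiable_bound[OF K(2) _ _ that])
      fix z assume z: "z \<in> K"
      have fz: "(f has_derivative frechet_derivative f (at z)) (at z)"
        using smooth_on_has_derivative[OF f] by simp
      then show "(f has_derivative frechet_derivative f (at z)) (at z within K)"
        by (rule has_derivative_at_withinI)
      show "onorm (frechet_derivative f (at z)) \<le> L"
      proof (rule onorm_le)
        fix v :: 'a
        have "frechet_derivative f (at z) v = (\<Sum>b\<in>Basis. (v \<bullet> b) *\<^sub>R frechet_derivative f (at z) b)"
          using fz by (intro frechet_derivative_Basis_sum differentiableI)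
        also have "norm \<dots> \<le> (\<Sum>b\<in>Basis. norm v * \<bar>B b\<bar>)"
        proof (rule order_trans[OF norm_sum], rule sum_mono)
          fix b :: 'a assume b: "b \<in> Basis"
          have "\<bar>frechet_derivative f (at z) b\<bar> \<le> \<bar>B b\<bar>" using B[OF b z] by linarith
          then show "norm ((v \<bullet> b) *\<^sub>R frechet_derivative f (at z) b) \<le> norm v * \<bar>B b\<bar>"
            using Basis_le_norm[OF b, of v] by (auto simp: abs_mult intro!: mult_mono)
        qed
        finally show "norm (frechet_derivative f (at z) v) \<le> L * norm v"
          by (simp add: L_def sum_distrib_left[symmetric] mult.commute)
      qed
    qed
    then show ?thesis by simp
  qed
  moreover have "L \<ge> 0" by (simp add: L_def sum_nonneg)
  ultimately show ?thesis using that by blast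
qed

lemma smooth_map_on_lipschitz_compact:
  fixes F :: "'a::euclidean_space \<Rightarrow> 'b::euclidean_space"
  assumes F: "smooth_map_on UNIV F" and K: "compact K" "convex K"
  obtains L where "L \<ge> 0" "\<And>x y. x \<in> K \<Longrightarrow> y \<in> K \<Longrightarrow> norm (F x - F y) \<le> L * norm (x - y)"
proof -
  have "\<exists>L\<ge>0. \<forall>x\<in>K. \<forall>y\<in>K. \<bar>F x \<bullet> b - F y \<bullet> b\<bar> \<le> L * norm (x - y)" if "b \<in> Basis" for b
    using smooth_on_lipschitz_compact[of "\<lambda>x. F x \<bullet> b" K] F K that unfolding smooth_map_on_def by metis
  then obtain L where L: "\<And>b. b \<in> Basis \<Longrightarrow> L b \<ge> 0"
    "\<And>b x y. b \<in> Basis \<Longrightarrow> x \<in> K \<Longrightarrow> y \<in> K \<Longrightarrow> \<bar>F x \<bullet> b - F y \<bullet> b\<bar> \<le> L b * norm (x - y)"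
    by metis
  have "norm (F x - F y) \<le> (\<Sum>b\<in>Basis. L b) * norm (x - y)" if "x \<in> K" "y \<in> K" for x y
  proof -
    have "norm (F x - F y) \<le> (\<Sum>b\<in>Basis. \<bar>(F x - F y) \<bullet> b\<bar>)" by (rule norm_le_l1)
    also have "\<dots> \<le> (\<Sum>b\<in>Basis. L b * norm (x - y))"
      using L(2)[OF _ that] by (intro sum_mono) (auto simp: inner_diff_left)
    finally show ?thesis by (simp add: sum_distrib_right)
  qed
  then show ?thesis using that[of "\<Sum>b\<in>Basis. L b"] L(1) by (simp add: sum_nonneg)
qed

section \<open>Second derivatives along vector fields\<close>

text \<open>Differentiating along a variable field yields a second derivative with the field frozen
  at \<open>p\<close> and a first-order correction from the derivative of the field. The split is
  used where the correction vanishes: for fields on different factors, and at a maximum.\<close>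

lemma has_derivative_along_field:
  fixes f :: "'a::euclidean_space \<Rightarrow> real"
  assumes f: "smooth_on UNIV f" and W: "(W has_derivative W') (at p)"
  shows "((\<lambda>q. frechet_derivative f (at q) (W q)) has_derivative
    (\<lambda>h. frechet_derivative (\<lambda>q. frechet_derivative f (at q) (W p)) (at p) h + frechet_derivative f (at p) (W' h))) (at p)"
proof -
  define g where "g b q = frechet_derivative f (at q) b" for b q
  have fd: "f differentiable at q" for q
    using smooth_on_differentiable[OF f] by simp
  have g: "(g b has_derivative frechet_derivative (g b) (at p)) (at p)" if "b \<in> Basis" for b
    using smooth_on_has_derivative[OF smooth_on_frechet_derivative_Basis[OF f that]]
    by (simp add: g_def[abs_def])
  have expand: "frechet_derivative f (at q) v = (\<Sum>b\<in>Basis. (v \<bullet> b) * g b q)" for q v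
    unfolding g_def real_scaleR_def[symmetric] by (rule frechet_derivative_Basis_sum[OF fd])
  have "((\<lambda>q. \<Sum>b\<in>Basis. (W q \<bullet> b) * g b q) has_derivative
      (\<lambda>h. \<Sum>b\<in>Basis. (W p \<bullet> b) * frechet_derivative (g b) (at p) h + (W' h \<bullet> b) * g b p)) (at p)"
    by (intro has_derivative_sum has_derivative_mult g has_derivative_inner_left W)
  moreover have "((\<lambda>q. \<Sum>b\<in>Basis. (W p \<bullet> b) * g b q) has_derivative
      (\<lambda>h. \<Sum>b\<in>Basis. (W p \<bullet> b) * frechet_derivative (g b) (at p) h)) (at p)"
    by (intro has_derivative_sum has_derivative_mult_right g)
  from frechet_derivative_at[OF this]
  have "frechet_derivative (\<lambda>q. \<Sum>b\<in>Basis. (W p \<bullet> b) * g b q) (at p)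
      = (\<lambda>h. \<Sum>b\<in>Basis. (W p \<bullet> b) * frechet_derivative (g b) (at p) h)" by (rule sym)
  ultimately show ?thesis
    by (simp add: expand sum.distrib)
qed

lemma frechet_derivative_along_field:
  fixes f :: "'a::euclidean_space \<Rightarrow> real"
  assumes "smooth_on UNIV f" "(W has_derivative W') (at p)"
  shows "frechet_derivative (\<lambda>q. frechet_derivative f (at q) (W q)) (at p) h
    = frechet_derivative (\<lambda>q. frechet_derivative f (at q) (W p)) (at p) h + frechet_derivative f (at p) (W' h)"
  using frechet_derivative_at[OF has_derivative_along_field[OF assms]] by metis

lemma frechet_derivative_minus:
  fixes f :: "'a::real_normed_vector \<Rightarrow> 'b::real_normed_vector"
  assumes "f differentiable at x"
  shows "frechet_derivative (\<lambda>y. - f y) (at x) h = - frechet_derivative f (at x) h"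
  using frechet_derivative_at[OF has_derivative_minus[OF assms[unfolded frechet_derivative_works]]] by metis

lemma smooth_map_on_id [simp]: "smooth_map_on S (\<lambda>x. x)"
  by (simp add: smooth_map_on_bounded_linear bounded_linear_ident)

lemma smooth_map_on_fst' [simp]: "smooth_map_on S fst" and smooth_map_on_snd' [simp]: "smooth_map_on S snd"
  by (simp_all add: smooth_map_on_bounded_linear bounded_linear_fst bounded_linear_snd)

text \<open>A field on one factor has coefficients that do not change along the other factor, so
  both first-order corrections vanish and the symmetry of second derivatives with frozen directions
  remains.\<close>

lemma factor_fields_commute:
  fixes f :: "'a::euclidean_space \<times> 'b::euclidean_space \<Rightarrow> real"
  assumes f: "smooth_on UNIV f" and V: "smooth_map_on UNIV V" and W: "smooth_map_on UNIV W"
  shows "frechet_derivative (\<lambda>q. frechet_derivative f (at q) (0, W (snd q))) (at p) (V (fst p), 0)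
       = frechet_derivative (\<lambda>q. frechet_derivative f (at q) (V (fst q), 0)) (at p) (0, W (snd p))"
proof -
  obtain W' where W': "(W has_derivative W') (at (snd p))"
    using smooth_map_on_differentiable[OF W, of "snd p"] by (auto simp: differentiable_def)
  obtain V' where V': "(V has_derivative V') (at (fst p))"
    using smooth_map_on_differentiable[OF V, of "fst p"] by (auto simp: differentiable_def)
  have dW: "((\<lambda>q. (0::'a, W (snd q))) has_derivative (\<lambda>h. (0, W' (snd h)))) (at p)"
    by (intro has_derivative_Pair has_derivative_const
        has_derivative_compose[OF bounded_linear_imp_has_derivative[OF bounded_linear_snd] W'])
  have dV: "((\<lambda>q. (V (fst q), 0::'b)) has_derivative (\<lambda>h. (V' (fst h), 0))) (at p)"
    by (intro has_derivative_Pair has_derivative_const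
        has_derivative_compose[OF bounded_linear_imp_has_derivative[OF bounded_linear_fst] V'])
  have "V' 0 = 0" "W' 0 = 0" "frechet_derivative f (at p) 0 = 0"
    using has_derivative_linear[OF W'] has_derivative_linear[OF V']
      has_derivative_linear[OF smooth_on_has_derivative[OF f, of p]] by (auto intro: linear_0)
  then show ?thesis
    using frechet_derivative_along_field[OF f dW, of "(V (fst p), 0)"]
      frechet_derivative_along_field[OF f dV, of "(0, W (snd p))"]
      frechet_derivative_commute[OF f, of "(0, W (snd p))" p "(V (fst p), 0)"]
    by (simp add: zero_prod_def[symmetric])
qed

section \<open>Homogeneous groups\<close>

locale hom_group =
  fixes star :: "'g::euclidean_space \<Rightarrow> 'g \<Rightarrow> 'g" and c :: "'g \<Rightarrow> real"
  assumes c_pos: "\<And>b. b \<in> Basis \<Longrightarrow> c b > 0"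
    and hlg: "hom_lie_group star (wdil c)"
begin

abbreviation "gi \<equiv> grp_inv star"

lemma assoc: "star (star x y) z = star x (star y z)"
  and unit [simp]: "star 0 x = x" "star x 0 = x"
  and smooth_star: "smooth_map_on UNIV (\<lambda>p. star (fst p) (snd p))"
  and smooth_gi: "smooth_map_on UNIV gi"
  and wdil_star: "r > 0 \<Longrightarrow> wdil c r (star x y) = star (wdil c r x) (wdil c r y)"
  using hlg unfolding hom_lie_group_def by (auto simp: case_prod_unfold)

lemma gi [simp]: "star x (gi x) = 0" "star (gi x) x = 0"
proof -
  have "\<exists>!y. star x y = 0 \<and> star y x = 0"
    using hlg unfolding hom_lie_group_def by (metis)
  from theI'[OF this] show "star x (gi x) = 0" "star (gi x) x = 0"
    by (auto simp: grp_inv_def)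
qed

lemma gi_cancel [simp]: "star (gi x) (star x y) = y" "star x (star (gi x) y) = y"
  by (simp_all add: assoc[symmetric])

lemma gi_unique: "star x y = 0 \<Longrightarrow> y = gi x"
  by (metis gi_cancel(1) unit(2))

lemma gi_gi [simp]: "gi (gi x) = x"
  by (metis gi(2) gi_unique)

lemma gi_0 [simp]: "gi 0 = 0"
  by (metis gi(1) unit(1))

lemma gi_star: "gi (star x y) = star (gi y) (gi x)"
  by (metis assoc gi(1) gi_cancel(2) gi_unique)

lemma gi_star_eq_0_iff: "star (gi x) y = 0 \<longleftrightarrow> x = y"
  by (metis gi(2) gi_cancel(2) unit(2))

lemma wdil_gi: "r > 0 \<Longrightarrow> wdil c r (gi x) = gi (wdil c r x)"
  by (rule gi_unique) (simp add: wdil_star[symmetric])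

lemma smooth_star_comp:
  assumes "smooth_map_on S f" "smooth_map_on S g" "open S"
  shows "smooth_map_on S (\<lambda>x. star (f x) (g x))"
  using smooth_map_on_compose[OF smooth_star smooth_map_on_Pair[OF assms(1,2)]] assms(3) by simp

lemma smooth_gi_comp:
  assumes "smooth_map_on S f" "open S"
  shows "smooth_map_on S (\<lambda>x. gi (f x))"
  using smooth_map_on_compose[OF smooth_gi assms(1)] assms(2) by simp

lemma continuous_on_star:
  assumes "continuous_on S f" "continuous_on S g"
  shows "continuous_on S (\<lambda>x. star (f x) (g x))"
  using continuous_on_compose2[OF smooth_map_on_imp_continuous_on[OF smooth_star] continuous_on_Pair[OF assms]] by simp

lemma continuous_on_gi:
  assumes "continuous_on S f"
  shows "continuous_on S (\<lambda>x. gi (f x))"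
  using continuous_on_compose2[OF smooth_map_on_imp_continuous_on[OF smooth_gi] assms] by simp

lemma compact_star:
  assumes "compact A" "compact B"
  shows "compact ((\<lambda>p. star (fst p) (snd p)) ` (A \<times> B))"
  by (intro compact_continuous_image compact_Times assms continuous_on_star continuous_on_fst continuous_on_snd continuous_on_id)

lemma compact_gi: "compact A \<Longrightarrow> compact (gi ` A)"
  by (intro compact_continuous_image continuous_on_gi continuous_on_id)

text \<open>Dilating \<open>z\<close> into the unit box makes the right translation by \<open>z\<close> Lipschitz with a constant
  that does not depend on \<open>z\<close>.\<close>

lemma right_translate_emeasure_bounded:
  assumes K: "compact K"
  obtains C :: real where "C \<ge> 0" "\<And>z. emeasure lborel {y. star z (gi y) \<in> K} \<le> ennreal C"
proof -
  let ?Q = "\<Sum>b\<in>Basis. c b"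
  obtain \<rho> where \<rho>: "\<rho> > 0" "\<And>x b. x \<in> gi ` K \<Longrightarrow> b \<in> Basis \<Longrightarrow> \<bar>x \<bullet> b\<bar> \<le> \<rho>"
  proof -
    have "bounded (gi ` K)" using compact_gi[OF K] by (rule compact_imp_bounded)
    then obtain B where B: "B > 0" "\<forall>x\<in>gi ` K. norm x \<le> B"
      unfolding bounded_pos by blast
    show ?thesis
      by (rule that[OF B(1)]) (use B(2) Basis_le_norm order_trans in blast)
  qed
  let ?R = "cbox (- \<rho> *\<^sub>R One) (\<rho> *\<^sub>R One) :: 'g set"
  let ?U = "cbox (- One) One :: 'g set"
  obtain L where L: "L \<ge> 0" and lip: "\<And>p q. p \<in> ?R \<times> ?U \<Longrightarrow> q \<in> ?R \<times> ?U \<Longrightarrow>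
      norm (star (fst p) (snd p) - star (fst q) (snd q)) \<le> L * norm (p - q)"
    using smooth_map_on_lipschitz_compact[OF smooth_star, of "?R \<times> ?U"]
    by (metis compact_Times compact_cbox convex_Times convex_box(1))
  define A where "A = (2 * L * DIM('g)) ^ DIM('g)"
  have A: "A \<ge> 0" using L by (simp add: A_def)
  show ?thesis
  proof (rule that[of "A * (2 * (2 * \<rho>) ^ DIM('g))"])
    show "0 \<le> A * (2 * (2 * \<rho>) ^ DIM('g))" using A \<rho> by simp
    fix z :: 'g
    obtain r where r: "0 < r" "r \<le> 1" and rz: "\<And>b. b \<in> Basis \<Longrightarrow> \<bar>wdil c r z \<bullet> b\<bar> \<le> 1"
      using wdil_normalize[of c z] c_pos by metis
    define z' where "z' = wdil c r z"
    have z': "z' \<in> ?U" using rz by (auto simp: z'_def mem_box abs_le_iff)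
    \<comment> \<open>\<open>p\<close> is the corner of the dilate of the box of size
      \<open>\<rho>\<close>; since \<open>gi\<close> commutes with dilations, this dilate contains
      the inverses of the dilated set \<open>K\<close>. Its volume carries the factor
      \<open>r powr ?Q\<close>, to be cancelled at the end.\<close>
    define p where "p = wdil c r (\<rho> *\<^sub>R One)"
    let ?S = "cbox (- p) p"
    have p: "p \<bullet> b = r powr c b * \<rho>" if "b \<in> Basis" for b using that by (simp add: p_def)
    have p0: "0 \<le> p \<bullet> b" "p \<bullet> b \<le> \<rho>" if "b \<in> Basis" for b
      using p[OF that] \<rho> r c_pos[OF that] powr_le1[of "c b" r] by (auto simp: mult_left_le_one_le)
    have SR: "?S \<subseteq> ?R"
      using p0 by (auto simp: mem_box inner_simps) (meson order_trans neg_le_iff_le)+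
    have S: "emeasure lborel ?S = ennreal ((2 * \<rho>) ^ DIM('g) * r powr ?Q)"
    proof -
      have "emeasure lborel ?S = ennreal (\<Prod>b\<in>Basis. (p - - p) \<bullet> b)"
        using p0 by (intro emeasure_lborel_cbox) (auto simp: inner_simps intro: order_trans)
      also have "(\<Prod>b\<in>Basis. (p - - p) \<bullet> b) = (\<Prod>b\<in>(Basis::'g set). (2 * \<rho>) * r powr c b)"
        by (intro prod.cong) (auto simp: inner_simps p)
      also have "\<dots> = (2 * \<rho>) ^ DIM('g) * r powr ?Q"
        using r by (simp add: prod.distrib powr_sum)
      finally show ?thesis .
    qed
    let ?A = "{y. star z (gi y) \<in> K}"
    \<comment> \<open>\<open>T\<close> is the dilate by \<open>r\<close> of the set
      \<open>?A\<close> to be measured, with \<open>z\<close> replaced by the point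
      \<open>z'\<close> of the unit box. It lies in the right translate of the small box
      \<open>?S\<close> by \<open>z'\<close>.\<close>
    define T where "T = {y. star z' (gi y) \<in> wdil c r ` K}"
    have "closed (wdil c r ` K)"
      by (intro compact_imp_closed compact_continuous_image K continuous_on_wdil continuous_on_id)
    then have "closed T"
      unfolding T_def using continuous_closed_vimage[of "wdil c r ` K" "\<lambda>y. star z' (gi y)"]
        continuous_on_star[OF continuous_on_const continuous_on_gi[OF continuous_on_id]]
      by (metis UNIV_I continuous_on_eq_continuous_at open_UNIV vimage_def)
    then have Tm: "T \<in> sets borel" by simp
    have "T \<subseteq> (\<lambda>w. star w z') ` ?S"
    proof
      fix y assume "y \<in> T"
      then obtain k where k: "k \<in> K" "star z' (gi y) = wdil c r k" by (auto simp: T_def)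
      then have "y = star (gi (wdil c r k)) z'"
        by (metis assoc gi(2) gi_cancel(2) unit(2) gi_gi)
      moreover have "gi (wdil c r k) \<in> ?S"
      proof -
        have "- (r powr c b * \<rho>) \<le> r powr c b * (gi k \<bullet> b) \<and> r powr c b * (gi k \<bullet> b) \<le> r powr c b * \<rho>"
          if b: "b \<in> Basis" for b
          using \<rho>(2)[of "gi k", OF _ b] k(1) mult_left_mono[of "- \<rho>" "gi k \<bullet> b" "r powr c b"]
          by (auto simp: abs_le_iff intro!: mult_left_mono)
        then show ?thesis
          using r by (auto simp: wdil_gi[symmetric] mem_box p)
      qed
      ultimately show "y \<in> (\<lambda>w. star w z') ` ?S" by blast
    qed
    moreover have "norm (star x z' - star y z') \<le> L * norm (x - y)" if "x \<in> ?R" "y \<in> ?R" for x y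
      using lip[of "(x, z')" "(y, z')"] that z' by simp
    \<comment> \<open>The covering error is taken equal to the volume of \<open>?S\<close>. Being
      proportional to \<open>r powr ?Q\<close>, it survives the final division by that factor; this
      accounts for the leading 2 inside the constant.\<close>
    moreover have "(2 * \<rho>) ^ DIM('g) * r powr ?Q > 0" using \<rho> r by simp
    moreover have "?S \<in> lmeasurable" by simp
    ultimately have "emeasure lborel T \<le> ennreal A * (emeasure lebesgue ?S + ennreal ((2 * \<rho>) ^ DIM('g) * r powr ?Q))"
      unfolding A_def using SR \<rho>(1) L by (intro lipschitz_image_emeasure) auto
    also have "\<dots> = ennreal A * (ennreal ((2 * \<rho>) ^ DIM('g) * r powr ?Q) + ennreal ((2 * \<rho>) ^ DIM('g) * r powr ?Q))"
      using S by simp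
    also have "\<dots> = ennreal (r powr ?Q) * ennreal (A * (2 * (2 * \<rho>) ^ DIM('g)))"
      using A \<rho> by (simp add: ennreal_mult'[symmetric] ennreal_plus[symmetric] algebra_simps del: ennreal_plus)
    finally have *: "emeasure lborel T \<le> ennreal (r powr ?Q) * ennreal (A * (2 * (2 * \<rho>) ^ DIM('g)))" .
    have "wdil c r -` T = ?A"
    proof -
      have "star z' (gi (wdil c r y)) = wdil c r (star z (gi y))" for y
        using r by (simp add: z'_def wdil_star wdil_gi)
      moreover have "wdil c r x \<in> wdil c r ` K \<longleftrightarrow> x \<in> K" for x
        by (rule inj_image_mem_iff[OF inj_wdil[OF r(1)]])
      ultimately show ?thesis by (auto simp: T_def)
    qed
    then have "ennreal (r powr ?Q) * emeasure lborel ?A \<le> ennreal (r powr ?Q) * ennreal (A * (2 * (2 * \<rho>) ^ DIM('g)))"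
      using * emeasure_wdil_vimage[OF r(1) Tm, of c] by simp
    then show "emeasure lborel ?A \<le> ennreal (A * (2 * (2 * \<rho>) ^ DIM('g)))"
      using r by (subst (asm) ennreal_mult_le_mult_iff) auto
  qed
qed

text \<open>The hypothesis on \<open>V\<close> says that \<open>V a\<close> is the image of
  \<open>V 0\<close> under the derivative of left translation by \<open>a\<close>, that is, the
  velocity of \<open>w \<mapsto> star a w\<close> at the identity in direction \<open>V 0\<close>.
  In this form it covers both the fields \<open>Z j\<close> on space-time and the time
  direction.\<close>

lemma diff_kernel_antisym:
  assumes \<phi>: "smooth_on UNIV \<phi>"
    and V: "\<And>a. frechet_derivative (star a) (at 0) (V 0) = V a"
  shows "frechet_derivative (\<lambda>p. \<phi> (star (fst p) (gi (snd p)))) (at p) (V (fst p), 0)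
    = - frechet_derivative (\<lambda>p. \<phi> (star (fst p) (gi (snd p)))) (at p) (0, V (snd p))"
proof -
  let ?\<Psi> = "\<lambda>p. \<phi> (star (fst p) (gi (snd p)))"
  have "smooth_on UNIV ?\<Psi>"
    by (intro smooth_on_compose[OF \<phi>] smooth_star_comp smooth_gi_comp) auto
  then have \<Psi>: "(?\<Psi> has_derivative frechet_derivative ?\<Psi> (at p)) (at p)"
    using smooth_on_has_derivative by blast
  have s: "(star a has_derivative frechet_derivative (star a) (at 0)) (at 0)" for a
  proof -
    have "smooth_map_on UNIV (star a)"
      using smooth_star_comp[of UNIV "\<lambda>_. a" "\<lambda>x. x"] by simp
    then show ?thesis
      using smooth_map_on_differentiable frechet_derivative_works by blast
  qed
  have "((\<lambda>w. (star (fst p) w, star (snd p) w)) has_derivative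
      (\<lambda>h. (frechet_derivative (star (fst p)) (at 0) h, frechet_derivative (star (snd p)) (at 0) h))) (at 0)"
    by (intro has_derivative_Pair s)
  moreover have "(?\<Psi> has_derivative frechet_derivative ?\<Psi> (at p)) (at ((\<lambda>w. (star (fst p) w, star (snd p) w)) 0))"
    using \<Psi> by simp
  ultimately have "((\<lambda>w. ?\<Psi> (star (fst p) w, star (snd p) w)) has_derivative
      (\<lambda>h. frechet_derivative ?\<Psi> (at p) (frechet_derivative (star (fst p)) (at 0) h, frechet_derivative (star (snd p)) (at 0) h))) (at 0)"
    by (rule has_derivative_compose)
  moreover have "?\<Psi> (star (fst p) w, star (snd p) w) = ?\<Psi> p" for w
    by (simp add: gi_star assoc)
  ultimately have "((\<lambda>w. ?\<Psi> p) has_derivative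
      (\<lambda>h. frechet_derivative ?\<Psi> (at p) (frechet_derivative (star (fst p)) (at 0) h, frechet_derivative (star (snd p)) (at 0) h))) (at 0)"
    by simp
  from fun_cong[OF has_derivative_unique[OF this has_derivative_const], of "V 0"]
  have "frechet_derivative ?\<Psi> (at p) (V (fst p), V (snd p)) = 0"
    by (simp only: V)
  moreover have "(V (fst p), V (snd p)) = (V (fst p), 0) + (0, V (snd p))" by simp
  ultimately have "frechet_derivative ?\<Psi> (at p) (V (fst p), 0) + frechet_derivative ?\<Psi> (at p) (0, V (snd p)) = 0"
    using linear_add[OF has_derivative_linear[OF \<Psi>]] by metis
  then show ?thesis by linarith
qed

text \<open>Each of the two derivatives is moved from the first variable to the second at the cost
  of a sign, and the signs cancel. Between the two moves the derivatives act on different variables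
  and have to be exchanged.\<close>

lemma diff_kernel_second_order:
  assumes \<phi>: "smooth_on UNIV \<phi>" and sV: "smooth_map_on UNIV V"
    and V: "\<And>a. frechet_derivative (star a) (at 0) (V 0) = V a"
  defines "\<Psi> \<equiv> \<lambda>p. \<phi> (star (fst p) (gi (snd p)))"
  shows "frechet_derivative (\<lambda>q. frechet_derivative \<Psi> (at q) (V (fst q), 0)) (at p) (V (fst p), 0)
    = frechet_derivative (\<lambda>q. frechet_derivative \<Psi> (at q) (0, V (snd q))) (at p) (0, V (snd p))"
proof -
  let ?A = "\<lambda>q. frechet_derivative \<Psi> (at q) (V (fst q), 0)"
  let ?B = "\<lambda>q. frechet_derivative \<Psi> (at q) (0, V (snd q))"
  have \<Psi>: "smooth_on UNIV \<Psi>"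
    unfolding \<Psi>_def by (intro smooth_on_compose[OF \<phi>] smooth_star_comp smooth_gi_comp) auto
  have A: "?A = (\<lambda>q. - ?B q)"
    unfolding \<Psi>_def using diff_kernel_antisym[OF \<phi> V] by blast
  have sA: "smooth_on UNIV ?A" and sB: "smooth_on UNIV ?B"
    by (intro smooth_on_vf_apply \<Psi> smooth_map_on_Pair smooth_map_on_compose[OF sV]; simp)+
  have "frechet_derivative ?A (at p) (V (fst p), 0) = - frechet_derivative ?B (at p) (V (fst p), 0)"
    unfolding A by (intro frechet_derivative_minus smooth_on_differentiable[OF sB]) auto
  also have "\<dots> = - frechet_derivative ?A (at p) (0, V (snd p))"
    using factor_fields_commute[OF \<Psi> sV sV] by simp
  also have "\<dots> = frechet_derivative ?B (at p) (0, V (snd p))"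
  proof -
    have "?B = (\<lambda>q. - ?A q)" using A by (simp add: fun_eq_iff)
    then show ?thesis
      using frechet_derivative_minus[OF smooth_on_differentiable[OF sA], of p "(0, V (snd p))"] by simp
  qed
  finally show ?thesis .
qed

text \<open>Left invariance is tested on the coordinate functions at the identity, which turns an
  equation between operators into one between vectors.\<close>

lemma left_invariant_derivative:
  assumes V: "left_invariant star V"
  shows "frechet_derivative (star a) (at 0) (V 0) = V a"
proof (rule euclidean_eqI)
  fix b :: 'g assume "b \<in> Basis"
  have "smooth_map_on UNIV (star a)"
    using smooth_star_comp[of UNIV "\<lambda>_. a" "\<lambda>x. x"] by simp
  then have s: "(star a has_derivative frechet_derivative (star a) (at 0)) (at 0)"
    using smooth_map_on_differentiable frechet_derivative_works by blast
  have "smooth_on UNIV (\<lambda>w. w \<bullet> b)"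
    by (intro smooth_on_bounded_linear bounded_linear_inner_left)
  then have "vf_apply V (\<lambda>y. star a y \<bullet> b) 0 = vf_apply V (\<lambda>w. w \<bullet> b) (star a 0)"
    using fun_cong[OF V[unfolded left_invariant_def, rule_format], of "\<lambda>w. w \<bullet> b" a 0] by simp
  moreover have "vf_apply V (\<lambda>w. w \<bullet> b) x = V x \<bullet> b" for x
    using frechet_derivative_at[OF bounded_linear_imp_has_derivative[OF bounded_linear_inner_left[of b]], of x]
    unfolding vf_apply_def by metis
  moreover have "vf_apply V (\<lambda>y. star a y \<bullet> b) 0 = frechet_derivative (star a) (at 0) (V 0) \<bullet> b"
    using frechet_derivative_at[OF has_derivative_inner_left[OF s, of b]] unfolding vf_apply_def by metis
  ultimately show "frechet_derivative (star a) (at 0) (V 0) \<bullet> b = V a \<bullet> b" by simp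
qed

end

section \<open>Convolution kernels and the maximum principle\<close>

lemma slice_has_derivative_fst:
  assumes "f differentiable (at (z, y))"
  shows "((\<lambda>z. f (z, y)) has_derivative (\<lambda>h. frechet_derivative f (at (z, y)) (h, 0))) (at z)"
proof -
  have "((\<lambda>z. (z, y)) has_derivative (\<lambda>h. (h, 0))) (at z)"
    by (intro has_derivative_Pair has_derivative_ident has_derivative_const)
  from has_derivative_compose[OF this assms[unfolded frechet_derivative_works]] show ?thesis .
qed

lemma slice_has_derivative_snd:
  assumes "f differentiable (at (z, y))"
  shows "((\<lambda>y. f (z, y)) has_derivative (\<lambda>h. frechet_derivative f (at (z, y)) (0, h))) (at y)"
proof -
  have "((\<lambda>y. (z, y)) has_derivative (\<lambda>h. (0, h))) (at y)"
    by (intro has_derivative_Pair has_derivative_ident has_derivative_const)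
  from has_derivative_compose[OF this assms[unfolded frechet_derivative_works]] show ?thesis .
qed

lemma slice_frechet_derivative_fst:
  "f differentiable (at (z, y)) \<Longrightarrow>
    frechet_derivative (\<lambda>z. f (z, y)) (at z) h = frechet_derivative f (at (z, y)) (h, 0)"
  using frechet_derivative_at[OF slice_has_derivative_fst] by metis

lemma slice_frechet_derivative_snd:
  "f differentiable (at (z, y)) \<Longrightarrow>
    frechet_derivative (\<lambda>y. f (z, y)) (at y) h = frechet_derivative f (at (z, y)) (0, h)"
  using frechet_derivative_at[OF slice_has_derivative_snd] by metis

lemma smooth_on_slice_fst: "smooth_on UNIV f \<Longrightarrow> smooth_on UNIV (\<lambda>z. f (z, y))"
  by (rule smooth_on_compose[of UNIV f UNIV "\<lambda>z. (z, y)"]) (auto intro: smooth_map_on_Pair)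

lemma smooth_on_slice_snd: "smooth_on UNIV f \<Longrightarrow> smooth_on UNIV (\<lambda>y. f (z, y))"
  by (rule smooth_on_compose[of UNIV f UNIV "\<lambda>y. (z, y)"]) (auto intro: smooth_map_on_Pair)

text \<open>Properness of the support over the first variable makes integrals against a merely
  locally integrable function meaningful and differentiable, although the support in the product
  need not be compact.\<close>

definition proper_kernel :: "('a::euclidean_space \<times> 'a \<Rightarrow> real) \<Rightarrow> bool" where
  "proper_kernel \<Psi> \<longleftrightarrow> smooth_on UNIV \<Psi> \<and>
    (\<forall>C. compact C \<longrightarrow> (\<exists>C'. compact C' \<and> (\<forall>z\<in>C. \<forall>y. \<Psi> (z, y) \<noteq> 0 \<longrightarrow> y \<in> C')))"

lemma proper_kernel_smooth: "proper_kernel \<Psi> \<Longrightarrow> smooth_on UNIV \<Psi>"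
  by (simp add: proper_kernel_def)

lemma proper_kernel_differentiable: "proper_kernel \<Psi> \<Longrightarrow> \<Psi> differentiable (at p)"
  using smooth_on_differentiable[OF proper_kernel_smooth] by blast

lemma proper_kernel_derivative:
  assumes \<Psi>: "proper_kernel \<Psi>" and V: "smooth_map_on UNIV V"
  shows "proper_kernel (\<lambda>p. frechet_derivative \<Psi> (at p) (V p, 0))"
  unfolding proper_kernel_def
proof (intro conjI allI impI)
  show "smooth_on UNIV (\<lambda>p. frechet_derivative \<Psi> (at p) (V p, 0))"
    by (intro smooth_on_vf_apply proper_kernel_smooth[OF \<Psi>] smooth_map_on_Pair V) auto
  fix C :: "'a set" assume C: "compact C"
  \<comment> \<open>The derivative at \<open>z\<close> depends on the kernel near \<open>z\<close>,
    hence the set of parameters is enlarged by a unit ball before the support is bounded.\<close>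
  define C1 where "C1 = {x + y | x y. x \<in> C \<and> y \<in> cball (0::'a) 1}"
  have "compact C1"
    unfolding C1_def by (intro compact_sums C compact_cball)
  then obtain C' where C': "compact C'" "\<And>z y. z \<in> C1 \<Longrightarrow> \<Psi> (z, y) \<noteq> 0 \<Longrightarrow> y \<in> C'"
    using \<Psi> unfolding proper_kernel_def by metis
  show "\<exists>C'. compact C' \<and> (\<forall>z\<in>C. \<forall>y. frechet_derivative \<Psi> (at (z, y)) (V (z, y), 0) \<noteq> 0 \<longrightarrow> y \<in> C')"
  proof (intro exI[of _ C'] conjI C'(1) ballI allI impI)
    fix z y assume z: "z \<in> C" and nz: "frechet_derivative \<Psi> (at (z, y)) (V (z, y), 0) \<noteq> 0"
    show "y \<in> C'"
    proof (rule ccontr)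
      assume y: "y \<notin> C'"
      have zero: "\<Psi> (z', y) = 0" if "z' \<in> ball z 1" for z'
      proof -
        have "z' = z + (z' - z)" "z' - z \<in> cball 0 1"
          using that by (auto simp: dist_norm norm_minus_commute)
        then have "z' \<in> C1" using z unfolding C1_def by blast
        then show ?thesis using C'(2) y by blast
      qed
      have "((\<lambda>z. 0) has_derivative (\<lambda>h. frechet_derivative \<Psi> (at (z, y)) (h, 0))) (at z)"
        using slice_has_derivative_fst[OF proper_kernel_differentiable[OF \<Psi>]]
        by (rule has_derivative_transform_within_open[of _ _ _ _ "ball z 1"]) (use zero in auto)
      from fun_cong[OF has_derivative_unique[OF this has_derivative_const]]
      show False using nz by blast
    qed
  qed
qed

lemma kernel_dominated:
  fixes u :: "'a::euclidean_space \<Rightarrow> real"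
  assumes int: "\<And>K. compact K \<Longrightarrow> set_integrable lborel K u"
    and \<Psi>: "proper_kernel \<Psi>" and C: "compact C"
  obtains g where "integrable lborel g" "\<And>z y. z \<in> C \<Longrightarrow> \<bar>u y * \<Psi> (z, y)\<bar> \<le> g y"
proof -
  obtain C' where C': "compact C'" "\<And>z y. z \<in> C \<Longrightarrow> \<Psi> (z, y) \<noteq> 0 \<Longrightarrow> y \<in> C'"
    using \<Psi> C unfolding proper_kernel_def by metis
  have "compact (\<Psi> ` (C \<times> C'))"
    using smooth_on_imp_continuous_on[OF proper_kernel_smooth[OF \<Psi>]]
    by (intro compact_continuous_image compact_Times C C'(1)) (rule continuous_on_subset, auto)
  then obtain B where "\<forall>x\<in>\<Psi> ` (C \<times> C'). norm x \<le> B"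
    using compact_imp_bounded[of "\<Psi> ` (C \<times> C')"] unfolding bounded_iff by blast
  then have B: "\<bar>\<Psi> (z, y)\<bar> \<le> B" if "z \<in> C" "y \<in> C'" for z y
    using that by auto
  have "integrable lborel (\<lambda>y. \<bar>B\<bar> * \<bar>indicator C' y *\<^sub>R u y\<bar>)"
    using int[OF C'(1)] unfolding set_integrable_def by auto
  moreover have "\<bar>u y * \<Psi> (z, y)\<bar> \<le> \<bar>B\<bar> * \<bar>indicator C' y *\<^sub>R u y\<bar>" if z: "z \<in> C" for z y
  proof (cases "y \<in> C'")
    case True
    have "\<bar>\<Psi> (z, y)\<bar> \<le> \<bar>B\<bar>" using B[OF z True] by linarith
    then have "\<bar>u y\<bar> * \<bar>\<Psi> (z, y)\<bar> \<le> \<bar>u y\<bar> * \<bar>B\<bar>" by (rule mult_left_mono) simp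
    then show ?thesis using True by (simp add: abs_mult mult.commute)
  next
    case False
    then have "\<Psi> (z, y) = 0" using C'(2)[OF z] by blast
    then show ?thesis by simp
  qed
  ultimately show ?thesis using that by blast
qed

lemma kernel_measurable:
  assumes u: "u \<in> borel_measurable lborel" and \<Psi>: "proper_kernel \<Psi>"
  shows "(\<lambda>y. u y * \<Psi> (z, y)) \<in> borel_measurable lborel"
proof -
  have "continuous_on UNIV (\<lambda>y. \<Psi> (z, y))"
    by (intro smooth_on_imp_continuous_on smooth_on_slice_snd proper_kernel_smooth \<Psi>)
  then have "(\<lambda>y. \<Psi> (z, y)) \<in> borel_measurable borel"
    by (rule borel_measurable_continuous_onI)
  then show ?thesis using u by simp
qed

lemma kernel_integrable:
  fixes u :: "'a::euclidean_space \<Rightarrow> real"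
  assumes u: "u \<in> borel_measurable lborel" and int: "\<And>K. compact K \<Longrightarrow> set_integrable lborel K u"
    and \<Psi>: "proper_kernel \<Psi>"
  shows "integrable lborel (\<lambda>y. u y * \<Psi> (z, y))"
proof -
  obtain g where g: "integrable lborel g" "\<And>y. \<bar>u y * \<Psi> (z, y)\<bar> \<le> g y"
    by (rule kernel_dominated[OF int \<Psi>, of "{z}"]) auto
  show ?thesis
    by (rule Bochner_Integration.integrable_bound[OF g(1) kernel_measurable[OF u \<Psi>]])
      (use g(2) in \<open>auto intro!: AE_I2 order_trans[OF _ abs_ge_self]\<close>)
qed

lemma kernel_integral:
  fixes u :: "'a::euclidean_space \<Rightarrow> real"
  assumes u: "u \<in> borel_measurable lborel" and int: "\<And>K. compact K \<Longrightarrow> set_integrable lborel K u"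
    and \<Psi>: "proper_kernel \<Psi>"
  shows "smooth_on UNIV (\<lambda>z. \<integral>y. u y * \<Psi> (z, y) \<partial>lborel)"
    and "frechet_derivative (\<lambda>z. \<integral>y. u y * \<Psi> (z, y) \<partial>lborel) (at z) h
      = (\<integral>y. u y * frechet_derivative \<Psi> (at (z, y)) (h, 0) \<partial>lborel)"
proof -
  \<comment> \<open>The function \<open>u\<close> stays fixed while the kernel runs through all
    proper kernels; by \<open>proper_kernel_derivative\<close> this family is closed under
    derivatives in \<open>z\<close>. All smoothness of the integral comes from the kernel.\<close>
  define FF where "FF = {\<lambda>z y. u y * \<Psi> (z, y) | \<Psi>. proper_kernel \<Psi>}"
  have d: "((\<lambda>z. u y * \<Psi> (z, y)) has_derivative (\<lambda>h. u y * frechet_derivative \<Psi> (at (z, y)) (h, 0))) (at z)"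
    if "proper_kernel \<Psi>" for \<Psi> z y
    using slice_has_derivative_fst[OF proper_kernel_differentiable[OF that]] by (rule has_derivative_mult_right)
  have fd: "frechet_derivative (\<lambda>z. u y * \<Psi> (z, y)) (at z) h = u y * frechet_derivative \<Psi> (at (z, y)) (h, 0)"
    if "proper_kernel \<Psi>" for \<Psi> z y h
    using frechet_derivative_at[OF d[OF that]] by metis
  have meas: "F \<in> FF \<Longrightarrow> x \<in> UNIV \<Longrightarrow> F x \<in> borel_measurable lborel" for F x
    using kernel_measurable[OF u] by (auto simp: FF_def)
  have diff: "F \<in> FF \<Longrightarrow> x \<in> UNIV \<Longrightarrow> \<eta> \<in> space lborel \<Longrightarrow> (\<lambda>x. F x \<eta>) differentiable at x" for F x \<eta>
    using d by (auto simp: FF_def differentiable_def)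
  have dom: "\<exists>e>0. \<exists>g. integrable lborel g \<and> (\<forall>y\<in>ball x e. \<forall>\<eta>\<in>space lborel. \<bar>F y \<eta>\<bar> \<le> g \<eta>)"
    if FF: "F \<in> FF" "x \<in> UNIV" for F and x :: 'a
  proof -
    obtain \<Psi> where F: "F = (\<lambda>z y. u y * \<Psi> (z, y))" and \<Psi>: "proper_kernel \<Psi>"
      using FF(1) unfolding FF_def by blast
    obtain g where "integrable lborel g" "\<And>z y. z \<in> cball x 1 \<Longrightarrow> \<bar>u y * \<Psi> (z, y)\<bar> \<le> g y"
      by (rule kernel_dominated[OF int \<Psi>, of "cball x 1"]) auto
    then show ?thesis unfolding F by (intro exI[of _ 1] conjI exI[of _ g]) auto
  qed
  have step: "\<exists>F'\<in>FF. \<forall>x\<in>UNIV. \<forall>\<eta>\<in>space lborel. frechet_derivative (\<lambda>x. F x \<eta>) (at x) v = F' x \<eta>"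
    if FF: "F \<in> FF" for F v
  proof -
    obtain \<Psi> where F: "F = (\<lambda>z y. u y * \<Psi> (z, y))" and \<Psi>: "proper_kernel \<Psi>"
      using FF unfolding FF_def by blast
    have "proper_kernel (\<lambda>p. frechet_derivative \<Psi> (at p) (v, 0))"
      by (rule proper_kernel_derivative[OF \<Psi>]) simp
    then have "(\<lambda>z y. u y * frechet_derivative \<Psi> (at (z, y)) (v, 0)) \<in> FF"
      unfolding FF_def by (intro CollectI exI[of _ "\<lambda>p. frechet_derivative \<Psi> (at p) (v, 0)"]) auto
    then show ?thesis
      by (rule bexI[rotated]) (simp add: F fd[OF \<Psi>])
  qed
  have F: "(\<lambda>z y. u y * \<Psi> (z, y)) \<in> FF"
    using \<Psi> by (auto simp: FF_def)
  show "smooth_on UNIV (\<lambda>z. \<integral>y. u y * \<Psi> (z, y) \<partial>lborel)"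
    by (rule smooth_on_integral_family[where FF = FF]; use meas diff dom step F in blast)
  have "((\<lambda>z. \<integral>y. u y * \<Psi> (z, y) \<partial>lborel) has_derivative
      (\<lambda>v. \<integral>y. frechet_derivative (\<lambda>z. u y * \<Psi> (z, y)) (at z) v \<partial>lborel)) (at z)"
    by (rule has_derivative_integral_family[where FF = FF and S = UNIV]; use meas diff dom step F in blast)
  from fun_cong[OF frechet_derivative_at[OF this, symmetric], of h]
  show "frechet_derivative (\<lambda>z. \<integral>y. u y * \<Psi> (z, y) \<partial>lborel) (at z) h
      = (\<integral>y. u y * frechet_derivative \<Psi> (at (z, y)) (h, 0) \<partial>lborel)"
    by (simp only: fd[OF \<Psi>])
qed

text \<open>The first derivative of \<open>f\<close> vanishes at the maximum, so \<open>V\<close>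
  may be frozen at \<open>p\<close>; what remains is the second derivative along a straight line. If
  it were positive, the first derivative along the line would be positive just after
  \<open>p\<close> and \<open>f\<close> would exceed its maximum.\<close>

lemma second_derivative_nonpos_at_max:
  fixes f :: "'a::euclidean_space \<Rightarrow> real"
  assumes f: "smooth_on UNIV f" and V: "smooth_map_on UNIV V" and max: "\<And>x. f x \<le> f p"
  shows "vf_apply V (vf_apply V f) p \<le> 0"
proof -
  let ?v = "V p"
  let ?g = "\<lambda>q. frechet_derivative f (at q) ?v"
  obtain V' where V': "(V has_derivative V') (at p)"
    using smooth_map_on_differentiable[OF V] by (auto simp: differentiable_def)
  have fp: "(f has_derivative frechet_derivative f (at p)) (at p)"
    using smooth_on_has_derivative[OF f] by simp
  then have zero: "frechet_derivative f (at p) h = 0" for h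
    using differential_zero_maxmin[OF _ _ fp, of UNIV] max by auto
  have g: "smooth_on UNIV ?g"
    by (rule smooth_on_vf_apply[OF f]) auto
  have eq: "vf_apply V (vf_apply V f) p = frechet_derivative ?g (at p) ?v"
    unfolding vf_apply_def using frechet_derivative_along_field[OF f V'] zero by simp
  show ?thesis
  proof (rule ccontr)
    assume "\<not> ?thesis"
    then have pos: "frechet_derivative ?g (at p) ?v > 0" using eq by simp
    have "((\<lambda>t. ?g (p + t *\<^sub>R ?v)) has_real_derivative frechet_derivative ?g (at p) ?v) (at 0)"
      using smooth_on_line_derivative[OF g, of p ?v 0] by simp
    from DERIV_pos_inc_right[OF this pos] obtain d where
      d: "d > 0" "\<And>h. 0 < h \<Longrightarrow> h < d \<Longrightarrow> ?g (p + h *\<^sub>R ?v) > 0"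
      using zero by auto
    obtain \<xi> where \<xi>: "0 < \<xi>" "\<xi> < d / 2"
      "f (p + (d / 2) *\<^sub>R ?v) - f (p + 0 *\<^sub>R ?v) = (d / 2 - 0) * ?g (p + \<xi> *\<^sub>R ?v)"
      using MVT2[of 0 "d / 2" "\<lambda>t. f (p + t *\<^sub>R ?v)" "\<lambda>t. ?g (p + t *\<^sub>R ?v)"]
        smooth_on_line_derivative[OF f] d(1) half_gt_zero by blast
    have "(d / 2 - 0) * ?g (p + \<xi> *\<^sub>R ?v) > 0"
      using d(1) d(2)[of \<xi>] \<xi>(1,2) by (intro mult_pos_pos) auto
    then have "f p < f (p + (d / 2) *\<^sub>R ?v)"
      using \<xi>(3) by simp
    then show False using max[of "p + (d / 2) *\<^sub>R ?v"] by linarith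
  qed
qed

text \<open>\<open>v - \<epsilon> arctan t\<close> is a strict subsolution, so it has no maximum.\<close>

lemma heat_max_principle:
  fixes v :: "real \<times> 'g::euclidean_space \<Rightarrow> real"
  assumes v: "smooth_on UNIV v" and lim: "(v \<longlongrightarrow> 0) at_infinity"
    and Z: "\<And>j. j \<in> J \<Longrightarrow> smooth_map_on UNIV (Z j)"
    and H: "\<And>w. (\<Sum>j\<in>J. vf_space (Z j) (vf_space (Z j) v) w) - dt v w = 0"
  shows "v w0 \<le> 0"
proof (rule ccontr)
  assume "\<not> v w0 \<le> 0"
  define M where "M = v w0"
  then have M: "M > 0" using \<open>\<not> v w0 \<le> 0\<close> by simp
  \<comment> \<open>Since \<open>\<bar>arctan t\<bar> \<le> 8 / 5\<close>, the correction is at most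
    \<open>2 / 5 * M\<close> in absolute value. Hence \<open>f w0 \<ge> 3 / 5 * M\<close>, whereas
    \<open>f w < M / 10 + 2 / 5 * M\<close> wherever \<open>v w < M / 10\<close>: the supremum is
    attained inside a ball.\<close>
  define f where "f w = v w - M / 4 * arctan (fst w)" for w
  have pi: "pi < 3.2" using pi_approx by simp
  have at: "\<bar>M / 4 * arctan t\<bar> \<le> M * (2/5)" for t
  proof -
    have "\<bar>arctan t\<bar> \<le> 8/5" using arctan_bounded[of t] pi by linarith
    then have "M / 4 * \<bar>arctan t\<bar> \<le> M / 4 * (8/5)" using M by (intro mult_left_mono) auto
    then show ?thesis using M by (simp add: abs_mult)
  qed
  have "\<forall>\<^sub>F w in at_infinity. v w < M / 10"
    using order_tendstoD(2)[OF lim, of "M / 10"] M by simp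
  then obtain b where b: "\<And>w. b \<le> norm w \<Longrightarrow> v w < M / 10"
    unfolding eventually_at_infinity by blast
  define R where "R = max \<bar>b\<bar> (norm w0)"
  have "continuous_on UNIV f"
    unfolding f_def by (intro continuous_intros smooth_on_imp_continuous_on v)
  then have "continuous_on (cball 0 R) f" by (rule continuous_on_subset) simp
  moreover have "cball (0::real \<times> 'g) R \<noteq> {}" by (simp add: R_def le_max_iff_disj)
  ultimately obtain w1 where w1: "\<And>w. w \<in> cball 0 R \<Longrightarrow> f w \<le> f w1"
    using continuous_attains_sup[OF compact_cball] by blast
  have "f w0 \<le> f w1" by (rule w1) (simp add: R_def)
  moreover have "M * (3/5) \<le> f w0" using at[of "fst w0"] by (simp add: f_def M_def abs_le_iff)
  moreover have "f w < M * (3/5)" if "w \<notin> cball 0 R" for w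
  proof -
    have "v w < M / 10" using that by (intro b) (auto simp: R_def)
    then show ?thesis using at[of "fst w"] M unfolding f_def abs_le_iff by linarith
  qed
  ultimately have max: "f w \<le> f w1" for w
    using w1[of w] by (meson less_imp_le order.trans)
  obtain t1 z1 where tz: "w1 = (t1, z1)" by fastforce
  have "vf_space (Z j) (vf_space (Z j) v) w1 \<le> 0" if j: "j \<in> J" for j
  proof -
    have "v (t1, z) \<le> v (t1, z1)" for z
      using max[of "(t1, z)"] by (simp add: f_def tz)
    from second_derivative_nonpos_at_max[OF smooth_on_slice_snd[OF v] Z[OF j] this]
    show ?thesis by (simp add: vf_space_def[abs_def] tz)
  qed
  then have "(\<Sum>j\<in>J. vf_space (Z j) (vf_space (Z j) v) w1) \<le> 0"
    by (rule sum_nonpos)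
  \<comment> \<open>At \<open>w1\<close> the time derivative of \<open>f\<close> vanishes, so that
    of \<open>v\<close> equals the positive derivative of the correction. The correction does not
    depend on the space variable and leaves the sign of the second-order part alone.\<close>
  moreover have "dt v w1 > 0"
  proof -
    have "(\<lambda>s. v (s, z1)) differentiable at t1"
      by (rule smooth_on_differentiable[OF smooth_on_slice_fst[OF v]]) auto
    then have "((\<lambda>s. v (s, z1)) has_real_derivative deriv (\<lambda>s. v (s, z1)) t1) (at t1)"
      using DERIV_deriv_iff_real_differentiable by blast
    then have "((\<lambda>s. f (s, z1)) has_real_derivative deriv (\<lambda>s. v (s, z1)) t1 - M / 4 * inverse (1 + t1\<^sup>2)) (at t1)"
      unfolding f_def fst_conv by (intro DERIV_diff DERIV_cmult DERIV_arctan)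
    then have "deriv (\<lambda>s. v (s, z1)) t1 - M / 4 * inverse (1 + t1\<^sup>2) = 0"
      by (rule DERIV_local_max[of _ _ _ 1]) (use max tz in auto)
    moreover have "M / 4 * inverse (1 + t1\<^sup>2) > 0"
      using M by (intro mult_pos_pos) (auto simp: add_pos_nonneg)
    ultimately show ?thesis by (simp add: dt_def tz)
  qed
  ultimately show False using H[of w1] by linarith
qed

section \<open>Weights on products, and the group extended by time\<close>

text \<open>Basis vectors of a product have exactly one nonzero component, so the test
  \<open>snd b = 0\<close> decides which factor \<open>b\<close> comes from.\<close>

definition pweight :: "('a::euclidean_space \<Rightarrow> real) \<Rightarrow> ('b::euclidean_space \<Rightarrow> real) \<Rightarrow> 'a \<times> 'b \<Rightarrow> real" where
  "pweight c d b = (if snd b = 0 then c (fst b) else d (snd b))"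

lemma wdil_pweight: "wdil (pweight c d) r p = (wdil c r (fst p), wdil d r (snd p))"
proof (rule euclidean_eqI)
  fix b :: "'a \<times> 'b" assume b: "b \<in> Basis"
  then consider u where "b = (u, 0)" "u \<in> Basis" | v where "b = (0, v)" "v \<in> Basis"
    by (auto simp: Basis_prod_def)
  then show "wdil (pweight c d) r p \<bullet> b = (wdil c r (fst p), wdil d r (snd p)) \<bullet> b"
    unfolding wdil_inner[OF b] by cases (auto simp: pweight_def inner_prod_def)
qed

lemma sum_pweight: "(\<Sum>b\<in>Basis. pweight c d b) = (\<Sum>b\<in>Basis. c b) + (\<Sum>b\<in>Basis. d b)"
proof -
  have "(\<Sum>b\<in>Basis. pweight c d b) = (\<Sum>b\<in>(\<lambda>u. (u, 0)) ` Basis. pweight c d b) + (\<Sum>b\<in>(\<lambda>v. (0, v)) ` Basis. pweight c d b)"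
    unfolding Basis_prod_def by (rule sum.union_disjoint) auto
  also have "(\<Sum>b\<in>(\<lambda>u. (u, 0)) ` Basis. pweight c d b) = (\<Sum>b\<in>Basis. c b)"
    by (subst sum.reindex) (auto simp: pweight_def inj_on_def)
  also have "(\<Sum>b\<in>(\<lambda>v. (0, v)) ` Basis. pweight c d b) = (\<Sum>b\<in>Basis. d b)"
    by (subst sum.reindex) (auto simp: pweight_def inj_on_def intro!: sum.cong)
  finally show ?thesis .
qed

lemma pweight_pos:
  assumes "\<And>b. b \<in> Basis \<Longrightarrow> c b > 0" "\<And>b. b \<in> Basis \<Longrightarrow> d b > 0" "b \<in> Basis"
  shows "pweight c d b > 0"
  using assms by (auto simp: Basis_prod_def pweight_def)

definition time_star :: "('g \<Rightarrow> 'g \<Rightarrow> 'g) \<Rightarrow> real \<times> 'g \<Rightarrow> real \<times> 'g \<Rightarrow> real \<times> 'g" where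
  "time_star star p q = (fst p + fst q, star (snd p) (snd q))"

text \<open>With weight 2 on time, \<open>dt\<close> scales like the square of a field that is
  homogeneous of degree one.\<close>

abbreviation time_weight :: "('g::euclidean_space \<Rightarrow> real) \<Rightarrow> real \<times> 'g \<Rightarrow> real" where
  "time_weight \<equiv> pweight (\<lambda>_. 2)"

context hom_group
begin

lemma time_hom_group: "hom_group (time_star star) (time_weight c)"
proof
  show "0 < time_weight c b" if "b \<in> Basis" for b
    using that by (intro pweight_pos) (auto simp: c_pos)
  have inv: "grp_inv (time_star star) = (\<lambda>p. (- fst p, gi (snd p)))"
  proof
    fix p :: "real \<times> 'g"
    show "grp_inv (time_star star) p = (- fst p, gi (snd p))"
      unfolding grp_inv_def[of "time_star star"]
    proof (rule the_equality)
      fix y assume "time_star star p y = 0 \<and> time_star star y p = 0"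
      then show "y = (- fst p, gi (snd p))"
        using gi_unique[of "snd p" "snd y"] by (auto simp: time_star_def zero_prod_def prod_eq_iff)
    qed (simp add: time_star_def zero_prod_def)
  qed
  show "hom_lie_group (time_star star) (wdil (time_weight c))"
    unfolding hom_lie_group_def
  proof (intro conjI allI impI)
    fix x :: "real \<times> 'g"
    show "\<exists>y. time_star star x y = 0 \<and> time_star star y x = 0"
      by (rule exI[of _ "(- fst x, gi (snd x))"]) (simp add: time_star_def zero_prod_def)
  next
    show "smooth_map_on UNIV (\<lambda>(x, y). time_star star x y)"
      unfolding time_star_def case_prod_unfold
      by (intro smooth_map_on_Pair smooth_star_comp smooth_map_on_snd smooth_map_on_fst smooth_map_on_id
          smooth_map_on_bounded_linear bounded_linear_add bounded_linear_intros open_UNIV)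
    show "smooth_map_on UNIV (grp_inv (time_star star))"
      unfolding inv
      by (intro smooth_map_on_Pair smooth_gi_comp smooth_map_on_snd smooth_map_on_id
          smooth_map_on_bounded_linear bounded_linear_minus bounded_linear_fst open_UNIV)
    fix r :: real and x y :: "real \<times> 'g" assume "0 < r"
    then show "wdil (time_weight c) r (time_star star x y)
        = time_star star (wdil (time_weight c) r x) (wdil (time_weight c) r y)"
      by (simp add: wdil_pweight time_star_def wdil_star)
        (simp add: wdil_def algebra_simps)
  qed (auto simp: time_star_def assoc zero_prod_def)
qed

end

section \<open>Uniqueness for the heat operator\<close>

text \<open>Expressing the partial derivatives through the total derivative on space-time makes the
  lemmas about kernels applicable.\<close>

lemma vf_space_eq:
  assumes "\<phi> differentiable (at w)"
  shows "vf_space V \<phi> w = frechet_derivative \<phi> (at w) (0, V (snd w))"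
  using slice_frechet_derivative_snd[of \<phi> "fst w" "snd w"] assms
  by (simp add: vf_space_def vf_apply_def)

lemma dt_eq:
  assumes "\<phi> differentiable (at w)"
  shows "dt \<phi> w = frechet_derivative \<phi> (at w) (1, 0)"
proof -
  have "((\<lambda>s. \<phi> (s, snd w)) has_derivative (\<lambda>h. frechet_derivative \<phi> (at w) (h, 0))) (at (fst w))"
    using slice_has_derivative_fst[of \<phi> "fst w" "snd w"] assms by simp
  moreover have "(\<lambda>h. frechet_derivative \<phi> (at w) (h, 0)) = (*) (frechet_derivative \<phi> (at w) (1, 0))"
  proof
    fix h :: real
    have "frechet_derivative \<phi> (at w) (h *\<^sub>R (1, 0)) = h *\<^sub>R frechet_derivative \<phi> (at w) (1, 0)"
      using linear_frechet_derivative[OF assms] by (rule linear_scale)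
    then show "frechet_derivative \<phi> (at w) (h, 0) = frechet_derivative \<phi> (at w) (1, 0) * h"
      by (simp add: mult.commute)
  qed
  ultimately have "((\<lambda>s. \<phi> (s, snd w)) has_real_derivative frechet_derivative \<phi> (at w) (1, 0)) (at (fst w))"
    by (simp add: has_field_derivative_def)
  then show ?thesis unfolding dt_def by (rule DERIV_imp_deriv)
qed

lemma smooth_on_vf_space:
  assumes \<phi>: "smooth_on UNIV \<phi>" and V: "smooth_map_on UNIV V"
  shows "smooth_on UNIV (vf_space V \<phi>)"
proof -
  have "vf_space V \<phi> = (\<lambda>w. frechet_derivative \<phi> (at w) (0, V (snd w)))"
    using vf_space_eq smooth_on_differentiable[OF \<phi>] by blast
  moreover have "smooth_on UNIV (\<lambda>w. frechet_derivative \<phi> (at w) (0, V (snd w)))"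
    by (intro smooth_on_vf_apply \<phi> smooth_map_on_Pair smooth_map_on_compose[OF V]) auto
  ultimately show ?thesis by simp
qed

lemma smooth_on_dt:
  assumes \<phi>: "smooth_on UNIV \<phi>"
  shows "smooth_on UNIV (dt \<phi>)"
proof -
  have "dt \<phi> = (\<lambda>w. frechet_derivative \<phi> (at w) (1, 0))"
    using dt_eq smooth_on_differentiable[OF \<phi>] by blast
  moreover have "smooth_on UNIV (\<lambda>w. frechet_derivative \<phi> (at w) (1, 0))"
    by (intro smooth_on_vf_apply \<phi>) auto
  ultimately show ?thesis by simp
qed

context hom_group
begin

lemma proper_kernel_convolution:
  assumes \<phi>: "smooth_on UNIV \<phi>" and K: "compact K" and supp: "\<And>x. x \<notin> K \<Longrightarrow> \<phi> x = 0"
  shows "proper_kernel (\<lambda>p. \<phi> (star (fst p) (gi (snd p))))"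
  unfolding proper_kernel_def
proof (intro conjI allI impI)
  show "smooth_on UNIV (\<lambda>p. \<phi> (star (fst p) (gi (snd p))))"
    by (intro smooth_on_compose[OF \<phi>] smooth_star_comp smooth_gi_comp) auto
  fix C :: "'g set" assume C: "compact C"
  let ?C' = "(\<lambda>p. star (fst p) (snd p)) ` (gi ` K \<times> C)"
  show "\<exists>C'. compact C' \<and> (\<forall>z\<in>C. \<forall>y. \<phi> (star (fst (z, y)) (gi (snd (z, y)))) \<noteq> 0 \<longrightarrow> y \<in> C')"
  proof (intro exI[of _ ?C'] conjI ballI allI impI)
    show "compact ?C'" by (intro compact_star compact_gi K C)
    fix z y assume "z \<in> C" "\<phi> (star (fst (z, y)) (gi (snd (z, y)))) \<noteq> 0"
    then have "star z (gi y) \<in> K" using supp by force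
    moreover have "y = star (gi (star z (gi y))) z" by (simp add: gi_star assoc)
    ultimately show "y \<in> ?C'" using \<open>z \<in> C\<close> by force
  qed
qed

text \<open>Over a large \<open>z\<close> the kernel only sees values of \<open>u\<close> near infinity, on a set of bounded volume.\<close>

lemma convolution_tendsto_0:
  assumes \<phi>: "smooth_on UNIV \<phi>" and K: "compact K" and supp: "\<And>x. x \<notin> K \<Longrightarrow> \<phi> x = 0"
    and u: "u \<in> borel_measurable lborel" and int: "\<And>K. compact K \<Longrightarrow> set_integrable lborel K u"
    and lim: "(u \<longlongrightarrow> 0) at_infinity"
  shows "((\<lambda>z. \<integral>y. u y * \<phi> (star z (gi y)) \<partial>lborel) \<longlongrightarrow> 0) at_infinity"
proof (rule tendstoI)
  fix e :: real assume e: "e > 0"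
  obtain C where C: "C \<ge> 0" "\<And>z. emeasure lborel {y. star z (gi y) \<in> K} \<le> ennreal C"
    using right_translate_emeasure_bounded[OF K] by blast
  have "compact (\<phi> ` K)"
    using smooth_on_imp_continuous_on[OF \<phi>] by (intro compact_continuous_image K) (rule continuous_on_subset, auto)
  then obtain B0 where B0: "\<forall>x\<in>\<phi> ` K. norm x \<le> B0"
    using compact_imp_bounded[of "\<phi> ` K"] unfolding bounded_iff by blast
  define B where "B = \<bar>B0\<bar>"
  have B0': "B \<ge> 0" by (simp add: B_def)
  have B: "\<bar>\<phi> x\<bar> \<le> B" for x
  proof (cases "x \<in> K")
    case True
    then have "\<bar>\<phi> x\<bar> \<le> B0" using B0 by simp
    then show ?thesis by (simp add: B_def)
  next
    case False
    then show ?thesis using supp B0' by simp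
  qed
  \<comment> \<open>The added 1 keeps the denominator positive when \<open>B * C = 0\<close> and
    makes the final estimate strict.\<close>
  define e' where "e' = e / (B * C + 1)"
  have BC: "0 \<le> B * C" using B0' C by simp
  then have e': "e' > 0" using e by (simp add: e'_def add_nonneg_pos)
  have "\<forall>\<^sub>F y in at_infinity. dist (u y) 0 < e'"
    using lim e' by (rule tendstoD)
  then obtain R where R: "\<And>y. R \<le> norm y \<Longrightarrow> \<bar>u y\<bar> < e'"
    unfolding eventually_at_infinity by (auto simp: dist_norm)
  have "bounded ((\<lambda>p. star (fst p) (snd p)) ` (K \<times> cball 0 \<bar>R\<bar>))"
    by (intro compact_imp_bounded compact_star K compact_cball)
  \<comment> \<open>\<open>R2\<close> bounds the product of \<open>K\<close> with the ball on which
    \<open>u\<close> may be large. Since \<open>z = star (star z (gi y)) y\<close>, a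
    \<open>z\<close> of norm above \<open>R2\<close> with \<open>star z (gi y)\<close> in
    \<open>K\<close> forces \<open>y\<close> out of that ball.\<close>
  then obtain R2 where R2: "\<forall>x\<in>(\<lambda>p. star (fst p) (snd p)) ` (K \<times> cball 0 \<bar>R\<bar>). norm x \<le> R2"
    unfolding bounded_iff by blast
  have "dist (\<integral>y. u y * \<phi> (star z (gi y)) \<partial>lborel) 0 < e" if z: "R2 + 1 \<le> norm z" for z
  proof -
    let ?A = "{y. star z (gi y) \<in> K}"
    have "closed ?A"
      using continuous_closed_vimage[of K "\<lambda>y. star z (gi y)"] compact_imp_closed[OF K]
        continuous_on_star[OF continuous_on_const continuous_on_gi[OF continuous_on_id]]
      by (metis UNIV_I continuous_on_eq_continuous_at open_UNIV vimage_def)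
    then have A [measurable]: "?A \<in> sets lborel" by simp
    have fin: "emeasure lborel ?A < \<infinity>"
      using C(2)[of z] by (simp add: order_le_less_trans)
    have meas: "measure lborel ?A \<le> C"
      using C by (simp add: measure_def enn2real_leI)
    have bound: "\<bar>u y * \<phi> (star z (gi y))\<bar> \<le> e' * B * indicator ?A y" for y
    proof (cases "star z (gi y) \<in> K")
      case True
      have "y \<notin> cball 0 \<bar>R\<bar>"
      proof
        assume y: "y \<in> cball 0 \<bar>R\<bar>"
        have "z = star (star z (gi y)) y" by (simp add: assoc)
        then have "norm z \<le> R2" using R2 True y by force
        then show False using z by simp
      qed
      then have "\<bar>u y\<bar> \<le> e'" using R[of y] by (simp add: not_le abs_less_iff abs_le_iff)
      then have "\<bar>u y\<bar> * \<bar>\<phi> (star z (gi y))\<bar> \<le> e' * B"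
        using B B0' e' by (intro mult_mono) auto
      then show ?thesis using True by (simp add: abs_mult)
    next
      case False
      then show ?thesis using supp by simp
    qed
    have ind: "integrable lborel (\<lambda>y. e' * B * indicator ?A y :: real)"
      using A fin by (auto intro!: integrable_mult_right integrable_real_indicator)
    have "integrable lborel (\<lambda>y. u y * \<phi> (star z (gi y)))"
      using kernel_integrable[OF u int proper_kernel_convolution[OF \<phi> K supp], of z] by simp
    then have "\<bar>\<integral>y. u y * \<phi> (star z (gi y)) \<partial>lborel\<bar> \<le> (\<integral>y. e' * B * indicator ?A y \<partial>lborel)"
      by (intro order_trans[OF integral_abs_bound] integral_mono integrable_abs ind bound)
    also have "\<dots> = e' * B * measure lborel ?A" by simp
    also have "\<dots> \<le> e' * B * C"
      using meas B0' e' by (intro mult_left_mono) auto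
    also have "\<dots> = e * (B * C / (B * C + 1))" by (simp add: e'_def)
    also have "\<dots> < e * 1"
      using e BC by (intro mult_strict_left_mono) auto
    finally show ?thesis by (simp add: dist_norm)
  qed
  then show "\<forall>\<^sub>F z in at_infinity. dist (\<integral>y. u y * \<phi> (star z (gi y)) \<partial>lborel) 0 < e"
    unfolding eventually_at_infinity by blast
qed

text \<open>If \<open>u w > 0\<close>, a nonnegative bump supported close to the identity makes
  \<open>y \<mapsto> \<phi> (star w (gi y))\<close> live where \<open>u\<close> is positive; the
  integral of a nonnegative function that is positive on a nonempty open set cannot be
  \<open>\<le> 0\<close>. A single bump suffices, without passing to a limit.\<close>

lemma convolution_nonpos_imp_nonpos:
  assumes u: "u \<in> borel_measurable lborel" and int: "\<And>K. compact K \<Longrightarrow> set_integrable lborel K u"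
    and cont: "continuous_on (UNIV - {0}) u"
    and nonpos: "\<And>\<phi> K. smooth_on UNIV \<phi> \<Longrightarrow> compact K \<Longrightarrow> (\<And>x. x \<notin> K \<Longrightarrow> \<phi> x = 0) \<Longrightarrow>
      (\<integral>y. u y * \<phi> (star w (gi y)) \<partial>lborel) \<le> 0"
    and w: "w \<noteq> 0"
  shows "u w \<le> 0"
proof (rule ccontr)
  assume "\<not> u w \<le> 0"
  then have uw: "u w > 0" by simp
  define S where "S = (UNIV - {0}) \<inter> u -` {0<..}"
  have S: "open S" "w \<in> S" "\<And>y. y \<in> S \<Longrightarrow> u y > 0"
    unfolding S_def using uw w continuous_open_preimage[OF cont, of "{0<..}"] by auto
  \<comment> \<open>The point \<open>y\<close> with \<open>star w (gi y) = k\<close> is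
    \<open>star (gi k) w\<close>, so this open set tells how small the support of the bump has to
    be.\<close>
  have "open ((\<lambda>k. star (gi k) w) -` S)"
    using continuous_open_preimage[OF continuous_on_star[OF continuous_on_gi[OF continuous_on_id] continuous_on_const[of UNIV w]] open_UNIV S(1)]
    by simp
  moreover have "0 \<in> (\<lambda>k. star (gi k) w) -` S" using S(2) by simp
  ultimately obtain \<rho> where \<rho>: "\<rho> > 0" "ball 0 \<rho> \<subseteq> (\<lambda>k. star (gi k) w) -` S"
    using open_contains_ball by blast
  obtain \<phi> :: "'g \<Rightarrow> real" where \<phi>: "smooth_on UNIV \<phi>" "\<And>x. 0 \<le> \<phi> x" "\<phi> 0 > 0" "\<And>x. \<rho> \<le> norm x \<Longrightarrow> \<phi> x = 0"
    using smooth_bump_exists[OF \<rho>(1)] by blast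
  have supp: "\<phi> x = 0" if "x \<notin> cball 0 \<rho>" for x using \<phi>(4) that by simp
  let ?f = "\<lambda>y. u y * \<phi> (star w (gi y))"
  have f0: "0 \<le> ?f y" for y
  proof (cases "norm (star w (gi y)) < \<rho>")
    case True
    then have "star (gi (star w (gi y))) w \<in> S" using \<rho>(2) by auto
    then have "y \<in> S" by (simp add: gi_star assoc)
    then show ?thesis using S(3) \<phi>(2) by (simp add: less_imp_le)
  qed (use \<phi>(4) in simp)
  have f_int: "integrable lborel ?f"
    using kernel_integrable[OF u int proper_kernel_convolution[OF \<phi>(1) compact_cball[of 0 \<rho>] supp], of w] by simp
  have "(\<integral>y. ?f y \<partial>lborel) \<le> 0"
    by (rule nonpos[OF \<phi>(1) compact_cball[of 0 \<rho>] supp])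
  moreover have "(\<integral>y. ?f y \<partial>lborel) \<ge> 0"
    by (rule integral_nonneg_AE) (simp add: f0)
  ultimately have "AE y in lborel. ?f y = 0"
    using integral_nonneg_eq_0_iff_AE[OF f_int] f0 by simp
  moreover define T where "T = S \<inter> (\<lambda>y. \<phi> (star w (gi y))) -` {0<..}"
  have "continuous_on UNIV (\<lambda>y. \<phi> (star w (gi y)))"
    by (rule continuous_on_compose2[OF smooth_on_imp_continuous_on[OF \<phi>(1)]
        continuous_on_star[OF continuous_on_const continuous_on_gi[OF continuous_on_id]]]) simp
  then have T: "open T"
    unfolding T_def by (intro open_Int S(1) continuous_open_vimage) (simp_all add: continuous_on_eq_continuous_at)
  have wT: "w \<in> T" using S(2) \<phi>(3) by (simp add: T_def)
  have "y \<notin> T" if "?f y = 0" for y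
    using that S(3)[of y] by (auto simp: T_def)
  ultimately have "AE y in lborel. y \<notin> T"
    by (elim eventually_mono) blast
  then have "T \<in> null_sets lborel"
    using T by (simp add: AE_iff_null_sets)
  then have "negligible T"
    using null_sets_completionI negligible_iff_null_sets by blast
  then show False
    using open_not_negligible[OF T] wT by blast
qed

text \<open>The maximum principle bounds a function from one side only, so the argument is made for
  an upper bound and later applied to \<open>u\<close> and \<open>- u\<close>.\<close>

lemma heat_solution_nonpos:
  assumes Z: "\<And>j. j \<in> J \<Longrightarrow> smooth_map_on UNIV (Z j)" "\<And>j. j \<in> J \<Longrightarrow> left_invariant star (Z j)"
    and cont: "continuous_on (UNIV - {0}) u"
    and int: "\<And>K. compact K \<Longrightarrow> set_integrable lborel K u"
    and lim: "(u \<longlongrightarrow> 0) at_infinity"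
    and weak: "\<And>\<phi>. test_function \<phi> \<Longrightarrow>
      (\<integral>w. u w * ((\<Sum>j\<in>J. vf_space (Z j) (vf_space (Z j) \<phi>) w) + dt \<phi> w) \<partial>lborel) = 0"
    and w: "w \<noteq> 0"
  shows "u w \<le> 0"
proof -
  interpret E: hom_group "time_star star" "time_weight c"
    by (rule time_hom_group)
  have u: "u \<in> borel_measurable lborel"
    using borel_measurable_continuous_countable_exceptions[of "{0}" u] cont
    by (simp add: Compl_eq_Diff_UNIV)
  \<comment> \<open>Fields on space-time with constant time component \<open>\<tau>\<close> and
    space component \<open>V\<close> satisfy the translation identity of the extended group. The
    cases used are \<open>\<tau> = 0\<close> with \<open>V = Z j\<close>, and
    \<open>\<tau> = 1\<close> with \<open>V = 0\<close>.\<close>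
  have field: "frechet_derivative (time_star star a) (at 0) (\<tau>, V (snd 0)) = (\<tau>, V (snd a))"
    if "\<And>a. frechet_derivative (star a) (at 0) (V 0) = V a" for a \<tau> V
  proof -
    have "smooth_map_on UNIV (star (snd a))"
      using smooth_star_comp[of UNIV "\<lambda>_. snd a" "\<lambda>x. x"] by simp
    then have "(star (snd a) has_derivative frechet_derivative (star (snd a)) (at 0)) (at (snd (0 :: real \<times> 'g)))"
      using smooth_map_on_differentiable frechet_derivative_works by force
    then have "((\<lambda>p. (fst a + fst p, star (snd a) (snd p))) has_derivative
        (\<lambda>h. (0 + fst h, frechet_derivative (star (snd a)) (at 0) (snd h)))) (at 0)"
      by (intro has_derivative_Pair has_derivative_add has_derivative_const
          has_derivative_compose[OF bounded_linear_imp_has_derivative[OF bounded_linear_snd]]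
          bounded_linear_imp_has_derivative bounded_linear_fst)
    then have "(time_star star a has_derivative
        (\<lambda>h. (0 + fst h, frechet_derivative (star (snd a)) (at 0) (snd h)))) (at 0)"
      by (simp add: time_star_def[abs_def])
    from fun_cong[OF frechet_derivative_at[OF this, symmetric], of "(\<tau>, V (snd 0))"]
    show ?thesis using that by simp
  qed
  show ?thesis
  proof (rule E.convolution_nonpos_imp_nonpos[OF u int cont _ w])
    fix \<phi> :: "real \<times> 'g \<Rightarrow> real" and K
    assume \<phi>: "smooth_on UNIV \<phi>" and K: "compact K" and supp: "\<And>x. x \<notin> K \<Longrightarrow> \<phi> x = 0"
    define \<Psi> where "\<Psi> = (\<lambda>p. \<phi> (time_star star (fst p) (E.gi (snd p))))"
    define v where "v z = (\<integral>y. u y * \<Psi> (z, y) \<partial>lborel)" for z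
    have \<Psi>: "proper_kernel \<Psi>"
      unfolding \<Psi>_def by (rule E.proper_kernel_convolution[OF \<phi> K supp])
    have s\<Psi>: "smooth_on UNIV \<Psi>" by (rule proper_kernel_smooth[OF \<Psi>])
    have sv: "smooth_on UNIV v"
      unfolding v_def by (rule kernel_integral(1)[OF u int \<Psi>])
    have lim_v: "(v \<longlongrightarrow> 0) at_infinity"
      using E.convolution_tendsto_0[OF \<phi> K supp u int lim] by (simp add: v_def[abs_def] \<Psi>_def)
    have KI: "frechet_derivative (\<lambda>z. \<integral>y. u y * \<Phi> (z, y) \<partial>lborel) (at z) h
        = (\<integral>y. u y * frechet_derivative \<Phi> (at (z, y)) (h, 0) \<partial>lborel)"
      if "proper_kernel \<Phi>" for \<Phi> z h
      by (rule kernel_integral(2)[OF u int that])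
    have heat: "(\<Sum>j\<in>J. vf_space (Z j) (vf_space (Z j) v) z) - dt v z = 0" for z
    proof -
      \<comment> \<open>For fixed \<open>z\<close> the kernel itself is the test function. The weak
        equation already contains the adjoint operator acting on \<open>y\<close>, so no integration
        by parts takes place.\<close>
      define \<psi> where "\<psi> = (\<lambda>y. \<Psi> (z, y))"
      have s\<psi>: "smooth_on UNIV \<psi>"
        unfolding \<psi>_def by (rule smooth_on_slice_snd[OF s\<Psi>])
      have "test_function \<psi>"
      proof -
        obtain C' where C': "compact C'" "\<And>y. \<Psi> (z, y) \<noteq> 0 \<Longrightarrow> y \<in> C'"
          using \<Psi> compact_sing[of z] unfolding proper_kernel_def by (metis singletonI)
        then have "closure {y. \<psi> y \<noteq> 0} \<subseteq> C'"
          by (intro closure_minimal compact_imp_closed) (auto simp: \<psi>_def)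
        then have "compact (closure {y. \<psi> y \<noteq> 0})"
          using compact_Int_closed[OF C'(1) closed_closure] by (metis inf.absorb2)
        then show ?thesis using s\<psi> by (simp add: test_function_def)
      qed
      \<comment> \<open>This is \<open>Z j\<close> applied twice in the first variable. It is again
        a proper kernel, and \<open>Z\<psi>\<close> below identifies it with \<open>Z j\<close>
        applied twice to \<open>\<psi>\<close>.\<close>
      define \<Psi>2 where "\<Psi>2 j p = frechet_derivative (\<lambda>q. frechet_derivative \<Psi> (at q) ((0, Z j (snd (fst q))), 0))
        (at p) ((0, Z j (snd (fst p))), 0)" for j p
      have sV: "smooth_map_on UNIV (\<lambda>p :: real \<times> 'g. (0 :: real, Z j (snd p)))" if "j \<in> J" for j
        by (intro smooth_map_on_Pair smooth_map_on_compose[OF Z(1)[OF that]]) auto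
      have sV': "smooth_map_on UNIV (\<lambda>p :: (real \<times> 'g) \<times> (real \<times> 'g). (0 :: real, Z j (snd (fst p))))" if "j \<in> J" for j
        by (intro smooth_map_on_compose[OF sV[OF that]]) auto
      have k1: "proper_kernel (\<lambda>q. frechet_derivative \<Psi> (at q) ((0, Z j (snd (fst q))), 0))" if "j \<in> J" for j
        by (rule proper_kernel_derivative[OF \<Psi> sV'[OF that]])
      have k2: "proper_kernel (\<Psi>2 j)" if "j \<in> J" for j
        unfolding \<Psi>2_def by (rule proper_kernel_derivative[OF k1[OF that] sV'[OF that]])
      have ZZv: "vf_space (Z j) (vf_space (Z j) v) z = (\<integral>y. u y * \<Psi>2 j (z, y) \<partial>lborel)" if j: "j \<in> J" for j
      proof -
        have Zv: "vf_space (Z j) v = (\<lambda>x. \<integral>y. u y * frechet_derivative \<Psi> (at (x, y)) ((0, Z j (snd x)), 0) \<partial>lborel)"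
        proof
          fix x
          show "vf_space (Z j) v x = (\<integral>y. u y * frechet_derivative \<Psi> (at (x, y)) ((0, Z j (snd x)), 0) \<partial>lborel)"
            using vf_space_eq[OF smooth_on_differentiable[OF sv open_UNIV UNIV_I], of "Z j" x] KI[OF \<Psi>]
            by (simp add: v_def[abs_def])
        qed
        have "vf_space (Z j) (vf_space (Z j) v) z = frechet_derivative (vf_space (Z j) v) (at z) (0, Z j (snd z))"
          by (intro vf_space_eq smooth_on_differentiable[OF smooth_on_vf_space[OF sv Z(1)[OF j]]]) auto
        also have "\<dots> = (\<integral>y. u y * \<Psi>2 j (z, y) \<partial>lborel)"
          using KI[OF k1[OF j], of z "(0, Z j (snd z))"] unfolding Zv by (simp add: \<Psi>2_def)
        finally show ?thesis .
      qed
      have dtv: "dt v z = (\<integral>y. u y * frechet_derivative \<Psi> (at (z, y)) ((1, 0), 0) \<partial>lborel)"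
        using dt_eq[OF smooth_on_differentiable[OF sv open_UNIV UNIV_I], of z]
          KI[OF \<Psi>, of z "(1, 0)"] unfolding v_def by simp
      have d\<Psi>: "\<Psi> differentiable (at p)" for p
        by (rule proper_kernel_differentiable[OF \<Psi>])
      have Z\<psi>: "vf_space (Z j) (vf_space (Z j) \<psi>) y = \<Psi>2 j (z, y)" if j: "j \<in> J" for j y
      proof -
        let ?B = "\<lambda>q. frechet_derivative \<Psi> (at q) (0, (0, Z j (snd (snd q))))"
        have sB: "smooth_on UNIV ?B"
          by (intro smooth_on_vf_apply s\<Psi> smooth_map_on_Pair smooth_map_on_compose[OF Z(1)[OF j]]
              smooth_map_on_const smooth_map_on_snd smooth_map_on_snd' open_UNIV subset_UNIV)
        have "vf_space (Z j) \<psi> = (\<lambda>y. ?B (z, y))"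
        proof
          fix y
          show "vf_space (Z j) \<psi> y = ?B (z, y)"
            using vf_space_eq[OF smooth_on_differentiable[OF s\<psi> open_UNIV UNIV_I], of "Z j" y]
              slice_frechet_derivative_snd[OF d\<Psi>, of z y] by (simp add: \<psi>_def)
        qed
        moreover have "vf_space (Z j) (\<lambda>y. ?B (z, y)) y = frechet_derivative ?B (at (z, y)) (0, (0, Z j (snd y)))"
          using vf_space_eq[OF smooth_on_differentiable[OF smooth_on_slice_snd[OF sB] open_UNIV UNIV_I], of "Z j" z y]
            slice_frechet_derivative_snd[OF smooth_on_differentiable[OF sB open_UNIV UNIV_I], of z y] by simp
        moreover have "\<dots> = \<Psi>2 j (z, y)"
          using E.diff_kernel_second_order[OF \<phi> sV[OF j] field[OF left_invariant_derivative[OF Z(2)[OF j]]], of "(z, y)"]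
          by (simp add: \<Psi>2_def \<Psi>_def)
        ultimately show ?thesis by simp
      qed
      \<comment> \<open>A first-order term is moved with a single change of sign: this turns
        \<open>- dt\<close> in \<open>z\<close> into \<open>+ dt\<close> in \<open>y\<close>, as in
        the adjoint.\<close>
      have dt\<psi>: "dt \<psi> y = - frechet_derivative \<Psi> (at (z, y)) ((1, 0), 0)" for y
      proof -
        have const: "smooth_map_on UNIV (star a)" for a
          using smooth_star_comp[of UNIV "\<lambda>_. a" "\<lambda>x. x"] by simp
        have "frechet_derivative (star a) (at 0) 0 = 0" for a
          using linear_0[OF linear_frechet_derivative[OF smooth_map_on_differentiable[OF const open_UNIV UNIV_I]]] .
        from field[of "\<lambda>_. 0" _ 1, OF this]
        have T: "frechet_derivative (time_star star a) (at 0) (1, 0) = (1, 0)" for a by simp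
        have "dt \<psi> y = frechet_derivative \<Psi> (at (z, y)) (0, (1, 0))"
          using dt_eq[OF smooth_on_differentiable[OF s\<psi> open_UNIV UNIV_I], of y]
            slice_frechet_derivative_snd[OF d\<Psi>, of z y] by (simp add: \<psi>_def)
        then show ?thesis
          using E.diff_kernel_antisym[OF \<phi>, of "\<lambda>_. (1, 0)" "(z, y)", OF T] by (simp add: \<Psi>_def)
      qed
      have i1: "integrable lborel (\<lambda>y. u y * \<Psi>2 j (z, y))" if "j \<in> J" for j
        by (rule kernel_integrable[OF u int k2[OF that]])
      have i2: "integrable lborel (\<lambda>y. u y * frechet_derivative \<Psi> (at (z, y)) ((1, 0), 0))"
        by (rule kernel_integrable[OF u int proper_kernel_derivative[OF \<Psi> smooth_map_on_const]])
      have "(\<Sum>j\<in>J. vf_space (Z j) (vf_space (Z j) v) z) - dt v z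
          = (\<integral>y. (\<Sum>j\<in>J. u y * \<Psi>2 j (z, y)) - u y * frechet_derivative \<Psi> (at (z, y)) ((1, 0), 0) \<partial>lborel)"
        using i1 i2 by (subst Bochner_Integration.integral_diff)
          (auto intro!: Bochner_Integration.integrable_sum simp: Bochner_Integration.integral_sum ZZv dtv)
      also have "\<dots> = (\<integral>y. u y * ((\<Sum>j\<in>J. vf_space (Z j) (vf_space (Z j) \<psi>) y) + dt \<psi> y) \<partial>lborel)"
        by (rule Bochner_Integration.integral_cong) (simp_all add: Z\<psi> dt\<psi> sum_distrib_left algebra_simps)
      also have "\<dots> = 0" by (rule weak[OF \<open>test_function \<psi>\<close>])
      finally show ?thesis .
    qed
    have "v w \<le> 0"
      by (rule heat_max_principle[OF sv lim_v Z(1) heat])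
    then show "(\<integral>y. u y * \<phi> (time_star star w (E.gi y)) \<partial>lborel) \<le> 0"
      by (simp add: v_def \<Psi>_def)
  qed
qed

lemma heat_solution_eq_0:
  assumes Z: "\<And>j. j \<in> J \<Longrightarrow> smooth_map_on UNIV (Z j)" "\<And>j. j \<in> J \<Longrightarrow> left_invariant star (Z j)"
    and cont: "continuous_on (UNIV - {0}) u"
    and int: "\<And>K. compact K \<Longrightarrow> set_integrable lborel K u"
    and lim: "(u \<longlongrightarrow> 0) at_infinity"
    and weak: "\<And>\<phi>. test_function \<phi> \<Longrightarrow>
      (\<integral>w. u w * ((\<Sum>j\<in>J. vf_space (Z j) (vf_space (Z j) \<phi>) w) + dt \<phi> w) \<partial>lborel) = 0"
    and w: "w \<noteq> 0"
  shows "u w = 0"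
proof -
  have "u w \<le> 0"
    by (rule heat_solution_nonpos[OF Z cont int lim weak w])
  moreover have "- u w \<le> 0"
  proof (rule heat_solution_nonpos[OF Z, where u = "\<lambda>w. - u w"])
    show "continuous_on (UNIV - {0}) (\<lambda>w. - u w)"
      using cont by (intro continuous_intros)
    show "set_integrable lborel K (\<lambda>w. - u w)" if "compact K" for K
      using int[OF that] by (simp add: set_integrable_def)
    show "((\<lambda>w. - u w) \<longlongrightarrow> 0) at_infinity"
      using tendsto_minus[OF lim] by simp
    show "(\<integral>w. - u w * ((\<Sum>j\<in>J. vf_space (Z j) (vf_space (Z j) \<phi>) w) + dt \<phi> w) \<partial>lborel) = 0"
      if "test_function \<phi>" for \<phi>
      using weak[OF that] by simp
  qed (use w in auto)
  ultimately show ?thesis by linarith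
qed

end

section \<open>Homogeneity of the fundamental solution\<close>

lemma wdil_2_real: "wdil (\<lambda>_. 2) r t = r powr 2 * (t :: real)"
  by (simp add: wdil_def)

lemma frechet_derivative_eq_0_outside:
  fixes f :: "'a::euclidean_space \<Rightarrow> real"
  assumes "closed S" "\<And>x. x \<notin> S \<Longrightarrow> f x = 0" "x \<notin> S"
  shows "frechet_derivative f (at x) = (\<lambda>_. 0)"
proof -
  have "((\<lambda>_. 0 :: real) has_derivative (\<lambda>_. 0)) (at x)" by simp
  then have "(f has_derivative (\<lambda>_. 0)) (at x)"
    by (rule has_derivative_transform_within_open[of _ _ _ _ "- S"]) (use assms in auto)
  from frechet_derivative_at[OF this] show ?thesis by simp
qed

lemma integrable_mult_compact_support:
  fixes u g :: "'a::euclidean_space \<Rightarrow> real"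
  assumes u: "u \<in> borel_measurable lborel" and int: "\<And>K. compact K \<Longrightarrow> set_integrable lborel K u"
    and g: "smooth_on UNIV g" and K: "compact K" "\<And>x. x \<notin> K \<Longrightarrow> g x = 0"
  shows "integrable lborel (\<lambda>y. u y * g y)"
proof -
  have "proper_kernel (\<lambda>p. g (snd p))"
    unfolding proper_kernel_def
  proof (intro conjI allI impI)
    show "smooth_on UNIV (\<lambda>p :: 'a \<times> 'a. g (snd p))"
      by (rule smooth_on_compose[OF g]) auto
    show "\<exists>C'. compact C' \<and> (\<forall>z\<in>C. \<forall>y. g (snd (z, y)) \<noteq> 0 \<longrightarrow> y \<in> C')" for C :: "'a set"
      using K by (intro exI[of _ K]) auto
  qed
  from kernel_integrable[OF u int this, of 0] show ?thesis by simp
qed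

text \<open>Smoothness and compact support make the product of the transformed test function with
  \<open>\<gamma>\<close> integrable, so that the weak equations of two solutions may be
  subtracted.\<close>

lemma heat_adjoint_smooth_support:
  fixes \<phi> :: "real \<times> 'g::euclidean_space \<Rightarrow> real"
  assumes \<phi>: "test_function \<phi>" and Z: "\<And>j. j \<in> J \<Longrightarrow> smooth_map_on UNIV (Z j)"
  shows "smooth_on UNIV (\<lambda>w. (\<Sum>j\<in>J. vf_space (Z j) (vf_space (Z j) \<phi>) w) + dt \<phi> w)"
    and "w \<notin> closure {w. \<phi> w \<noteq> 0} \<Longrightarrow> (\<Sum>j\<in>J. vf_space (Z j) (vf_space (Z j) \<phi>) w) + dt \<phi> w = 0"
proof -
  have s: "smooth_on UNIV \<phi>" using \<phi> by (simp add: test_function_def)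
  have sZ: "smooth_on UNIV (vf_space (Z j) \<phi>)" if "j \<in> J" for j
    by (rule smooth_on_vf_space[OF s Z[OF that]])
  show "smooth_on UNIV (\<lambda>w. (\<Sum>j\<in>J. vf_space (Z j) (vf_space (Z j) \<phi>) w) + dt \<phi> w)"
    by (intro smooth_on_add smooth_on_sum smooth_on_vf_space sZ Z smooth_on_dt[OF s]) auto
  let ?S = "closure {w. \<phi> w \<noteq> 0}"
  have 0: "\<phi> w = 0" if "w \<notin> ?S" for w
    using that closure_subset[of "{w. \<phi> w \<noteq> 0}"] by blast
  have Z0: "vf_space (Z j) \<phi> w = 0" if "w \<notin> ?S" "j \<in> J" for w j
    using vf_space_eq[OF smooth_on_differentiable[OF s open_UNIV UNIV_I], of "Z j" w]
      frechet_derivative_eq_0_outside[OF closed_closure 0 that(1)] by simp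
  assume w: "w \<notin> ?S"
  have "vf_space (Z j) (vf_space (Z j) \<phi>) w = 0" if j: "j \<in> J" for j
    using vf_space_eq[OF smooth_on_differentiable[OF sZ[OF j] open_UNIV UNIV_I], of "Z j" w]
      frechet_derivative_eq_0_outside[OF closed_closure Z0[OF _ j] w] by simp
  moreover have "dt \<phi> w = 0"
    using dt_eq[OF smooth_on_differentiable[OF s open_UNIV UNIV_I], of w]
      frechet_derivative_eq_0_outside[OF closed_closure 0 w] by simp
  ultimately show "(\<Sum>j\<in>J. vf_space (Z j) (vf_space (Z j) \<phi>) w) + dt \<phi> w = 0" by simp
qed

text \<open>\<open>vf_space\<close> freezes time, so the homogeneity of \<open>V\<close> is used on
  the slice at the dilated time \<open>r powr 2 * t\<close>.\<close>

lemma vf_space_wdil: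
  fixes \<psi> :: "real \<times> 'g::euclidean_space \<Rightarrow> real"
  assumes hom: "homogeneous_deg1 (wdil c) V" and \<psi>: "smooth_on UNIV \<psi>" and r: "r > 0"
  shows "vf_space V (\<lambda>w. \<psi> (wdil (time_weight c) r w)) = (\<lambda>w. r * vf_space V \<psi> (wdil (time_weight c) r w))"
proof
  fix w :: "real \<times> 'g"
  obtain t z where w: "w = (t, z)" by fastforce
  let ?f = "\<lambda>z. \<psi> (r powr 2 * t, z)"
  have "vf_apply V (?f \<circ> wdil c r) = (\<lambda>x. r * vf_apply V ?f (wdil c r x))"
    using hom r smooth_on_slice_snd[OF \<psi>] unfolding homogeneous_deg1_def by blast
  then have "vf_apply V (?f \<circ> wdil c r) z = r * vf_apply V ?f (wdil c r z)" by (rule fun_cong)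
  then show "vf_space V (\<lambda>w. \<psi> (wdil (time_weight c) r w)) w = r * vf_space V \<psi> (wdil (time_weight c) r w)"
    by (simp add: vf_space_def w wdil_pweight wdil_2_real comp_def)
qed

lemma vf_space_cmult:
  assumes \<psi>: "smooth_on UNIV \<psi>"
  shows "vf_space V (\<lambda>w. k * \<psi> w) w = k * vf_space V \<psi> w"
proof -
  have d: "(\<psi> has_derivative frechet_derivative \<psi> (at w)) (at w)"
    using smooth_on_has_derivative[OF \<psi>] by simp
  have d': "((\<lambda>w. k * \<psi> w) has_derivative (\<lambda>h. k * frechet_derivative \<psi> (at w) h)) (at w)"
    by (rule has_derivative_mult_right[OF d])
  show ?thesis
    using vf_space_eq[OF differentiableI[OF d], of V] vf_space_eq[OF differentiableI[OF d'], of V]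
      fun_cong[OF frechet_derivative_at[OF d'], of "(0, V (snd w))"] by (simp only:)
qed

lemma dt_wdil:
  fixes \<psi> :: "real \<times> 'g::euclidean_space \<Rightarrow> real"
  assumes \<psi>: "smooth_on UNIV \<psi>" and r: "r > 0"
  shows "dt (\<lambda>w. \<psi> (wdil (time_weight c) r w)) w = r powr 2 * dt \<psi> (wdil (time_weight c) r w)"
proof -
  obtain t z where w: "w = (t, z)" by fastforce
  let ?g = "\<lambda>s. \<psi> (s, wdil c r z)"
  have "?g differentiable (at (r powr 2 * t))"
    by (rule smooth_on_differentiable[OF smooth_on_slice_fst[OF \<psi>]]) auto
  then have "(?g has_real_derivative deriv ?g (r powr 2 * t)) (at (r powr 2 * t))"
    using DERIV_deriv_iff_real_differentiable by blast
  from DERIV_chain2[OF this DERIV_cmult[OF DERIV_ident, of "r powr 2"]]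
  have "((\<lambda>s. ?g (r powr 2 * s)) has_real_derivative deriv ?g (r powr 2 * t) * (r powr 2 * 1)) (at t)" .
  from DERIV_imp_deriv[OF this] show ?thesis
    by (simp add: dt_def w wdil_pweight wdil_2_real)
qed

lemma test_function_wdil:
  assumes \<phi>: "test_function \<phi>" and r: "r > 0"
  shows "test_function (\<lambda>w. \<phi> (wdil c r w))"
proof -
  have "smooth_on UNIV \<phi>" and supp: "compact (closure {w. \<phi> w \<noteq> 0})"
    using \<phi> by (simp_all add: test_function_def)
  then have s: "smooth_on UNIV (\<lambda>w. \<phi> (wdil c r w))"
    by (intro smooth_on_compose[OF _ smooth_map_on_wdil]) auto
  let ?S = "wdil c (1 / r) ` closure {w. \<phi> w \<noteq> 0}"
  have S: "compact ?S"
    by (intro compact_continuous_image continuous_on_wdil continuous_on_id supp)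
  have "{w. \<phi> (wdil c r w) \<noteq> 0} \<subseteq> ?S"
  proof
    fix w assume "w \<in> {w. \<phi> (wdil c r w) \<noteq> 0}"
    then have "wdil c r w \<in> closure {w. \<phi> w \<noteq> 0}"
      using closure_subset[of "{w. \<phi> w \<noteq> 0}"] by blast
    then show "w \<in> ?S" by (rule rev_image_eqI) (simp add: r)
  qed
  then have "closure {w. \<phi> (wdil c r w) \<noteq> 0} \<subseteq> ?S"
    using S by (intro closure_minimal compact_imp_closed)
  then have "compact (closure {w. \<phi> (wdil c r w) \<noteq> 0})"
    using compact_Int_closed[OF S closed_closure] by (metis inf.absorb2)
  with s show ?thesis by (simp add: test_function_def)
qed

text \<open>The inverse dilation is bounded, so large points have large images; this carries the
  limit of \<open>\<gamma>\<close> at infinity over to its rescalings.\<close>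

lemma wdil_norm_bound:
  assumes "r > 0"
  obtains B where "B > 0" "\<And>x. norm x \<le> B * norm (wdil c r x)"
proof -
  obtain B where B: "B > 0" "\<And>x. norm (wdil c (1 / r) x) \<le> norm x * B"
    using bounded_linear.pos_bounded[OF bounded_linear_wdil] by metis
  show ?thesis
    by (rule that[OF B(1)]) (metis B(2) assms mult.commute wdil_inverse(2))
qed

context hom_group
begin

text \<open>For \<open>\<phi>\<close> equal to \<open>\<psi>\<close> after dilation, the operator
  contributes a factor \<open>r powr 2\<close> and the change of variables on space-time a factor
  \<open>r powr (- (2 + ?Q))\<close>. Dilating \<open>\<gamma>\<close> thus multiplies the Dirac
  mass by \<open>r powr (- ?Q)\<close>, and \<open>r powr ?Q * \<gamma> (?D w) - \<gamma> w\<close>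
  solves the equation without source.\<close>

theorem heat_fundamental_solution_homogeneous:
  assumes Z: "\<And>j. j \<in> {1..m} \<Longrightarrow> smooth_map_on UNIV (Z j)" "\<And>j. j \<in> {1..m} \<Longrightarrow> left_invariant star (Z j)"
    and hom: "\<And>j. j \<in> {1..m} \<Longrightarrow> homogeneous_deg1 (wdil c) (Z j)"
    and \<gamma>: "heat_fundamental_solution Z m \<gamma>"
    and r: "r > 0" and w: "w \<noteq> 0"
  shows "\<gamma> (wdil (time_weight c) r w) = r powr (- (\<Sum>b\<in>Basis. c b)) * \<gamma> w"
proof -
  let ?Q = "\<Sum>b\<in>Basis. c b"
  let ?D = "wdil (time_weight c) r"
  define H where "H \<phi> w = (\<Sum>j\<in>{1..m}. vf_space (Z j) (vf_space (Z j) \<phi>) w) + dt \<phi> w" for \<phi> w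
  have \<gamma>_smooth: "smooth_on (UNIV - {0}) \<gamma>"
    and int: "\<And>K. compact K \<Longrightarrow> set_integrable lborel K \<gamma>"
    and lim: "(\<gamma> \<longlongrightarrow> 0) at_infinity"
    and weak: "\<And>\<phi>. test_function \<phi> \<Longrightarrow> (\<integral>w. \<gamma> w * H \<phi> w \<partial>lborel) = - \<phi> 0"
    using \<gamma> unfolding heat_fundamental_solution_def H_def by auto
  have cont: "continuous_on (UNIV - {0}) \<gamma>"
    by (rule smooth_on_imp_continuous_on[OF \<gamma>_smooth])
  have meas: "\<gamma> \<in> borel_measurable lborel"
    using borel_measurable_continuous_countable_exceptions[of "{0}" \<gamma>] cont
    by (simp add: Compl_eq_Diff_UNIV)
  have measD: "(\<lambda>w. \<gamma> (?D w)) \<in> borel_measurable lborel"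
    using meas by simp
  have contD: "continuous_on (UNIV - {0}) (\<lambda>w. \<gamma> (?D w))"
    by (rule continuous_on_compose2[OF cont continuous_on_wdil[OF continuous_on_id]]) (use r in auto)
  have intD: "set_integrable lborel K (\<lambda>w. \<gamma> (?D w))" if K: "compact K" for K
  proof -
    have "compact (?D ` K)"
      by (intro compact_continuous_image continuous_on_wdil continuous_on_id K)
    from integrable_wdil[OF r int[OF this, unfolded set_integrable_def], of "time_weight c"]
    have "integrable lborel (\<lambda>x. indicator (?D ` K) (?D x) *\<^sub>R \<gamma> (?D x))" .
    moreover have "indicator (?D ` K) (?D x) = (indicator K x :: real)" for x
      using inj_image_mem_iff[OF inj_wdil[OF r]] by (auto simp: indicator_def)
    ultimately show ?thesis by (simp add: set_integrable_def)
  qed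
  have limD: "((\<lambda>w. \<gamma> (?D w)) \<longlongrightarrow> 0) at_infinity"
  proof (rule tendstoI)
    fix e :: real assume "e > 0"
    then have "\<forall>\<^sub>F w in at_infinity. dist (\<gamma> w) 0 < e" by (rule tendstoD[OF lim])
    then obtain b where b: "\<And>w. b \<le> norm w \<Longrightarrow> dist (\<gamma> w) 0 < e"
      unfolding eventually_at_infinity by blast
    obtain B where B: "B > 0" "\<And>x. norm x \<le> B * norm (?D x)"
      using wdil_norm_bound[OF r, of "time_weight c"] by blast
    have "dist (\<gamma> (?D w)) 0 < e" if "B * b \<le> norm w" for w
    proof (rule b)
      have "B * b \<le> B * norm (?D w)" using that B(2)[of w] by linarith
      then show "b \<le> norm (?D w)" using B(1) by simp
    qed
    then show "\<forall>\<^sub>F w in at_infinity. dist (\<gamma> (?D w)) 0 < e"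
      unfolding eventually_at_infinity by blast
  qed
  have H_int: "integrable lborel (\<lambda>w. u w * H \<phi> w)"
    if "test_function \<phi>" "u \<in> borel_measurable lborel" "\<And>K. compact K \<Longrightarrow> set_integrable lborel K u" for u \<phi>
  proof -
    have sH: "smooth_on UNIV (H \<phi>)"
      unfolding H_def[abs_def] by (rule heat_adjoint_smooth_support(1)[OF that(1) Z(1)])
    have H0: "H \<phi> x = 0" if x: "x \<notin> closure {w. \<phi> w \<noteq> 0}" for x
      unfolding H_def by (rule heat_adjoint_smooth_support(2)[OF \<open>test_function \<phi>\<close> Z(1) x])
    have K: "compact (closure {w. \<phi> w \<noteq> 0})" using that(1) by (simp add: test_function_def)
    show ?thesis
      by (rule integrable_mult_compact_support[OF that(2,3) sH K H0])
  qed
  have weakD: "(\<integral>w. \<gamma> (?D w) * H \<phi> w \<partial>lborel) = - (r powr (- ?Q)) * \<phi> 0" if \<phi>: "test_function \<phi>" for \<phi>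
  proof -
    define \<psi> where "\<psi> w = \<phi> (wdil (time_weight c) (1 / r) w)" for w
    have \<psi>: "test_function \<psi>"
      unfolding \<psi>_def using r by (intro test_function_wdil[OF \<phi>]) auto
    then have s: "smooth_on UNIV \<psi>" by (simp add: test_function_def)
    have \<phi>_eq: "\<phi> = (\<lambda>w. \<psi> (?D w))" using r by (simp add: \<psi>_def)
    have "H \<phi> w = r powr 2 * H \<psi> (?D w)" for w
    proof -
      have "vf_space (Z j) (vf_space (Z j) \<phi>) w = r powr 2 * vf_space (Z j) (vf_space (Z j) \<psi>) (?D w)"
        if j: "j \<in> {1..m}" for j
      proof -
        have sZ: "smooth_on UNIV (vf_space (Z j) \<psi>)" by (rule smooth_on_vf_space[OF s Z(1)[OF j]])
        have "vf_space (Z j) \<phi> = (\<lambda>w. r * vf_space (Z j) \<psi> (?D w))"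
          unfolding \<phi>_eq by (rule vf_space_wdil[OF hom[OF j] s r])
        moreover have "smooth_on UNIV (\<lambda>w. vf_space (Z j) \<psi> (?D w))"
          by (rule smooth_on_compose[OF sZ smooth_map_on_wdil]) auto
        ultimately have "vf_space (Z j) (vf_space (Z j) \<phi>) w = r * vf_space (Z j) (\<lambda>w. vf_space (Z j) \<psi> (?D w)) w"
          by (simp add: vf_space_cmult)
        also have "\<dots> = r * (r * vf_space (Z j) (vf_space (Z j) \<psi>) (?D w))"
          using fun_cong[OF vf_space_wdil[OF hom[OF j] sZ r], of w] by simp
        finally show ?thesis using r by (simp add: power2_eq_square)
      qed
      moreover have "dt \<phi> w = r powr 2 * dt \<psi> (?D w)"
        unfolding \<phi>_eq by (rule dt_wdil[OF s r])
      ultimately show ?thesis by (simp add: H_def sum_distrib_left distrib_left)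
    qed
    then have "(\<integral>w. \<gamma> (?D w) * H \<phi> w \<partial>lborel) = r powr 2 * (\<integral>w. \<gamma> (?D w) * H \<psi> (?D w) \<partial>lborel)"
      by (simp add: mult.left_commute)
    also have "(\<integral>w. \<gamma> (?D w) * H \<psi> (?D w) \<partial>lborel) = - \<psi> 0 * r powr (- (2 + ?Q))"
    proof -
      have "(\<lambda>w. \<gamma> w * H \<psi> w) \<in> borel_measurable borel"
        using borel_measurable_integrable[OF H_int[OF \<psi> meas int]] by simp
      from integral_wdil[OF r this, of "time_weight c"]
      have "r powr (2 + ?Q) * (\<integral>w. \<gamma> (?D w) * H \<psi> (?D w) \<partial>lborel) = - \<psi> 0"
        using weak[OF \<psi>] by (simp add: sum_pweight)
      moreover have "r powr (2 + ?Q) * r powr (- (2 + ?Q)) = 1"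
        unfolding powr_add[symmetric] using r by simp
      moreover have "I = p * p'" if "P * I = p" "P * p' = 1" for I P p p' :: real
      proof -
        have "p * p' = I * (P * p')" using that(1) by (simp add: algebra_simps)
        then show ?thesis using that(2) by simp
      qed
      ultimately show ?thesis by blast
    qed
    finally have "(\<integral>w. \<gamma> (?D w) * H \<phi> w \<partial>lborel) = - (r powr 2 * r powr (- (2 + ?Q))) * \<psi> 0" by simp
    also have "r powr 2 * r powr (- (2 + ?Q)) = r powr (- ?Q)"
      by (simp add: powr_add[symmetric] del: powr_numeral)
    finally show ?thesis by (simp add: \<psi>_def)
  qed
  have "r powr ?Q * \<gamma> (?D w) - \<gamma> w = 0"
  proof (rule heat_solution_eq_0[OF Z, where u = "\<lambda>w. r powr ?Q * \<gamma> (?D w) - \<gamma> w"])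
    show "continuous_on (UNIV - {0}) (\<lambda>w. r powr ?Q * \<gamma> (?D w) - \<gamma> w)"
      by (intro continuous_on_diff continuous_on_mult continuous_on_const cont contD)
    show "set_integrable lborel K (\<lambda>w. r powr ?Q * \<gamma> (?D w) - \<gamma> w)" if "compact K" for K
      by (intro set_integral_diff set_integrable_mult_right int[OF that] intD[OF that])
    show "((\<lambda>w. r powr ?Q * \<gamma> (?D w) - \<gamma> w) \<longlongrightarrow> 0) at_infinity"
      using tendsto_diff[OF tendsto_mult_left[OF limD, of "r powr ?Q"] lim] by simp
    show "(\<integral>w. (r powr ?Q * \<gamma> (?D w) - \<gamma> w) * ((\<Sum>j\<in>{1..m}. vf_space (Z j) (vf_space (Z j) \<phi>) w) + dt \<phi> w) \<partial>lborel) = 0"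
      if \<phi>: "test_function \<phi>" for \<phi>
    proof -
      have "(\<integral>w. (r powr ?Q * \<gamma> (?D w) - \<gamma> w) * H \<phi> w \<partial>lborel)
          = (\<integral>w. r powr ?Q * (\<gamma> (?D w) * H \<phi> w) - \<gamma> w * H \<phi> w \<partial>lborel)"
        by (rule Bochner_Integration.integral_cong) (simp_all add: algebra_simps)
      also have "\<dots> = r powr ?Q * (\<integral>w. \<gamma> (?D w) * H \<phi> w \<partial>lborel) - (\<integral>w. \<gamma> w * H \<phi> w \<partial>lborel)"
        using H_int[OF \<phi> meas int] H_int[OF \<phi> measD intD] by simp
      also have "\<dots> = 0"
        using r by (simp add: weak[OF \<phi>] weakD[OF \<phi>] powr_minus)
      finally show ?thesis by (simp add: H_def)
    qed
  qed (use w in auto)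
  then show ?thesis using r by (simp add: powr_minus field_simps)
qed

end

section \<open>Integration over the fibres\<close>

lemma integrable_max_powr:
  fixes e :: real
  assumes e: "e < -1"
  shows "(\<integral>\<^sup>+x. ennreal (max 1 \<bar>x\<bar> powr e) \<partial>lborel) < \<infinity>"
proof -
  define I where "I = - (1 powr (e + 1)) / (e + 1)"
  have I: "(\<integral>\<^sup>+x. ennreal (x powr e) * indicator {1..} x \<partial>lborel) = ennreal I"
    unfolding I_def using has_integral_powr_to_inf[OF e, of 1]
    by (intro nn_integral_has_integral_lebesgue') auto
  have I': "(\<integral>\<^sup>+x. ennreal ((-x) powr e) * indicator {1..} (-x) \<partial>lborel) = ennreal I"
    using nn_integral_real_affine[of "\<lambda>x. ennreal (x powr e) * indicator {1..} x" "-1" 0] I by simp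
  have "(\<integral>\<^sup>+x. ennreal (max 1 \<bar>x\<bar> powr e) \<partial>lborel)
    \<le> (\<integral>\<^sup>+x. (indicator {-1..1} x + ennreal (x powr e) * indicator {1..} x)
        + ennreal ((-x) powr e) * indicator {1..} (-x) \<partial>lborel)"
    by (intro nn_integral_mono) (auto simp: indicator_def max_def abs_if)
  also have "\<dots> = (\<integral>\<^sup>+x. indicator {-1..1} x + ennreal (x powr e) * indicator {1..} x \<partial>lborel)
      + (\<integral>\<^sup>+x. ennreal ((-x) powr e) * indicator {1..} (-x) \<partial>lborel)"
    by (rule nn_integral_add) measurable
  also have "(\<integral>\<^sup>+x. indicator {-1..1} x + ennreal (x powr e) * indicator {1..} x \<partial>lborel)
      = (\<integral>\<^sup>+x. indicator {-1..1::real} x \<partial>lborel) + (\<integral>\<^sup>+x. ennreal (x powr e) * indicator {1..} x \<partial>lborel)"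
    by (rule nn_integral_add) measurable
  also have "\<dots> + (\<integral>\<^sup>+x. ennreal ((-x) powr e) * indicator {1..} (-x) \<partial>lborel) < \<infinity>"
    by (simp add: I I')
  finally show ?thesis .
qed

text \<open>A bound in product form is chosen because its integral factorises into integrals over
  the line.\<close>

lemma integrable_prod_max_powr:
  fixes e :: real
  assumes e: "e < -1"
  shows "integrable lborel (\<lambda>x::'a::euclidean_space. \<Prod>b\<in>Basis. max 1 \<bar>x \<bullet> b\<bar> powr e)"
proof -
  have "(\<integral>\<^sup>+x. (\<Prod>b\<in>Basis. ennreal (max 1 \<bar>(x::'a) \<bullet> b\<bar> powr e)) \<partial>lborel)
      = (\<Prod>b\<in>(Basis::'a set). \<integral>\<^sup>+x. ennreal (max 1 \<bar>x\<bar> powr e) \<partial>lborel)"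
    by (rule nn_integral_lborel_prod[where f = "\<lambda>b x. ennreal (max 1 \<bar>x\<bar> powr e)"]) simp_all
  also have "\<dots> < \<infinity>"
    using integrable_max_powr[OF e] by (simp add: ennreal_prod_eq_top power_less_top_ennreal)
  finally have "(\<integral>\<^sup>+x. ennreal (norm (\<Prod>b\<in>Basis. max 1 \<bar>(x::'a) \<bullet> b\<bar> powr e)) \<partial>lborel) < \<infinity>"
    by (simp add: prod_ennreal prod_nonneg abs_prod)
  then show ?thesis by (intro integrableI_bounded) auto
qed

text \<open>After dilating \<open>\<eta>\<close> to size one, a function homogeneous of degree \<open>- d\<close> is evaluated on a
  compact set only; this is where the decay in \<open>\<eta>\<close> comes from.\<close>

lemma homogeneous_decay:
  fixes F :: "'p::euclidean_space \<times> 'b::euclidean_space \<Rightarrow> real" and cp :: "'p \<Rightarrow> real" and cb :: "'b \<Rightarrow> real"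
  assumes cp: "\<And>b. b \<in> Basis \<Longrightarrow> cp b > 0" and cb: "\<And>b. b \<in> Basis \<Longrightarrow> cb b > 0"
    and q: "(\<Sum>b\<in>Basis. cb b) < d"
    and cont: "continuous_on W F"
    and hom: "\<And>r p. r > 0 \<Longrightarrow> p \<in> W \<Longrightarrow> F (wdil (pweight cp cb) r p) = r powr (- d) * F p"
    and W: "\<And>k \<eta>. \<eta> \<noteq> 0 \<Longrightarrow> (k, \<eta>) \<in> W" and K: "compact K" "\<And>k \<eta>. k \<in> K \<Longrightarrow> (k, \<eta>) \<in> W"
  obtains g where "integrable lborel g" "\<And>k \<eta>. k \<in> K \<Longrightarrow> \<bar>F (k, \<eta>)\<bar> \<le> g \<eta>"
proof -
  let ?q = "\<Sum>b\<in>Basis. cb b"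
  \<comment> \<open>With this exponent \<open>r powr d\<close> is the product over \<open>b\<close>
    of \<open>(r powr cb b) powr e\<close>, and each factor is at most
    \<open>max 1 \<bar>\<eta> \<bullet> b\<bar> powr (- e)\<close>. The condition
    \<open>e > 1\<close> for integrability is the hypothesis that the fibre weights sum to less than
    \<open>d\<close>.\<close>
  define e where "e = d / ?q"
  have q0: "?q > 0" using cb by (intro sum_pos) auto
  then have e: "e > 1" using q by (simp add: e_def)
  have bK: "bounded K" using K(1) by (rule compact_imp_bounded)
  then obtain R where R: "\<forall>k\<in>K. norm k \<le> R" unfolding bounded_iff by blast
  \<comment> \<open>Two compact sets receive the dilated point. For \<open>r < 1\<close> the dilated
    \<open>k\<close> may leave \<open>K\<close> but stays in a box, and some coordinate of the
    dilated \<open>\<eta>\<close> equals 1 in absolute value, which puts the point in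
    \<open>W\<close>; this is \<open>S'\<close>. For \<open>r = 1\<close> the fibre variable may be
    0, but \<open>k\<close> is still in \<open>K\<close>; this is \<open>S1\<close>.\<close>
  define S' where "S' = (cbox (- (\<bar>R\<bar> *\<^sub>R One)) (\<bar>R\<bar> *\<^sub>R One) :: 'p set) \<times> \<Union>((\<lambda>b. cbox (- One) One \<inter> {\<eta>::'b. \<bar>\<eta> \<bullet> b\<bar> = 1}) ` Basis)"
  define S1 where "S1 = K \<times> (cbox (- One) One :: 'b set)"
  have "closed {\<eta>::'b. \<bar>\<eta> \<bullet> b\<bar> = 1}" for b
    by (intro closed_Collect_eq continuous_intros)
  then have S': "compact S'"
    unfolding S'_def by (intro compact_Times compact_cbox compact_UN finite_Basis compact_Int_closed) auto
  have S1: "compact S1" unfolding S1_def by (intro compact_Times K(1) compact_cbox)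
  have "S' \<subseteq> W"
  proof
    fix p assume "p \<in> S'"
    then have "snd p \<noteq> 0" by (auto simp: S'_def)
    then show "p \<in> W" using W[of "snd p" "fst p"] by simp
  qed
  moreover have "S1 \<subseteq> W" unfolding S1_def using K(2) by auto
  ultimately have "compact (F ` (S' \<union> S1))"
    by (intro compact_continuous_image continuous_on_subset[OF cont] compact_Un S' S1) auto
  then have "bounded (F ` (S' \<union> S1))" by (rule compact_imp_bounded)
  then obtain B where B: "\<forall>x\<in>F ` (S' \<union> S1). norm x \<le> B"
    unfolding bounded_iff by blast
  define g where "g \<eta> = \<bar>B\<bar> * (\<Prod>b\<in>Basis. max 1 \<bar>\<eta> \<bullet> b\<bar> powr (- e))" for \<eta> :: 'b
  have "integrable lborel g"
    unfolding g_def[abs_def] using e by (intro integrable_mult_right integrable_prod_max_powr) auto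
  moreover have "\<bar>F (k, \<eta>)\<bar> \<le> g \<eta>" if k: "k \<in> K" for k \<eta>
  proof -
    obtain r where r: "0 < r" "r \<le> 1" and r1: "\<And>b. b \<in> Basis \<Longrightarrow> \<bar>wdil cb r \<eta> \<bullet> b\<bar> \<le> 1"
      and r2: "r = 1 \<or> (\<exists>b\<in>Basis. \<bar>wdil cb r \<eta> \<bullet> b\<bar> = 1)"
      using wdil_normalize[of cb \<eta>] cb by metis
    have box: "wdil cb r \<eta> \<in> cbox (- One) One"
      using r1 by (auto simp: mem_box abs_le_iff simp del: wdil_inner)
    have "\<bar>F (wdil (pweight cp cb) r (k, \<eta>))\<bar> \<le> \<bar>B\<bar>"
    proof -
      have "wdil (pweight cp cb) r (k, \<eta>) \<in> S' \<union> S1"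
      proof (cases "r = 1")
        case True
        then show ?thesis using box k by (simp add: S1_def wdil_pweight)
      next
        case False
        then obtain b where b: "b \<in> Basis" "\<bar>wdil cb r \<eta> \<bullet> b\<bar> = 1" using r2 by blast
        have "\<bar>wdil cp r k \<bullet> b\<bar> \<le> \<bar>R\<bar>" if b: "b \<in> Basis" for b
        proof -
          have "r powr cp b \<le> 1" using r cp[OF b] by (intro powr_le1) auto
          then have "r powr cp b * \<bar>k \<bullet> b\<bar> \<le> 1 * \<bar>k \<bullet> b\<bar>" by (rule mult_right_mono) simp
          also have "\<dots> \<le> norm k" using Basis_le_norm[OF b] by simp
          also have "\<dots> \<le> \<bar>R\<bar>" using R k by force
          finally show ?thesis using b by (simp add: abs_mult)
        qed
        then have "wdil cp r k \<in> cbox (- (\<bar>R\<bar> *\<^sub>R One)) (\<bar>R\<bar> *\<^sub>R One)"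
          by (auto simp: mem_box abs_le_iff minus_le_iff simp del: wdil_inner)
        then show ?thesis using b box by (auto simp: S'_def wdil_pweight simp del: wdil_inner)
      qed
      then have "norm (F (wdil (pweight cp cb) r (k, \<eta>))) \<le> B" using B by blast
      then show ?thesis by simp
    qed
    then have "r powr (- d) * \<bar>F (k, \<eta>)\<bar> \<le> \<bar>B\<bar>"
      using hom[OF r(1) K(2)[OF k]] by (simp add: abs_mult)
    then have "\<bar>F (k, \<eta>)\<bar> \<le> \<bar>B\<bar> * r powr d"
      using r by (simp add: powr_minus field_simps)
    also have "r powr d = (\<Prod>b\<in>Basis. (r powr cb b) powr e)"
    proof -
      have "d = ?q * e" using q0 by (simp add: e_def)
      then have "d = (\<Sum>b\<in>Basis. cb b * e)" by (simp only: sum_distrib_right)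
      then show ?thesis using r by (simp add: powr_sum powr_powr)
    qed
    also have "\<bar>B\<bar> * \<dots> \<le> g \<eta>"
      unfolding g_def
    proof (intro mult_left_mono prod_mono conjI)
      fix b :: 'b assume b: "b \<in> Basis"
      have "r powr cb b * max 1 \<bar>\<eta> \<bullet> b\<bar> \<le> 1"
        using r1[OF b] b r cb[OF b] powr_le1[of "cb b" r] by (simp add: max_def abs_mult)
      then have "r powr cb b \<le> 1 / max 1 \<bar>\<eta> \<bullet> b\<bar>"
        by (subst le_divide_eq) auto
      then have "(r powr cb b) powr e \<le> (1 / max 1 \<bar>\<eta> \<bullet> b\<bar>) powr e"
        using e r by (intro powr_mono2) auto
      also have "\<dots> = max 1 \<bar>\<eta> \<bullet> b\<bar> powr (- e)"
        by (simp add: powr_minus powr_divide inverse_eq_divide)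
      finally show "(r powr cb b) powr e \<le> max 1 \<bar>\<eta> \<bullet> b\<bar> powr (- e)" .
    qed auto
    finally show ?thesis .
  qed
  ultimately show ?thesis using that by blast
qed

lemma wdil_Basis: "b \<in> Basis \<Longrightarrow> wdil c r b = (r powr c b) *\<^sub>R b"
  by (rule euclidean_eqI) (auto simp: inner_Basis)

text \<open>A basis vector \<open>b\<close> is an eigenvector of the dilation with eigenvalue
  \<open>r powr c b\<close>, so differentiating the homogeneity relation along \<open>b\<close>
  lowers the degree by the weight of \<open>b\<close>.\<close>

lemma homogeneous_derivative:
  fixes F :: "'a::euclidean_space \<Rightarrow> real"
  assumes W: "open W" and F: "smooth_on W F"
    and inv: "\<And>p. p \<in> W \<Longrightarrow> wdil c r p \<in> W"
    and hom: "\<And>p. p \<in> W \<Longrightarrow> F (wdil c r p) = r powr (- d) * F p"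
    and r: "r > 0" and p: "p \<in> W" and b: "b \<in> Basis"
  shows "frechet_derivative F (at (wdil c r p)) b = r powr (- (d + c b)) * frechet_derivative F (at p) b"
proof -
  have Fp: "(F has_derivative frechet_derivative F (at p)) (at p)"
    by (rule smooth_on_has_derivative[OF F W p])
  have F': "(F has_derivative frechet_derivative F (at (wdil c r p))) (at (wdil c r p))"
    by (rule smooth_on_has_derivative[OF F W inv[OF p]])
  have "((\<lambda>p. F (wdil c r p)) has_derivative (\<lambda>h. frechet_derivative F (at (wdil c r p)) (wdil c r h))) (at p)"
    by (rule has_derivative_compose[OF bounded_linear_imp_has_derivative[OF bounded_linear_wdil] F'])
  moreover have "((\<lambda>p. F (wdil c r p)) has_derivative (\<lambda>h. r powr (- d) * frechet_derivative F (at p) h)) (at p)"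
    by (rule has_derivative_transform_within_open[OF has_derivative_mult_right[OF Fp] W p]) (simp add: hom)
  ultimately have "frechet_derivative F (at (wdil c r p)) (wdil c r b) = r powr (- d) * frechet_derivative F (at p) b"
    using has_derivative_unique by metis
  then have "r powr c b * frechet_derivative F (at (wdil c r p)) b = r powr (- d) * frechet_derivative F (at p) b"
    using b has_derivative_linear[OF F'] by (simp add: wdil_Basis linear_scale)
  then have "r powr (- c b) * (r powr c b * frechet_derivative F (at (wdil c r p)) b) = r powr (- c b) * (r powr (- d) * frechet_derivative F (at p) b)"
    by simp
  then show ?thesis using r by (simp add: mult.assoc[symmetric] powr_add[symmetric] algebra_simps)
qed

text \<open>The family of integrands consists of all smooth functions on \<open>W\<close> that are
  homogeneous of some degree \<open>- d\<close> with \<open>d\<close> above the sum of the fibre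
  weights. A derivative in the parameter raises \<open>d\<close>, hence \<open>d\<close> is
  quantified inside the family. Working on \<open>W\<close> rather than over \<open>\<Omega>\<close>
  leaves room for the dilations, which move the parameter too.\<close>

lemma smooth_on_integral_homogeneous:
  fixes G :: "'p::euclidean_space \<times> 'b::euclidean_space \<Rightarrow> real" and cp :: "'p \<Rightarrow> real" and cb :: "'b \<Rightarrow> real"
  assumes cp: "\<And>b. b \<in> Basis \<Longrightarrow> cp b > 0" and cb: "\<And>b. b \<in> Basis \<Longrightarrow> cb b > 0"
    and q: "(\<Sum>b\<in>Basis. cb b) < d"
    and W: "open W" and G: "smooth_on W G"
    and inv: "\<And>r p. r > 0 \<Longrightarrow> p \<in> W \<Longrightarrow> wdil (pweight cp cb) r p \<in> W"
    and hom: "\<And>r p. r > 0 \<Longrightarrow> p \<in> W \<Longrightarrow> G (wdil (pweight cp cb) r p) = r powr (- d) * G p"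
    and W0: "\<And>k \<eta>. \<eta> \<noteq> 0 \<Longrightarrow> (k, \<eta>) \<in> W"
    and \<Omega>: "open \<Omega>" "\<And>k \<eta>. k \<in> \<Omega> \<Longrightarrow> (k, \<eta>) \<in> W"
  shows "smooth_on \<Omega> (\<lambda>k. \<integral>\<eta>. G (k, \<eta>) \<partial>lborel)"
proof -
  define HH where "HH = {F. smooth_on W F \<and> (\<exists>d. (\<Sum>b\<in>Basis. cb b) < d \<and>
    (\<forall>r p. r > 0 \<longrightarrow> p \<in> W \<longrightarrow> F (wdil (pweight cp cb) r p) = r powr (- d) * F p))}"
  define FF where "FF = (\<lambda>F k \<eta>. F (k, \<eta>)) ` HH"
  have diff: "F differentiable (at p)" if "F \<in> HH" "p \<in> W" for F p
    using that smooth_on_differentiable[OF _ W] by (auto simp: HH_def)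
  show ?thesis
  proof (rule smooth_on_integral_family[where FF = FF, OF \<Omega>(1)])
    fix F x assume "F \<in> FF" and x: "x \<in> \<Omega>"
    then obtain F' where F: "F = (\<lambda>k \<eta>. F' (k, \<eta>))" and F': "F' \<in> HH" unfolding FF_def by blast
    have cont: "continuous_on W F'"
      by (rule smooth_on_imp_continuous_on) (use F' in \<open>simp add: HH_def\<close>)
    have "continuous_on UNIV (\<lambda>\<eta>. F' (x, \<eta>))"
      by (rule continuous_on_compose2[OF cont, of UNIV "\<lambda>\<eta>. (x, \<eta>)"]) (use \<Omega>(2)[OF x] in \<open>auto intro!: continuous_intros\<close>)
    from borel_measurable_continuous_onI[OF this] show "F x \<in> borel_measurable lborel"
      by (simp add: F)
    show "(\<lambda>x. F x \<eta>) differentiable at x" if "\<eta> \<in> space lborel" for \<eta>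
      unfolding F by (rule differentiableI[OF slice_has_derivative_fst[OF diff[OF F' \<Omega>(2)[OF x]]]])
    obtain d where d: "(\<Sum>b\<in>Basis. cb b) < d"
      "\<And>r p. r > 0 \<Longrightarrow> p \<in> W \<Longrightarrow> F' (wdil (pweight cp cb) r p) = r powr (- d) * F' p"
      using F' by (auto simp: HH_def)
    obtain \<epsilon> where \<epsilon>: "\<epsilon> > 0" "cball x \<epsilon> \<subseteq> \<Omega>"
      using \<Omega>(1) x open_contains_cball by blast
    obtain g where "integrable lborel g" "\<And>k \<eta>. k \<in> cball x \<epsilon> \<Longrightarrow> \<bar>F' (k, \<eta>)\<bar> \<le> g \<eta>"
      by (rule homogeneous_decay[OF cp cb d(1) cont d(2) W0 compact_cball[of x \<epsilon>]]) (use \<epsilon>(2) \<Omega>(2) in auto)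
    then show "\<exists>e>0. \<exists>g. integrable lborel g \<and> (\<forall>y\<in>ball x e. \<forall>\<eta>\<in>space lborel. \<bar>F y \<eta>\<bar> \<le> g \<eta>)"
      using \<epsilon>(1) by (intro exI[of _ \<epsilon>] conjI exI[of _ g]) (auto simp: F)
  next
    fix F and v :: 'p assume "F \<in> FF" and v: "v \<in> Basis"
    then obtain F' where F: "F = (\<lambda>k \<eta>. F' (k, \<eta>))" and F': "F' \<in> HH" unfolding FF_def by blast
    obtain d where s: "smooth_on W F'" and d: "(\<Sum>b\<in>Basis. cb b) < d"
      "\<And>r p. r > 0 \<Longrightarrow> p \<in> W \<Longrightarrow> F' (wdil (pweight cp cb) r p) = r powr (- d) * F' p"
      using F' by (auto simp: HH_def)
    let ?D = "\<lambda>p. frechet_derivative F' (at p) (v, 0)"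
    have v0: "(v, 0) \<in> (Basis :: ('p \<times> 'b) set)" using v by (auto simp: Basis_prod_def)
    have "smooth_on W ?D"
      by (rule smooth_on_frechet_derivative_Basis[OF s v0])
    moreover have "pweight cp cb (v, 0) = cp v" by (simp add: pweight_def)
    then have "\<forall>r p. r > 0 \<longrightarrow> p \<in> W \<longrightarrow> ?D (wdil (pweight cp cb) r p) = r powr (- (d + cp v)) * ?D p"
      using homogeneous_derivative[OF W s inv d(2) _ _ v0] by simp
    moreover have "(\<Sum>b\<in>Basis. cb b) < d + cp v" using d(1) cp[OF v] by simp
    ultimately have "?D \<in> HH" unfolding HH_def by (intro CollectI conjI exI[of _ "d + cp v"])
    then have "(\<lambda>k \<eta>. ?D (k, \<eta>)) \<in> FF"
      unfolding FF_def by (rule image_eqI[where x = ?D, rotated]) simp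
    then show "\<exists>F'\<in>FF. \<forall>x\<in>\<Omega>. \<forall>\<eta>\<in>space lborel. frechet_derivative (\<lambda>x. F x \<eta>) (at x) v = F' x \<eta>"
      by (rule bexI[rotated]) (simp add: F slice_frechet_derivative_fst diff[OF F' \<Omega>(2)])
  next
    have "G \<in> HH" using G q hom unfolding HH_def by (intro CollectI conjI exI[of _ d]) auto
    then show "(\<lambda>k \<eta>. G (k, \<eta>)) \<in> FF"
      unfolding FF_def by (rule image_eqI[where x = G, rotated]) simp
  qed
qed

text \<open>Both endpoints and the fibre variable are dilated together. The argument of
  \<open>\<gamma>\<close> is then equivariant, and it meets the pole only where the endpoints
  coincide and the fibre variable is 0; hence the domain \<open>W\<close>.\<close>

lemma smooth_on_group_integral:
  fixes star :: "'a::euclidean_space \<times> 'b::euclidean_space \<Rightarrow> 'a \<times> 'b \<Rightarrow> 'a \<times> 'b"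
    and \<gamma> :: "real \<times> ('a \<times> 'b) \<Rightarrow> real"
  assumes G: "hom_group star (pweight ca cb)"
    and ca: "\<And>b. b \<in> Basis \<Longrightarrow> ca b > 0" and cb: "\<And>b. b \<in> Basis \<Longrightarrow> cb b > 0"
    and \<gamma>: "smooth_on (UNIV - {0}) \<gamma>"
    and hom: "\<And>r w. r > 0 \<Longrightarrow> w \<noteq> 0 \<Longrightarrow> \<gamma> (wdil (time_weight (pweight ca cb)) r w)
      = r powr (- (\<Sum>b\<in>Basis. pweight ca cb b)) * \<gamma> w"
  shows "smooth_on {p. fst p \<noteq> snd p}
    (\<lambda>p. \<integral>\<eta>. \<gamma> (fst (snd p) - fst (fst p), star (grp_inv star (snd (fst p), 0)) (snd (snd p), \<eta>)) \<partial>lborel)"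
proof -
  interpret hom_group star "pweight ca cb" by (rule G)
  let ?t = "time_weight ca"
  let ?C = "pweight (pweight ?t ?t) cb"
  define M where "M p = (fst (snd (fst p)) - fst (fst (fst p)), star (gi (snd (fst (fst p)), 0)) (snd (snd (fst p)), snd p))"
    for p :: "((real \<times> 'a) \<times> (real \<times> 'a)) \<times> 'b"
  define W where "W = {p :: ((real \<times> 'a) \<times> (real \<times> 'a)) \<times> 'b. fst (fst p) \<noteq> snd (fst p) \<or> snd p \<noteq> 0}"
  have M0: "M p \<noteq> 0 \<longleftrightarrow> p \<in> W" for p
  proof -
    have "M p = 0 \<longleftrightarrow> fst (snd (fst p)) - fst (fst (fst p)) = 0
        \<and> star (gi (snd (fst (fst p)), 0)) (snd (snd (fst p)), snd p) = 0"
      unfolding M_def by (simp only: prod_eq_iff[of _ "0 :: real \<times> ('a \<times> 'b)"] fst_conv snd_conv fst_zero snd_zero)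
    then have M0: "M p = 0 \<longleftrightarrow> fst (snd (fst p)) - fst (fst (fst p)) = 0
        \<and> (snd (fst (fst p)), 0) = (snd (snd (fst p)), snd p)"
      by (simp only: gi_star_eq_0_iff)
    show ?thesis unfolding M0 W_def by (auto simp: prod_eq_iff)
  qed
  have M_smooth: "smooth_map_on S M" if "open S" for S
    unfolding M_def[abs_def]
    by (intro smooth_map_on_Pair smooth_star_comp smooth_gi_comp that smooth_map_on_const
        smooth_map_on_fst smooth_map_on_snd smooth_map_on_id smooth_map_on_bounded_linear bounded_linear_sub bounded_linear_intros)
  have M_wdil: "M (wdil ?C r p) = wdil (time_weight (pweight ca cb)) r (M p)" if "r > 0" for r p
  proof -
    have "wdil (time_weight (pweight ca cb)) r (M p) = (r powr 2 * (fst (snd (fst p)) - fst (fst (fst p))),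
        star (gi (wdil (pweight ca cb) r (snd (fst (fst p)), 0))) (wdil (pweight ca cb) r (snd (snd (fst p)), snd p)))"
      by (subst wdil_pweight[of "\<lambda>_. 2" "pweight ca cb"])
        (simp only: M_def fst_conv snd_conv wdil_2_real wdil_star[OF that] wdil_gi[OF that])
    then show ?thesis
      by (simp add: M_def wdil_pweight wdil_2_real right_diff_distrib del: powr_numeral)
  qed
  have W: "open W"
  proof -
    have "W = (\<lambda>p. (fst (fst p) - snd (fst p), snd p)) -` (- {0})"
      by (auto simp: W_def zero_prod_def)
    moreover have "open ((\<lambda>p :: ((real \<times> 'a) \<times> (real \<times> 'a)) \<times> 'b. (fst (fst p) - snd (fst p), snd p)) -` (- {0}))"
      by (intro open_vimage continuous_intros)
    ultimately show ?thesis by simp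
  qed
  have inv: "wdil ?C r p \<in> W" if "r > 0" "p \<in> W" for r p
    using that M0[of p] M0[of "wdil ?C r p"] M_wdil[OF that(1), of p] by simp
  have sG: "smooth_on W (\<lambda>p. \<gamma> (M p))"
  proof (rule smooth_on_compose[OF \<gamma> M_smooth[OF W] _ W])
    show "M ` W \<subseteq> UNIV - {0}"
    proof
      fix w assume "w \<in> M ` W"
      then obtain p where "w = M p" "p \<in> W" by (rule imageE)
      then show "w \<in> UNIV - {0}" using M0[of p] by simp
    qed
  qed (simp add: open_Diff)
  have "smooth_on {p. fst p \<noteq> snd p} (\<lambda>k. \<integral>\<eta>. \<gamma> (M (k, \<eta>)) \<partial>lborel)"
  proof (rule smooth_on_integral_homogeneous[where cp = "pweight ?t ?t" and cb = cb
        and d = "\<Sum>b\<in>Basis. pweight ca cb b", OF _ cb _ W sG inv])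
    show "0 < pweight ?t ?t b" if "b \<in> Basis" for b
      using that by (intro pweight_pos) (auto simp: ca)
    \<comment> \<open>The gap between the fibre weights and the full homogeneous dimension is the
      sum of the weights of \<open>x\<close>, positive because \<open>Basis\<close> is
      nonempty.\<close>
    have "(\<Sum>b\<in>Basis. ca b) > 0" using ca by (intro sum_pos) auto
    then show "(\<Sum>b\<in>Basis. cb b) < (\<Sum>b\<in>Basis. pweight ca cb b)" by (simp add: sum_pweight)
    show "\<gamma> (M (wdil ?C r p)) = r powr - (\<Sum>b\<in>Basis. pweight ca cb b) * \<gamma> (M p)" if "r > 0" "p \<in> W" for r p
      using hom[OF that(1)] M0[of p] that(2) M_wdil[OF that(1), of p] by simp
    show "open {p :: (real \<times> 'a) \<times> (real \<times> 'a). fst p \<noteq> snd p}"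
      by (intro open_Collect_neq continuous_intros)
  qed (auto simp: W_def)
  then show ?thesis by (simp add: M_def)
qed

section \<open>Translation of indexed exponents into weights on basis vectors\<close>

lemma dil_eq_wdil:
  fixes \<sigma> :: "'i::finite \<Rightarrow> real"
  shows "dil \<sigma> r = wdil (\<lambda>b. \<sigma> (axis_index b)) r"
proof
  fix x :: "real^'i"
  show "dil \<sigma> r x = wdil (\<lambda>b. \<sigma> (axis_index b)) r x"
  proof (rule euclidean_eqI)
    fix b :: "real^'i" assume b: "b \<in> Basis"
    then obtain i where i: "b = axis i 1" by (auto simp: Basis_vec_def)
    then have "axis_index b = i"
      unfolding axis_index_def by (intro some_equality) (auto simp: axis_eq_axis)
    then show "dil \<sigma> r x \<bullet> b = wdil (\<lambda>b. \<sigma> (axis_index b)) r x \<bullet> b"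
      unfolding wdil_inner[OF b] by (simp add: i inner_axis dil_def)
  qed
qed

lemma prod_dil_eq_wdil: "prod_dil \<sigma> \<sigma>s = wdil (pweight (\<lambda>b. \<sigma> (axis_index b)) (\<lambda>b. \<sigma>s (axis_index b)))"
  by (intro ext) (simp add: prod_dil_def wdil_pweight dil_eq_wdil)

theorem theorem5p6:
  fixes X :: "nat \<Rightarrow> (real, 'n::{finite,linorder}) vec \<Rightarrow> (real, 'n) vec"
    and m :: nat
    and \<sigma> :: "'n \<Rightarrow> real"
    and \<sigma>s :: "'p::finite \<Rightarrow> real"
    and star :: "((real, 'n) vec) \<times> (real^'p) \<Rightarrow> ((real, 'n) vec) \<times> (real^'p) \<Rightarrow> ((real, 'n) vec) \<times> (real^'p)"
    and Z :: "nat \<Rightarrow> ((real, 'n) vec) \<times> (real^'p) \<Rightarrow> ((real, 'n) vec) \<times> (real^'p)"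
    and \<gamma> :: "real \<times> (((real, 'n) vec) \<times> (real^'p)) \<Rightarrow> real"
  assumes X_smooth: "\<forall>j\<in>{1..m}. smooth_map_on UNIV (X j)"
    and X_indep: "fun_lin_indep X {1..m}"
    and \<sigma>_first: "\<forall>i. (\<forall>k. i \<le> k) \<longrightarrow> \<sigma> i = 1"
    and \<sigma>_mono: "mono \<sigma>"
    and H1: "\<forall>j\<in>{1..m}. \<forall>r>0. \<forall>f. smooth_on UNIV f \<longrightarrow>
               vf_apply (X j) (f \<circ> dil \<sigma> r) = (\<lambda>x. r * vf_apply (X j) f (dil \<sigma> r x))"
    and H2: "dim {Y 0 | Y. Y \<in> lie_gen (X ` {1..m})} = CARD('n)"
    and N_dim: "fun_space_dim (lie_gen (X ` {1..m})) (CARD('n) + CARD('p))"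
    and \<sigma>s_pos: "\<forall>k. \<sigma>s k > 0"
    and G_group: "hom_lie_group star (prod_dil \<sigma> \<sigma>s)"
    and Z_field: "\<forall>i\<in>{1..m}. Z i \<in> group_lie_algebra star"
    and Z_hom: "\<forall>i\<in>{1..m}. homogeneous_deg1 (prod_dil \<sigma> \<sigma>s) (Z i)"
    and Z_gen: "lie_gen (Z ` {1..m}) = group_lie_algebra star"
    and Z_lift: "\<forall>i\<in>{1..m}. \<forall>f. smooth_on UNIV f \<longrightarrow>
                  (\<forall>x \<xi>. vf_apply (Z i) (\<lambda>w. f (fst w)) (x, \<xi>) = vf_apply (X i) f x)"
    and \<gamma>_fund: "heat_fundamental_solution Z m \<gamma>"
  shows "smooth_on {(a, b). a \<noteq> b} (\<lambda>(a, b). Gamma_kernel star \<gamma> a b)"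
proof -
  let ?ca = "\<lambda>b::(real, 'n) vec. \<sigma> (axis_index b)" and ?cb = "\<lambda>b::real^'p. \<sigma>s (axis_index b)"
  have "\<sigma> i > 0" for i
  proof -
    \<comment> \<open>The least index carries the exponent 1 and \<open>\<sigma>\<close> is
      monotone, so every exponent is at least 1.\<close>
    have "\<sigma> (Min UNIV) = 1" using \<sigma>_first by simp
    moreover have "\<sigma> (Min UNIV) \<le> \<sigma> i" using \<sigma>_mono by (rule monoD) simp
    ultimately show ?thesis by simp
  qed
  then have ca: "\<And>b. b \<in> Basis \<Longrightarrow> ?ca b > 0" by blast
  have cb: "\<And>b. b \<in> Basis \<Longrightarrow> ?cb b > 0" using \<sigma>s_pos by blast
  have G: "hom_group star (pweight ?ca ?cb)"
    using G_group pweight_pos[OF ca cb] by unfold_locales (auto simp: prod_dil_eq_wdil)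
  have hom: "\<gamma> (wdil (time_weight (pweight ?ca ?cb)) r w) = r powr (- (\<Sum>b\<in>Basis. pweight ?ca ?cb b)) * \<gamma> w"
    if "r > 0" "w \<noteq> 0" for r w
    by (rule hom_group.heat_fundamental_solution_homogeneous[OF G _ _ _ \<gamma>_fund that])
      (use Z_field Z_hom in \<open>auto simp: group_lie_algebra_def prod_dil_eq_wdil\<close>)
  have "smooth_on (UNIV - {0}) \<gamma>"
    using \<gamma>_fund by (simp add: heat_fundamental_solution_def)
  from smooth_on_group_integral[OF G ca cb this hom] show ?thesis
    by (simp add: Gamma_kernel_def[abs_def] case_prod_unfold)
qed

end
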